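(* Let $C$ be a symmetrizable generalized Cartan matrix with symmetrizer $D$ and orientation $\Omega$, and let $H(k)=H(C,kD,\Omega)$. For $k\ge 2$ the reduction functor $$R_{\mathrm{l.f.}}\colon \mathrm{rep}_{\mathrm{l.f.}}(H(k))\to\mathrm{rep}_{\mathrm{l.f.}}(H(k-1)),\qquad M\mapsto M/\varepsilon^{k-1}M,$$ induces a bijection between the isomorphism classes of rigid locally free $H(k)$-modules and the isomorphism classes of rigid locally free $H(k-1)$-modules.
   Context: $K$ is an algebraically closed field, $\mathbb N=\{0,1,2,\ldots\}$; modules are finite-dimensional left modules. The algebra $H(C,D,\Omega)$: $C=(c_{ij})\in M_n(\mathbb Z)$ satisfies $c_{ii}=2$ and $c_{ij}\le 0$ for $i\ne j$; a symmetrizer is $D=\mathrm{diag}(c_1,\ldots,c_n)$ with $c_i\in\mathbb Z_{>0}$ and $c_ic_{ij}=c_jc_{ji}$ for all $i,j$. When $c_{ij}<0$ put $g_{ij}=|\gcd(c_{ij},c_{ji})|$, $f_{ij}=|c_{ij}|/g_{ij}$. An orientation is a subset $\Omega\subset\{1,\ldots,n\}^2$ such that $\{(i,j),(j,i)\}\cap\Omega\neq\varnothing$ iff $c_{ij}<0$, and such that for each sequence $(i_1,i_2),(i_2,i_3),\ldots,(i_t,i_{t+1})$ of elements of $\Omega$ with $t\ge 1$ one has $i_1\neq i_{t+1}$. Let $Q$ be the quiver with vertices $1,\ldots,n$ and arrows $\alpha_{ij}^{(g)}\colon j\to i$ for $(i,j)\in\Omega$, $1\le g\le g_{ij}$, and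 loops $\varepsilon_i\colon i\to i$ for $1\le i\le n$. Then $H(C,D,\Omega)=KQ/I$, where $I$ is generated by the relations $\varepsilon_i^{c_i}=0$ for all $i$ and $\varepsilon_i^{f_{ji}}\alpha_{ij}^{(g)}=\alpha_{ij}^{(g)}\varepsilon_j^{f_{ij}}$ for all $(i,j)\in\Omega$, $1\le g\le g_{ij}$. The algebra $H(k)=H(C,kD,\Omega)$ is defined in the same way with each $c_i$ in $D$ replaced by $kc_i$. Let $H_i(k)\cong K[x]/(x^{kc_i})$ be the subalgebra of $H(k)$ generated by $\varepsilon_i$. An $H(k)$-module $M$, viewed as a representation $(M_i,M(\varepsilon_i),M(\alpha_{ij}^{(g)}))$, is locally free if each $M_i$ is a free $H_i(k)$-module; $\mathrm{rep}_{\mathrm{l.f.}}(H(k))$ is the category of locally free $H(k)$-modules. A module $M$ is rigid if $\mathrm{Ext}^1_{H(k)}(M,M)=0$. The element $\varepsilon=\sum_{i=1}^n\varepsilon_i^{c_i}$ is central in $H(k)$ and, for $k\ge 2$, $H(k)/(\varepsilon^{k-1}H(k))\cong H(k-1)$, so $M/\varepsilon^{k-1}M$ is an $H(k-1)$-module; it is locally free if $M$ is. *)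

theory Defs
  imports
    "HOL-Analysis.Finite_Cartesian_Product"
    "HOL-Computational_Algebra.Polynomial"
    "HOL-Algebra.QuotRing"
    "HOL-Algebra.Module"
    "Graph_Theory.Arc_Walk"
begin

section \<open>Path algebras\<close>

text \<open>
  A path is a triple \<open>(u, p, v)\<close>: it starts in \<open>u\<close>, traverses the arcs in the list \<open>p\<close> from left
  to right, and ends in \<open>v\<close>; \<open>(u, [], u)\<close> is the path of length 0 at \<open>u\<close>.  Arrows compose like
  maps, so the product \<open>a * b\<close> means first \<open>b\<close>, then \<open>a\<close>, and \<open>b\<close> is the initial part of the list.
\<close>

type_synonym ('v, 'e) path = "'v \<times> 'e list \<times> 'v"

definition path_algebra ::
    "('v::finite, 'e) pre_digraph \<Rightarrow> (('v, 'e) path \<Rightarrow> 'k::field) ring" where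
  "path_algebra G =
    \<lparr> carrier = {a. finite {x. a x \<noteq> 0} \<and>
                    (\<forall>u p v. a (u, p, v) \<noteq> 0 \<longrightarrow> pre_digraph.awalk G u p v)},
      mult = (\<lambda>a b (u, p, v). \<Sum>l\<le>length p. \<Sum>w\<in>UNIV. a (w, drop l p, v) * b (u, take l p, w)),
      one = (\<lambda>(u, p, v). if p = [] \<and> u = v \<and> u \<in> verts G then 1 else 0),
      zero = (\<lambda>_. 0),
      add = (\<lambda>a b x. a x + b x) \<rparr>"

definition path_elem :: "('v, 'e) path \<Rightarrow> ('v, 'e) path \<Rightarrow> 'k::field" where
  "path_elem x = (\<lambda>y. if y = x then 1 else 0)"

definition arc_elem :: "('v, 'e) pre_digraph \<Rightarrow> 'e \<Rightarrow> ('v, 'e) path \<Rightarrow> 'k::field" where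
  "arc_elem G e = path_elem (tail G e, [e], head G e)"


section \<open>The algebras \<open>H(C,D,\<Omega>)\<close>\<close>

text \<open>
  The index set \<open>{1,\<dots>,n}\<close> is the finite type \<open>'n\<close>, so \<open>C $ i $ j\<close> is the entry in row \<open>i\<close> and
  column \<open>j\<close>.  A diagonal matrix \<open>D\<close> is given by the function \<open>c\<close> of its diagonal entries.
\<close>

definition generalized_cartan_matrix :: "int^'n^'n \<Rightarrow> bool" where
  "generalized_cartan_matrix C \<longleftrightarrow>
     (\<forall>i. C $ i $ i = 2) \<and> (\<forall>i j. i \<noteq> j \<longrightarrow> C $ i $ j \<le> 0)"

definition symmetrizer :: "int^'n^'n \<Rightarrow> ('n \<Rightarrow> nat) \<Rightarrow> bool" where
  "symmetrizer C c \<longleftrightarrow>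
     (\<forall>i. 0 < c i) \<and> (\<forall>i j. int (c i) * C $ i $ j = int (c j) * C $ j $ i)"

definition orientation :: "int^'n^'n \<Rightarrow> ('n \<times> 'n) set \<Rightarrow> bool" where
  "orientation C \<Omega> \<longleftrightarrow>
     (\<forall>i j. {(i, j), (j, i)} \<inter> \<Omega> \<noteq> {} \<longleftrightarrow> C $ i $ j < 0) \<and> acyclic \<Omega>"

definition g_num :: "int^'n^'n \<Rightarrow> 'n \<Rightarrow> 'n \<Rightarrow> nat" where
  "g_num C i j = nat \<bar>gcd (C $ i $ j) (C $ j $ i)\<bar>"

definition f_num :: "int^'n^'n \<Rightarrow> 'n \<Rightarrow> 'n \<Rightarrow> nat" where
  "f_num C i j = nat \<bar>C $ i $ j\<bar> div g_num C i j"

text \<open>\<open>Alpha i j g\<close> is the arrow \<open>\<alpha>\<^sub>i\<^sub>j\<^sup>(\<^sup>g\<^sup>) : j \<rightarrow> i\<close>, and \<open>Eps i\<close> is the loop \<open>\<epsilon>\<^sub>i\<close>.\<close>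

datatype 'n arrow = Alpha 'n 'n nat | Eps 'n

fun arrow_tail :: "'n arrow \<Rightarrow> 'n" where
  "arrow_tail (Alpha i j g) = j"
| "arrow_tail (Eps i) = i"

fun arrow_head :: "'n arrow \<Rightarrow> 'n" where
  "arrow_head (Alpha i j g) = i"
| "arrow_head (Eps i) = i"

definition quiver :: "int^'n^'n \<Rightarrow> ('n \<times> 'n) set \<Rightarrow> ('n, 'n arrow) pre_digraph" where
  "quiver C \<Omega> =
    \<lparr> verts = UNIV,
      arcs = {Alpha i j g | i j g. (i, j) \<in> \<Omega> \<and> 1 \<le> g \<and> g \<le> g_num C i j} \<union> range Eps,
      tail = arrow_tail, head = arrow_head \<rparr>"

type_synonym ('n, 'k) KQ = "('n, 'n arrow) path \<Rightarrow> 'k"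

abbreviation KQ :: "int^'n^'n \<Rightarrow> ('n \<times> 'n) set \<Rightarrow> ('n::finite, 'k::field) KQ ring" where
  "KQ C \<Omega> \<equiv> path_algebra (quiver C \<Omega>)"

text \<open>The exponents below are positive, so powers of \<open>\<epsilon>\<^sub>i\<close> never mean the unit of \<open>KQ\<close>.
  An equation \<open>x = y\<close> is represented by the generator \<open>x - y\<close> of the ideal.\<close>

definition relations ::
    "int^'n^'n \<Rightarrow> ('n \<Rightarrow> nat) \<Rightarrow> ('n \<times> 'n) set \<Rightarrow> ('n::finite, 'k::field) KQ set" where
  "relations C c \<Omega> =
    (let A = KQ C \<Omega>; x = arc_elem (quiver C \<Omega>) in
      {x (Eps i) [^]\<^bsub>A\<^esub> c i | i. True} \<union>
      {(x (Eps i) [^]\<^bsub>A\<^esub> f_num C j i \<otimes>\<^bsub>A\<^esub> x (Alpha i j g))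
          \<ominus>\<^bsub>A\<^esub> (x (Alpha i j g) \<otimes>\<^bsub>A\<^esub> x (Eps j) [^]\<^bsub>A\<^esub> f_num C i j)
        | i j g. (i, j) \<in> \<Omega> \<and> 1 \<le> g \<and> g \<le> g_num C i j})"

definition relation_ideal ::
    "int^'n^'n \<Rightarrow> ('n \<Rightarrow> nat) \<Rightarrow> ('n \<times> 'n) set \<Rightarrow> ('n::finite, 'k::field) KQ set" where
  "relation_ideal C c \<Omega> = Idl\<^bsub>KQ C \<Omega>\<^esub> (relations C c \<Omega>)"

definition H_algebra ::
    "int^'n^'n \<Rightarrow> ('n \<Rightarrow> nat) \<Rightarrow> ('n \<times> 'n) set \<Rightarrow> ('n::finite, 'k::field) KQ set ring" where
  "H_algebra C c \<Omega> = KQ C \<Omega> Quot relation_ideal C c \<Omega>"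

definition H_proj ::
    "int^'n^'n \<Rightarrow> ('n \<Rightarrow> nat) \<Rightarrow> ('n \<times> 'n) set \<Rightarrow> ('n, 'k) KQ \<Rightarrow> ('n::finite, 'k::field) KQ set" where
  "H_proj C c \<Omega> a = a_r_coset (KQ C \<Omega>) (relation_ideal C c \<Omega>) a"

text \<open>The structure map \<open>K \<rightarrow> H(C,D,\<Omega>)\<close>, \<open>r \<mapsto> r \<cdot> 1\<close>.\<close>

definition H_scalar ::
    "int^'n^'n \<Rightarrow> ('n \<Rightarrow> nat) \<Rightarrow> ('n \<times> 'n) set \<Rightarrow> 'k \<Rightarrow> ('n::finite, 'k::field) KQ set" where
  "H_scalar C c \<Omega> r = H_proj C c \<Omega> (\<lambda>x. r * \<one>\<^bsub>KQ C \<Omega>\<^esub> x)"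

definition H_idem ::
    "int^'n^'n \<Rightarrow> ('n \<Rightarrow> nat) \<Rightarrow> ('n \<times> 'n) set \<Rightarrow> 'n \<Rightarrow> ('n::finite, 'k::field) KQ set" where
  "H_idem C c \<Omega> i = H_proj C c \<Omega> (path_elem (i, [], i))"

definition H_eps ::
    "int^'n^'n \<Rightarrow> ('n \<Rightarrow> nat) \<Rightarrow> ('n \<times> 'n) set \<Rightarrow> 'n \<Rightarrow> ('n::finite, 'k::field) KQ set" where
  "H_eps C c \<Omega> i = H_proj C c \<Omega> (arc_elem (quiver C \<Omega>) (Eps i))"


section \<open>Left modules\<close>

text \<open>
  The library's \<open>module\<close> locale is restricted to commutative rings; its record type is reused
  here for left modules (the fields \<open>mult\<close> and \<open>one\<close> of the record play no role).
\<close>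

locale left_module = R?: ring R + M?: abelian_group M
  for R :: "('r, 'x) ring_scheme" (structure) and M :: "('r, 'm) module" (structure) +
  assumes lsmult_closed:
      "\<lbrakk>a \<in> carrier R; x \<in> carrier M\<rbrakk> \<Longrightarrow> a \<odot>\<^bsub>M\<^esub> x \<in> carrier M"
    and lsmult_l_distr:
      "\<lbrakk>a \<in> carrier R; b \<in> carrier R; x \<in> carrier M\<rbrakk> \<Longrightarrow>
       (a \<oplus>\<^bsub>R\<^esub> b) \<odot>\<^bsub>M\<^esub> x = a \<odot>\<^bsub>M\<^esub> x \<oplus>\<^bsub>M\<^esub> b \<odot>\<^bsub>M\<^esub> x"
    and lsmult_r_distr:
      "\<lbrakk>a \<in> carrier R; x \<in> carrier M; y \<in> carrier M\<rbrakk> \<Longrightarrow>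
       a \<odot>\<^bsub>M\<^esub> (x \<oplus>\<^bsub>M\<^esub> y) = a \<odot>\<^bsub>M\<^esub> x \<oplus>\<^bsub>M\<^esub> a \<odot>\<^bsub>M\<^esub> y"
    and lsmult_assoc:
      "\<lbrakk>a \<in> carrier R; b \<in> carrier R; x \<in> carrier M\<rbrakk> \<Longrightarrow>
       (a \<otimes>\<^bsub>R\<^esub> b) \<odot>\<^bsub>M\<^esub> x = a \<odot>\<^bsub>M\<^esub> (b \<odot>\<^bsub>M\<^esub> x)"
    and lsmult_one: "x \<in> carrier M \<Longrightarrow> \<one>\<^bsub>R\<^esub> \<odot>\<^bsub>M\<^esub> x = x"

definition lmod_hom ::
    "('r, 'x) ring_scheme \<Rightarrow> ('r, 'm) module \<Rightarrow> ('r, 'n) module \<Rightarrow> ('m \<Rightarrow> 'n) set" where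
  "lmod_hom R M N =
    {h \<in> carrier M \<rightarrow> carrier N.
       (\<forall>x\<in>carrier M. \<forall>y\<in>carrier M. h (x \<oplus>\<^bsub>M\<^esub> y) = h x \<oplus>\<^bsub>N\<^esub> h y) \<and>
       (\<forall>a\<in>carrier R. \<forall>x\<in>carrier M. h (a \<odot>\<^bsub>M\<^esub> x) = a \<odot>\<^bsub>N\<^esub> h x)}"

definition lmod_isomorphic ::
    "('r, 'x) ring_scheme \<Rightarrow> ('r, 'm) module \<Rightarrow> ('r, 'n) module \<Rightarrow> bool" where
  "lmod_isomorphic R M N \<longleftrightarrow> (\<exists>h\<in>lmod_hom R M N. bij_betw h (carrier M) (carrier N))"

definition lmod_direct_sum :: "('r, 'm) module \<Rightarrow> ('r, 'n) module \<Rightarrow> ('r, 'm \<times> 'n) module" where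
  "lmod_direct_sum M N =
    \<lparr> carrier = carrier M \<times> carrier N, mult = undefined, one = undefined,
      zero = (\<zero>\<^bsub>M\<^esub>, \<zero>\<^bsub>N\<^esub>),
      add = (\<lambda>(x, y) (x', y'). (x \<oplus>\<^bsub>M\<^esub> x', y \<oplus>\<^bsub>N\<^esub> y')),
      smult = (\<lambda>a (x, y). (a \<odot>\<^bsub>M\<^esub> x, a \<odot>\<^bsub>N\<^esub> y)) \<rparr>"

text \<open>Free of finite rank, which for finite-dimensional modules is the same as free.\<close>

definition finite_free_module :: "('r, 'x) ring_scheme \<Rightarrow> ('r, 'm) module \<Rightarrow> bool" where
  "finite_free_module R M \<longleftrightarrow>
     left_module R M \<and>
     (\<exists>B. finite B \<and> B \<subseteq> carrier M \<and>
          (\<forall>x\<in>carrier M. \<exists>!r. r \<in> B \<rightarrow>\<^sub>E carrier R \<and> x = (\<Oplus>\<^bsub>M\<^esub>b\<in>B. r b \<odot>\<^bsub>M\<^esub> b)))"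

text \<open>Here \<open>\<kappa>\<close> is the structure map of the ring as an algebra over the field \<open>'k\<close>.\<close>

definition finite_dimensional :: "('k::field \<Rightarrow> 'r) \<Rightarrow> ('r, 'm) module \<Rightarrow> bool" where
  "finite_dimensional \<kappa> M \<longleftrightarrow>
     (\<exists>B. finite B \<and> B \<subseteq> carrier M \<and>
          (\<forall>x\<in>carrier M. \<exists>r. x = (\<Oplus>\<^bsub>M\<^esub>b\<in>B. \<kappa> (r b) \<odot>\<^bsub>M\<^esub> b)))"

text \<open>
  \<open>Ext\<^sup>1(M, N)\<close> as the set of Yoneda equivalence classes of short exact sequences
  \<open>0 \<rightarrow> N \<rightarrow> E \<rightarrow> M \<rightarrow> 0\<close>, its zero element being the class of the split sequence.
  The middle term of such a sequence is in bijection with \<open>N \<times> M\<close>, so it is no restriction that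
  the elements of \<open>E\<close> are taken from the type \<open>'n \<times> 'm\<close>.  In the equivalence, the connecting map
  is an isomorphism by the five lemma.
\<close>

type_synonym ('r, 'm, 'n) ses =
  "('n \<Rightarrow> 'n \<times> 'm) \<times> ('r, 'n \<times> 'm) module \<times> ('n \<times> 'm \<Rightarrow> 'm)"

definition extensions ::
    "('r, 'x) ring_scheme \<Rightarrow> ('r, 'm) module \<Rightarrow> ('r, 'n) module \<Rightarrow> ('r, 'm, 'n) ses set" where
  "extensions R M N =
    {(f, E, g). left_module R E \<and>
       f \<in> lmod_hom R N E \<and> inj_on f (carrier N) \<and>
       g \<in> lmod_hom R E M \<and> g ` carrier E = carrier M \<and>
       f ` carrier N = {e \<in> carrier E. g e = \<zero>\<^bsub>M\<^esub>}}"

definition extension_equiv ::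
    "('r, 'x) ring_scheme \<Rightarrow> ('r, 'm) module \<Rightarrow> ('r, 'n) module \<Rightarrow>
     (('r, 'm, 'n) ses \<times> ('r, 'm, 'n) ses) set" where
  "extension_equiv R M N =
    {((f, E, g), (f', E', g')).
       (f, E, g) \<in> extensions R M N \<and> (f', E', g') \<in> extensions R M N \<and>
       (\<exists>h\<in>lmod_hom R E E'.
          (\<forall>x\<in>carrier N. h (f x) = f' x) \<and> (\<forall>e\<in>carrier E. g' (h e) = g e))}"

definition Ext1 ::
    "('r, 'x) ring_scheme \<Rightarrow> ('r, 'm) module \<Rightarrow> ('r, 'n) module \<Rightarrow> ('r, 'm, 'n) ses set set" where
  "Ext1 R M N = extensions R M N // extension_equiv R M N"

definition Ext1_zero ::
    "('r, 'x) ring_scheme \<Rightarrow> ('r, 'm) module \<Rightarrow> ('r, 'n) module \<Rightarrow> ('r, 'm, 'n) ses set" where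
  "Ext1_zero R M N =
     extension_equiv R M N `` {(\<lambda>x. (x, \<zero>\<^bsub>M\<^esub>), lmod_direct_sum N M, snd)}"

definition rigid :: "('r, 'x) ring_scheme \<Rightarrow> ('r, 'm) module \<Rightarrow> bool" where
  "rigid R M \<longleftrightarrow> Ext1 R M M = {Ext1_zero R M M}"


section \<open>Locally free modules\<close>

text \<open>The (in general non-unital) subalgebra with unit \<open>u\<close> that is generated by \<open>S\<close>.\<close>

inductive_set generated_subalgebra ::
    "('r, 'x) ring_scheme \<Rightarrow> ('k \<Rightarrow> 'r) \<Rightarrow> 'r \<Rightarrow> 'r set \<Rightarrow> 'r set"
  for R :: "('r, 'x) ring_scheme" and \<kappa> :: "'k \<Rightarrow> 'r" and u :: 'r and S :: "'r set" where
  unit: "u \<in> generated_subalgebra R \<kappa> u S"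
| gen: "x \<in> S \<Longrightarrow> x \<in> generated_subalgebra R \<kappa> u S"
| scale: "x \<in> generated_subalgebra R \<kappa> u S \<Longrightarrow> \<kappa> r \<otimes>\<^bsub>R\<^esub> x \<in> generated_subalgebra R \<kappa> u S"
| add: "\<lbrakk>x \<in> generated_subalgebra R \<kappa> u S; y \<in> generated_subalgebra R \<kappa> u S\<rbrakk> \<Longrightarrow>
    x \<oplus>\<^bsub>R\<^esub> y \<in> generated_subalgebra R \<kappa> u S"
| mult: "\<lbrakk>x \<in> generated_subalgebra R \<kappa> u S; y \<in> generated_subalgebra R \<kappa> u S\<rbrakk> \<Longrightarrow>
    x \<otimes>\<^bsub>R\<^esub> y \<in> generated_subalgebra R \<kappa> u S"

text \<open>\<open>H\<^sub>i\<close>, whose unit is the idempotent \<open>e\<^sub>i\<close>, and \<open>M\<^sub>i = e\<^sub>i M\<close>.\<close>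

definition H_vertex ::
    "int^'n^'n \<Rightarrow> ('n \<Rightarrow> nat) \<Rightarrow> ('n \<times> 'n) set \<Rightarrow> 'n \<Rightarrow> ('n::finite, 'k::field) KQ set ring" where
  "H_vertex C c \<Omega> i = (H_algebra C c \<Omega>)
    \<lparr> carrier := generated_subalgebra (H_algebra C c \<Omega>) (H_scalar C c \<Omega>)
                   (H_idem C c \<Omega> i) {H_eps C c \<Omega> i},
      one := H_idem C c \<Omega> i \<rparr>"

definition vertex_part ::
    "int^'n^'n \<Rightarrow> ('n \<Rightarrow> nat) \<Rightarrow> ('n \<times> 'n) set \<Rightarrow>
     (('n::finite, 'k::field) KQ set, 'm) module \<Rightarrow> 'n \<Rightarrow> (('n, 'k) KQ set, 'm) module" where
  "vertex_part C c \<Omega> M i = M\<lparr> carrier := (\<lambda>x. H_idem C c \<Omega> i \<odot>\<^bsub>M\<^esub> x) ` carrier M \<rparr>"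

definition H_module ::
    "int^'n^'n \<Rightarrow> ('n \<Rightarrow> nat) \<Rightarrow> ('n \<times> 'n) set \<Rightarrow>
     (('n::finite, 'k::field) KQ set, 'm) module \<Rightarrow> bool" where
  "H_module C c \<Omega> M \<longleftrightarrow>
     left_module (H_algebra C c \<Omega>) M \<and> finite_dimensional (H_scalar C c \<Omega>) M"

definition locally_free ::
    "int^'n^'n \<Rightarrow> ('n \<Rightarrow> nat) \<Rightarrow> ('n \<times> 'n) set \<Rightarrow>
     (('n::finite, 'k::field) KQ set, 'm) module \<Rightarrow> bool" where
  "locally_free C c \<Omega> M \<longleftrightarrow>
     (\<forall>i. finite_free_module (H_vertex C c \<Omega> i) (vertex_part C c \<Omega> M i))"


section \<open>The reduction functor\<close>

text \<open>The central element \<open>\<epsilon> = \<Sum>\<^sub>i \<epsilon>\<^sub>i\<^bsup>c\<^sub>i\<^esup>\<close> of \<open>H(k) = H(C,kD,\<Omega>)\<close>; the exponents are those of \<open>D\<close>.\<close>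

definition H_central ::
    "int^'n^'n \<Rightarrow> ('n \<Rightarrow> nat) \<Rightarrow> ('n \<times> 'n) set \<Rightarrow> nat \<Rightarrow> ('n::finite, 'k::field) KQ set" where
  "H_central C c \<Omega> k =
     (let H = H_algebra C (\<lambda>i. k * c i) \<Omega>
      in \<Oplus>\<^bsub>H\<^esub>i\<in>UNIV. H_eps C (\<lambda>i. k * c i) \<Omega> i [^]\<^bsub>H\<^esub> c i)"

definition reduction_submodule ::
    "int^'n^'n \<Rightarrow> ('n \<Rightarrow> nat) \<Rightarrow> ('n \<times> 'n) set \<Rightarrow> nat \<Rightarrow>
     (('n::finite, 'k::field) KQ set, 'm) module \<Rightarrow> 'm set" where
  "reduction_submodule C c \<Omega> k M =
     (\<lambda>x. (H_central C c \<Omega> k [^]\<^bsub>H_algebra C (\<lambda>i. k * c i) \<Omega>\<^esub> (k - 1)) \<odot>\<^bsub>M\<^esub> x) ` carrier M"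

text \<open>
  \<open>M/\<epsilon>\<^bsup>k-1\<^esup>M\<close> as an \<open>H(k-1)\<close>-module.  As \<open>H(k-1) \<cong> H(k)/(\<epsilon>\<^bsup>k-1\<^esup>)\<close>, an element \<open>h\<close> of \<open>H(k-1)\<close>, which
  is a coset in the path algebra, acts through the image in \<open>H(k)\<close> of any representative \<open>a \<in> h\<close>;
  the unions below, in the style of \<^const>\<open>rcoset_mult\<close>, express this independence of choices.
\<close>

definition reduction ::
    "int^'n^'n \<Rightarrow> ('n \<Rightarrow> nat) \<Rightarrow> ('n \<times> 'n) set \<Rightarrow> nat \<Rightarrow>
     (('n::finite, 'k::field) KQ set, 'm) module \<Rightarrow> (('n, 'k) KQ set, 'm set) module" where
  "reduction C c \<Omega> k M =
    (let N = reduction_submodule C c \<Omega> k M in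
      \<lparr> carrier = A_RCOSETS M N, mult = undefined, one = undefined,
        zero = N, add = set_add M,
        smult = (\<lambda>h X. \<Union>a\<in>h. \<Union>x\<in>X.
                   a_r_coset M N (H_proj C (\<lambda>i. k * c i) \<Omega> a \<odot>\<^bsub>M\<^esub> x)) \<rparr>)"


section \<open>Isomorphism classes\<close>

text \<open>
  Every finite-dimensional module is isomorphic to one whose elements are taken from \<open>K\<^sup>\<nat>\<close>, so
  isomorphism classes are formed inside this type.  The module \<open>M\<close> representing a class may have
  elements of any type.
\<close>

type_synonym ('n, 'k) Hmod = "(('n, 'k) KQ set, nat \<Rightarrow> 'k) module"

definition iso_class ::
    "int^'n^'n \<Rightarrow> ('n \<Rightarrow> nat) \<Rightarrow> ('n \<times> 'n) set \<Rightarrow>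
     (('n::finite, 'k::field) KQ set, 'm) module \<Rightarrow> ('n, 'k) Hmod set" where
  "iso_class C c \<Omega> M = {N. H_module C c \<Omega> N \<and> lmod_isomorphic (H_algebra C c \<Omega>) M N}"

definition rigid_locally_free_classes ::
    "int^'n^'n \<Rightarrow> ('n \<Rightarrow> nat) \<Rightarrow> ('n \<times> 'n) set \<Rightarrow> ('n::finite, 'k::field) Hmod set set" where
  "rigid_locally_free_classes C c \<Omega> =
     iso_class C c \<Omega> ` {M :: ('n, 'k) Hmod. H_module C c \<Omega> M \<and> locally_free C c \<Omega> M \<and>
                          rigid (H_algebra C c \<Omega>) M}"

text \<open>The map \<open>[M] \<mapsto> [M/\<epsilon>\<^bsup>k-1\<^esup>M]\<close>; the union is over isomorphic modules, so all its members coincide.\<close>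

definition reduction_class ::
    "int^'n^'n \<Rightarrow> ('n \<Rightarrow> nat) \<Rightarrow> ('n \<times> 'n) set \<Rightarrow> nat \<Rightarrow>
     ('n::finite, 'k::field) Hmod set \<Rightarrow> ('n, 'k) Hmod set" where
  "reduction_class C c \<Omega> k X =
     (\<Union>M\<in>X. iso_class C (\<lambda>i. (k - 1) * c i) \<Omega> (reduction C c \<Omega> k M))"

end

theory Submission
  imports Defs "HOL-Library.Function_Algebras" "HOL-Library.Product_Plus"
begin

text \<open>
  A locally free \<open>H(k)\<close>-module is given by free \<open>K[x]/(x\<^bsup>k c\<^sub>i\<^esup>)\<close>-modules \<open>M\<^sub>i\<close> and by linear maps
  \<open>\<alpha> : M\<^sub>j \<rightarrow> M\<^sub>i\<close> with \<open>x\<^bsup>f\<^sub>j\<^sub>i\<^esup> \<alpha> = \<alpha> x\<^bsup>f\<^sub>i\<^sub>j\<^esup>\<close>.  As \<open>M\<^sub>j\<close> is free over \<open>K[x\<^bsup>f\<^sub>i\<^sub>j\<^esup>]/(x\<^bsup>k c\<^sub>j\<^esup>)\<close>, such maps lift to maps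
  between free \<open>K[x]\<close>-modules, so every locally free module is a polynomial model, independent of
  \<open>k\<close>, read modulo \<open>\<epsilon>\<^sup>k\<close>, and reduction means reading it modulo \<open>\<epsilon>\<^bsup>k-1\<^esup>\<close>.  Every self-extension splits
  over the loops, hence is given by a cocycle \<open>\<gamma>\<close>, a family of maps like \<open>\<alpha>\<close>, and \<open>M\<close> is rigid iff
  modulo \<open>\<epsilon>\<^sup>k\<close> every cocycle is a coboundary \<open>\<alpha> \<phi> - \<phi> \<alpha>\<close>.  If this holds modulo \<open>\<epsilon>\<^bsup>k-1\<^esup>\<close>, then the
  difference is \<open>\<epsilon>\<^bsup>k-1\<^esup> \<gamma>'\<close> for a cocycle \<open>\<gamma>'\<close>, and treating \<open>\<gamma>'\<close> in the same way solves the equation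
  modulo \<open>\<epsilon>\<^bsup>2k-2\<^esup>\<close>, hence modulo \<open>\<epsilon>\<^sup>k\<close>.  So rigidity does not change under reduction.  The same
  two-step argument lifts isomorphisms between the reductions of rigid modules.
\<close>

section \<open>The ring structure of a path algebra\<close>

text \<open>What makes all levels comparable is that each arrow relation is linear in a single
  \<alpha>. So the polynomial arrow maps form a linear space with no condition linking different
  arrows, every family of such maps is a cocycle, and a family divisible by \<epsilon>^m has a
  quotient that is again a cocycle. The quotient is unique because polynomials have no zero
  divisors, and \<epsilon> passes through the arrows because c_i = q f_ji and c_j = q f_ij with a
  common q. Maps between modules lift to polynomials, but the lifts satisfy their equations only
  modulo \<epsilon>^m; so commuting with arrows, being inverse and being a coboundary are all stated
  as divisibility by a power of \<epsilon>. The bound k \<ge> 2 enters as k \<le> 2(k - 1): two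
  rounds at level k - 1 reach level k. Vectors of all ranks share one type, in which a rank vector r
  cuts off coordinates. The classes at levels k and k - 1 are then parametrized by the same pairs
  (r, \<alpha>) under equivalent conditions, and on these pairs reduction is the identity.\<close>

fun path_cat :: "('v, 'e) path \<Rightarrow> ('v, 'e) path \<Rightarrow> ('v, 'e) path" where
  "path_cat (w, q, v) (u, p, w') = (u, p @ q, v)"

text \<open>In a product the right factor is traversed first, so the left factor must start where
  the right one ends.\<close>

definition joinable :: "('v, 'e) path \<Rightarrow> ('v, 'e) path \<Rightarrow> bool" where
  "joinable y z \<longleftrightarrow> fst y = snd (snd z)"

locale path_alg = wf_digraph G for G :: "('v::finite, 'e) pre_digraph" +
  fixes PA :: "(('v, 'e) path \<Rightarrow> 'k::field) ring" (structure)
  assumes PA_def: "PA = path_algebra G"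
begin

lemma PA_carrier_iff:
  "a \<in> carrier PA \<longleftrightarrow> finite {x. a x \<noteq> 0} \<and> (\<forall>u p v. a (u, p, v) \<noteq> 0 \<longrightarrow> awalk u p v)"
  by (simp add: PA_def path_algebra_def)

lemma PA_finite: "a \<in> carrier PA \<Longrightarrow> finite {x. a x \<noteq> 0}"
  by (simp add: PA_carrier_iff)

lemma PA_mult: "(a \<otimes> b) (u, p, v) =
    (\<Sum>l\<le>length p. \<Sum>w\<in>UNIV. a (w, drop l p, v) * b (u, take l p, w))"
  by (simp add: PA_def path_algebra_def)

lemma PA_one: "\<one> (u, p, v) = (if p = [] \<and> u = v \<and> u \<in> verts G then 1 else 0)"
  by (simp add: PA_def path_algebra_def)

lemma PA_zero: "\<zero> = (\<lambda>x. 0)" and PA_add: "a \<oplus> b = (\<lambda>x. a x + b x)"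
  by (simp_all add: PA_def path_algebra_def)

text \<open>A cut position together with a middle vertex is the same as a joinable pair with the
  given concatenation. Sums over pairs from finite sets containing the supports can be regrouped, as
  \<open>act_mult\<close> requires.\<close>

lemma PA_mult_conv:
  assumes "finite A" "finite B" "{x. a x \<noteq> 0} \<subseteq> A" "{x. b x \<noteq> 0} \<subseteq> B"
  shows "(a \<otimes> b) x = (\<Sum>(y, z) | (y, z) \<in> A \<times> B \<and> joinable y z \<and> path_cat y z = x. a y * b z)"
proof -
  obtain u p v where x: "x = (u, p, v)" by (cases x)
  define h where "h = (\<lambda>(l, w::'v). ((w, drop l p, v), (u, take l p, w)))"
  let ?D = "{..length p} \<times> (UNIV :: 'v set)"
  let ?S = "{(y, z). (y, z) \<in> A \<times> B \<and> joinable y z \<and> path_cat y z = x}"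
  \<comment> \<open>The cut position is recovered as the length of the initial part.\<close>
  have inj: "inj_on h ?D"
    by (rule inj_onI) (auto simp: h_def dest!: arg_cong[where f = length])
  have D: "h ` ?D = {(y, z). joinable y z \<and> path_cat y z = x}"
  proof (intro Set.set_eqI iffI)
    fix t assume "t \<in> h ` ?D"
    then show "t \<in> {(y, z). joinable y z \<and> path_cat y z = x}"
      by (auto simp: h_def joinable_def x)
  next
    fix t assume "t \<in> {(y, z). joinable y z \<and> path_cat y z = x}"
    then obtain w q w' r where "t = ((w, q, v), (u, r, w))" "p = r @ q"
      by (cases t) (auto simp: joinable_def x)
    then have "t = h (length r, w)" "(length r, w) \<in> ?D" by (auto simp: h_def)
    then show "t \<in> h ` ?D" by blast
  qed
  have fin: "finite (h ` ?D)" by simp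
  have "(a \<otimes> b) x = (\<Sum>(l, w)\<in>?D. a (w, drop l p, v) * b (u, take l p, w))"
    unfolding x PA_mult by (simp add: sum.cartesian_product)
  also have "\<dots> = (\<Sum>(y, z)\<in>h ` ?D. a y * b z)"
    by (subst sum.reindex[OF inj]) (auto simp: h_def intro!: sum.cong)
  also have "\<dots> = (\<Sum>(y, z)\<in>?S. a y * b z)"
    using assms(3,4) by (intro sum.mono_neutral_right fin) (auto simp: D)
  finally show ?thesis .
qed

lemma PA_mult_nonzeroE:
  assumes "a \<in> carrier PA" "b \<in> carrier PA" "(a \<otimes> b) x \<noteq> 0"
  obtains y z where "a y \<noteq> 0" "b z \<noteq> 0" "joinable y z" "x = path_cat y z"
proof -
  have "(\<Sum>(y, z) | (y, z) \<in> {y. a y \<noteq> 0} \<times> {z. b z \<noteq> 0} \<and> joinable y z \<and> path_cat y z = x. a y * b z) \<noteq> 0"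
    using assms by (subst PA_mult_conv[symmetric]) (auto simp: PA_finite)
  then obtain t where "t \<in> {(y, z). (y, z) \<in> {y. a y \<noteq> 0} \<times> {z. b z \<noteq> 0} \<and> joinable y z \<and> path_cat y z = x}"
    by (rule sum.not_neutral_contains_not_neutral)
  then show thesis using that by auto
qed

lemma PA_mult_closed:
  assumes a: "a \<in> carrier PA" and b: "b \<in> carrier PA"
  shows "a \<otimes> b \<in> carrier PA"
proof -
  have "{x. (a \<otimes> b) x \<noteq> 0} \<subseteq> (\<lambda>(y, z). path_cat y z) ` ({y. a y \<noteq> 0} \<times> {z. b z \<noteq> 0})"
    by (auto elim!: PA_mult_nonzeroE[OF a b] intro!: image_eqI[rotated] simp del: path_cat.simps)
  then have "finite {x. (a \<otimes> b) x \<noteq> 0}"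
    by (rule finite_subset) (use a b in \<open>simp add: PA_finite\<close>)
  moreover have "awalk u p v" if "(a \<otimes> b) (u, p, v) \<noteq> 0" for u p v
    using that
  proof (rule PA_mult_nonzeroE[OF a b])
    fix y z assume "a y \<noteq> 0" "b z \<noteq> 0" "joinable y z" "(u, p, v) = path_cat y z"
    then obtain w q r where "a (w, q, v) \<noteq> 0" "b (u, r, w) \<noteq> 0" "p = r @ q"
      by (cases y; cases z) (auto simp: joinable_def)
    then show "awalk u p v" using a b awalk_appendI[of u r w q v] by (auto simp: PA_carrier_iff)
  qed
  ultimately show ?thesis by (simp add: PA_carrier_iff)
qed

lemma PA_add_closed:
  assumes a: "a \<in> carrier PA" and b: "b \<in> carrier PA"
  shows "a \<oplus> b \<in> carrier PA"
proof -
  have "{x. a x + b x \<noteq> 0} \<subseteq> {x. a x \<noteq> 0} \<union> {x. b x \<noteq> 0}" by auto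
  then have "finite {x. a x + b x \<noteq> 0}"
    by (rule finite_subset) (use a b in \<open>simp add: PA_finite\<close>)
  then show ?thesis using a b
    by (auto simp: PA_carrier_iff PA_add) (metis add.right_neutral)
qed

lemma PA_scale_closed: "a \<in> carrier PA \<Longrightarrow> (\<lambda>x. r * a x) \<in> carrier PA"
  by (auto simp: PA_carrier_iff elim: rev_finite_subset)

lemma PA_zero_closed: "\<zero> \<in> carrier PA"
  by (simp add: PA_carrier_iff PA_zero)

lemma PA_one_closed: "\<one> \<in> carrier PA"
proof -
  have "{x. \<one> x \<noteq> (0::'k)} \<subseteq> (\<lambda>u. (u, [], u)) ` UNIV"
    by (auto simp: PA_one split: if_splits)
  then have "finite {x. \<one> x \<noteq> (0::'k)}" by (rule finite_subset) simp
  then show ?thesis by (auto simp: PA_carrier_iff PA_one awalk_Nil_iff split: if_splits)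
qed

lemma path_elem_closed: "awalk u p v \<Longrightarrow> path_elem (u, p, v) \<in> carrier PA"
  by (auto simp: PA_carrier_iff path_elem_def)

lemma arc_elem_closed: "e \<in> arcs G \<Longrightarrow> arc_elem G e \<in> carrier PA"
  by (auto simp: arc_elem_def awalk_def intro!: path_elem_closed)

text \<open>Both sides sum over all ways to cut a path twice; \<open>F l d\<close> collects the cuts
  with initial part of length \<open>l\<close> and middle part of length \<open>d\<close>. One side
  is indexed by \<open>(l, d)\<close>, the other by \<open>(l, l + d)\<close>.\<close>

lemma PA_mult_assoc: "(a \<otimes> b) \<otimes> c = a \<otimes> (b \<otimes> c)"
proof
  fix x :: "('v, 'e) path"
  obtain u p v where x: "x = (u, p, v)" by (cases x)
  let ?n = "length p"
  define F where "F l d = (\<Sum>w\<in>UNIV. \<Sum>w'\<in>UNIV.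
     a (w', drop (l + d) p, v) * (b (w, take d (drop l p), w') * c (u, take l p, w)))" for l d
  have "((a \<otimes> b) \<otimes> c) x = (\<Sum>l\<le>?n. \<Sum>d\<le>?n - l. F l d)"
  proof -
    have "(\<Sum>w\<in>UNIV. (a \<otimes> b) (w, drop l p, v) * c (u, take l p, w)) = (\<Sum>d\<le>?n - l. F l d)" for l
      unfolding PA_mult F_def
      by (simp add: sum_distrib_right mult.assoc add.commute sum.swap[of _ "{..?n - l}"])
    then show ?thesis unfolding x by (subst PA_mult) simp
  qed
  also have "\<dots> = (\<Sum>(l, d) | l + d \<le> ?n. F l d)"
    by (subst sum.Sigma) (auto intro!: sum.cong)
  also have "\<dots> = (\<Sum>m\<le>?n. \<Sum>l\<le>m. F l (m - l))"
    by (rule sum.triangle_reindex_eq)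
  also have "\<dots> = (a \<otimes> (b \<otimes> c)) x"
  proof -
    have "(\<Sum>w'\<in>UNIV. a (w', drop m p, v) * (b \<otimes> c) (u, take m p, w')) = (\<Sum>l\<le>m. F l (m - l))"
      if m: "m \<le> ?n" for m
    proof -
      have "(\<Sum>w'\<in>UNIV. a (w', drop m p, v) * (b \<otimes> c) (u, take m p, w'))
          = (\<Sum>w'\<in>UNIV. \<Sum>l\<le>m. \<Sum>w\<in>UNIV. a (w', drop m p, v) *
               (b (w, drop l (take m p), w') * c (u, take l (take m p), w)))"
        unfolding PA_mult using m by (simp add: sum_distrib_left)
      also have "\<dots> = (\<Sum>l\<le>m. \<Sum>w\<in>UNIV. \<Sum>w'\<in>UNIV. a (w', drop m p, v) *
               (b (w, drop l (take m p), w') * c (u, take l (take m p), w)))"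
        by (subst sum.swap) (intro sum.cong refl sum.swap)
      also have "\<dots> = (\<Sum>l\<le>m. F l (m - l))"
        unfolding F_def by (intro sum.cong refl) (simp add: drop_take min_absorb1)
      finally show ?thesis .
    qed
    then show ?thesis unfolding x by (subst PA_mult) simp
  qed
  finally show "((a \<otimes> b) \<otimes> c) x = (a \<otimes> (b \<otimes> c)) x" .
qed

lemma PA_one_mult: assumes "a \<in> carrier PA" shows "\<one> \<otimes> a = a"
proof
  fix x :: "('v, 'e) path"
  obtain u p v where x: "x = (u, p, v)" by (cases x)
  have "(\<one> \<otimes> a) x = (\<Sum>l\<le>length p. \<Sum>w\<in>UNIV. if w = v then if l = length p then a x else 0 else 0)"
    unfolding x PA_mult using assms awalk_last_in_verts
    by (intro sum.cong refl) (auto simp: PA_one PA_carrier_iff, blast)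
  then show "(\<one> \<otimes> a) x = a x" by simp
qed

lemma PA_mult_one: assumes "a \<in> carrier PA" shows "a \<otimes> \<one> = a"
proof
  fix x :: "('v, 'e) path"
  obtain u p v where x: "x = (u, p, v)" by (cases x)
  have "(a \<otimes> \<one>) x = (\<Sum>l\<le>length p. \<Sum>w\<in>UNIV. if w = u then if l = 0 then a x else 0 else 0)"
    unfolding x PA_mult using assms awalk_hd_in_verts
    by (intro sum.cong refl) (auto simp: PA_one PA_carrier_iff, blast)
  then show "(a \<otimes> \<one>) x = a x" by simp
qed

lemma ring_PA: "ring PA"
proof (rule ringI)
  show "abelian_group PA"
  proof (rule abelian_groupI)
    fix a assume a: "a \<in> carrier PA"
    show "\<exists>b\<in>carrier PA. b \<oplus> a = \<zero>"
      using PA_scale_closed[OF a, of "-1"] by (auto simp: PA_add PA_zero intro!: bexI)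
  qed (auto simp: PA_add_closed PA_zero_closed, auto simp: PA_add PA_zero add_ac)
  show "monoid PA"
    by (rule monoidI) (auto simp: PA_mult_closed PA_one_closed PA_mult_assoc PA_one_mult PA_mult_one)
  show "(a \<oplus> b) \<otimes> c = a \<otimes> c \<oplus> b \<otimes> c" for a b c
    by (rule ext, clarify) (auto simp: PA_mult PA_add algebra_simps sum.distrib)
  show "c \<otimes> (a \<oplus> b) = c \<otimes> a \<oplus> c \<otimes> b" for a b c
    by (rule ext, clarify) (auto simp: PA_mult PA_add algebra_simps sum.distrib)
qed

sublocale PA: ring PA by (rule ring_PA)

lemma PA_scale_mult:
  "(\<lambda>x. r * \<one> x) \<otimes> a = (\<lambda>x. r * a x)" if "a \<in> carrier PA"
proof -
  have "(\<lambda>x. r * \<one> x) \<otimes> a = (\<lambda>x. r * (\<one> \<otimes> a) x)"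
    by (rule ext, clarify) (simp add: PA_mult sum_distrib_left mult.assoc)
  then show ?thesis using that by simp
qed

lemma path_elem_mult:
  "path_elem y \<otimes> path_elem z = (if joinable y z then path_elem (path_cat y z) else \<zero>)"
proof
  fix x
  have "(path_elem y \<otimes> path_elem z) x
      = (\<Sum>(y', z') | (y', z') \<in> {y} \<times> {z} \<and> joinable y' z' \<and> path_cat y' z' = x. path_elem y y' * path_elem z z')"
    by (rule PA_mult_conv) (auto simp: path_elem_def)
  also have "{(y', z'). (y', z') \<in> {y} \<times> {z} \<and> joinable y' z' \<and> path_cat y' z' = x}
      = (if joinable y z \<and> path_cat y z = x then {(y, z)} else {})"
    by auto
  finally show "(path_elem y \<otimes> path_elem z) x
      = (if joinable y z then path_elem (path_cat y z) else \<zero>) x"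
    by (auto simp: path_elem_def PA_zero)
qed

text \<open>Vertices and arrows generate the path algebra, so compatibility with an action has to be
  checked on them only; see \<open>is_action_intertwine\<close>.\<close>

lemma PA_induct [consumes 1, case_names zero idem arc mult add scale]:
  assumes "a \<in> carrier PA"
    and zero: "P \<zero>"
    and idem: "\<And>u. u \<in> verts G \<Longrightarrow> P (path_elem (u, [], u))"
    and arc: "\<And>e. e \<in> arcs G \<Longrightarrow> P (arc_elem G e)"
    and mult: "\<And>a b. a \<in> carrier PA \<Longrightarrow> b \<in> carrier PA \<Longrightarrow> P a \<Longrightarrow> P b \<Longrightarrow> P (a \<otimes> b)"
    and add: "\<And>a b. a \<in> carrier PA \<Longrightarrow> b \<in> carrier PA \<Longrightarrow> P a \<Longrightarrow> P b \<Longrightarrow> P (a \<oplus> b)"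
    and scale: "\<And>r a. a \<in> carrier PA \<Longrightarrow> P a \<Longrightarrow> P (\<lambda>x. r * a x)"
  shows "P a"
proof -
  have path: "P (path_elem (u, p, v))" if "awalk u p v" for u p v
    using that
  proof (induction p arbitrary: u)
    case Nil
    then have "u = v" "v \<in> verts G" by (auto simp: awalk_Nil_iff)
    then show ?case using idem[of v] by simp
  next
    case (Cons e p)
    have e: "e \<in> arcs G" "tail G e = u" and w: "awalk (head G e) p v"
      using Cons.prems by (auto simp: awalk_Cons_iff)
    have "path_elem (u, e # p, v) = path_elem (head G e, p, v) \<otimes> arc_elem G e"
      by (simp add: arc_elem_def path_elem_mult joinable_def e)
    then show ?case
      using mult[OF path_elem_closed[OF w] arc_elem_closed[OF e(1)] Cons.IH[OF w] arc[OF e(1)]]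
      by simp
  qed
  \<comment> \<open>The finite set merely contains the support, so the induction step also goes
    through when the removed coefficient is zero.\<close>
  have "finite S \<Longrightarrow> {x. a x \<noteq> 0} \<subseteq> S \<Longrightarrow> a \<in> carrier PA \<Longrightarrow> P a" for S a
  proof (induction S arbitrary: a rule: finite_induct)
    case empty
    then have "a = \<zero>" by (auto simp: PA_zero)
    then show ?case using zero by simp
  next
    case (insert x S)
    define b where "b = a(x := 0)"
    have b: "b \<in> carrier PA"
      using insert.prems(2) unfolding PA_carrier_iff b_def
      by (auto elim!: rev_finite_subset split: if_splits)
    have "P b" using insert.prems(1) by (intro insert.IH b) (auto simp: b_def)
    show ?case
    proof (cases "a x = 0")
      case True
      then have "b = a" by (auto simp: b_def)
      then show ?thesis using \<open>P b\<close> by simp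
    next
      case False
      obtain u p v where x: "x = (u, p, v)" by (cases x)
      have w: "awalk u p v" using False insert.prems(2) by (simp add: PA_carrier_iff x)
      have "a = (\<lambda>y. a x * path_elem x y) \<oplus> b"
        by (auto simp: PA_add b_def path_elem_def)
      moreover have "P ((\<lambda>y. a x * path_elem x y) \<oplus> b)"
        using path[OF w] path_elem_closed[OF w] b \<open>P b\<close> unfolding x
        by (intro add scale PA_scale_closed) auto
      ultimately show ?thesis by simp
    qed
  qed
  then show ?thesis using assms(1) PA_finite by blast
qed

end


section \<open>Representations of a quiver\<close>

text \<open>The \<open>e u\<close> are orthogonal, but their sum may differ from the identity: in
  the polynomial models it is \<open>cut r\<close>, which kills the coordinates beyond the rank
  vector. The unit of the path algebra acts as this sum.\<close>

locale quiver_rep = path_alg G PA + vector_space sc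
  for G :: "('v::finite, 'e) pre_digraph" and PA :: "(('v, 'e) path \<Rightarrow> 'k::field) ring" (structure)
    and sc :: "'k \<Rightarrow> 'w::ab_group_add \<Rightarrow> 'w" +
  fixes e :: "'v \<Rightarrow> 'w \<Rightarrow> 'w" and T :: "'e \<Rightarrow> 'w \<Rightarrow> 'w"
  assumes e_add: "e u (x + y) = e u x + e u y" and e_sc: "e u (sc r x) = sc r (e u x)"
    and T_add: "a \<in> arcs G \<Longrightarrow> T a (x + y) = T a x + T a y"
    and T_sc: "a \<in> arcs G \<Longrightarrow> T a (sc r x) = sc r (T a x)"
    and e_e: "e u (e v x) = (if u = v then e u x else 0)"
    and e_T: "a \<in> arcs G \<Longrightarrow> e (head G a) (T a x) = T a x"
    and T_e: "a \<in> arcs G \<Longrightarrow> T a (e (tail G a) x) = T a x"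
begin

fun path_act :: "('v, 'e) path \<Rightarrow> 'w \<Rightarrow> 'w" where
  "path_act (u, p, v) x = e v (fold T p (e u x))"

definition act :: "(('v, 'e) path \<Rightarrow> 'k) \<Rightarrow> 'w \<Rightarrow> 'w" where
  "act a x = (\<Sum>y | a y \<noteq> 0. sc (a y) (path_act y x))"

lemma e_0: "e u 0 = 0"
  using e_add[of u 0 0] by simp

lemma fold_T_add: "set p \<subseteq> arcs G \<Longrightarrow> fold T p (x + y) = fold T p x + fold T p y"
  by (induction p arbitrary: x y) (auto simp: T_add)

lemma fold_T_sc: "set p \<subseteq> arcs G \<Longrightarrow> fold T p (sc r x) = sc r (fold T p x)"
  by (induction p arbitrary: x) (auto simp: T_sc)

lemma fold_T_0: "set p \<subseteq> arcs G \<Longrightarrow> fold T p 0 = 0"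
  using fold_T_add[of p 0 0] by simp

lemma path_act_add: "awalk u p v \<Longrightarrow> path_act (u, p, v) (x + y) = path_act (u, p, v) x + path_act (u, p, v) y"
  by (simp add: awalk_def e_add fold_T_add)

lemma path_act_sc: "awalk u p v \<Longrightarrow> path_act (u, p, v) (sc r x) = sc r (path_act (u, p, v) x)"
  by (simp add: awalk_def e_sc fold_T_sc)

lemma e_fold_T: "awalk u p v \<Longrightarrow> e v (fold T p (e u x)) = fold T p (e u x)"
proof (induction p arbitrary: u x)
  case Nil
  then show ?case by (simp add: awalk_Nil_iff e_e)
next
  case (Cons a p)
  then have a: "a \<in> arcs G" "awalk (head G a) p v" by (auto simp: awalk_Cons_iff)
  show ?case using Cons.IH[OF a(2), of "T a (e u x)"] by (simp add: e_T a)
qed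

text \<open>If the walks do not meet, the orthogonal projections at the two vertices annihilate the
  result, in accordance with the zero product in the path algebra.\<close>

lemma path_act_cat:
  assumes y: "awalk w q v" and z: "awalk u p w'"
  shows "path_act (w, q, v) (path_act (u, p, w') x)
    = (if joinable (w, q, v) (u, p, w') then path_act (path_cat (w, q, v) (u, p, w')) x else 0)"
proof (cases "w = w'")
  case False
  then have "e w (fold T p (e u x)) = 0"
    using e_e[of w w' "fold T p (e u x)"] by (simp add: e_fold_T[OF z])
  then show ?thesis using y False
    by (auto simp: joinable_def e_e e_fold_T[OF z] fold_T_0 e_0 awalk_def)
qed (simp add: joinable_def e_e e_fold_T[OF z])

lemma act_conv:
  assumes "finite A" "{y. a y \<noteq> 0} \<subseteq> A"
  shows "act a x = (\<Sum>y\<in>A. sc (a y) (path_act y x))"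
  unfolding act_def by (rule sum.mono_neutral_left) (use assms in auto)

lemma act_add: 
  assumes "a \<in> carrier PA" "b \<in> carrier PA"
  shows "act (a \<oplus> b) x = act a x + act b x"
proof -
  let ?A = "{y. a y \<noteq> 0} \<union> {y. b y \<noteq> 0}"
  have f: "finite ?A" using assms by (simp add: PA_finite)
  show ?thesis
    using f by (subst (1 2 3) act_conv[of ?A])
      (auto simp: PA_add sum.distrib[symmetric] scale_left_distrib)
qed

lemma act_scale: "a \<in> carrier PA \<Longrightarrow> act (\<lambda>y. r * a y) x = sc r (act a x)"
  by (subst (1 2) act_conv[of "{y. a y \<noteq> 0}"]) (auto simp: PA_finite scale_sum_right)

lemma act_zero: "act \<zero> x = 0"
  by (simp add: act_def PA_zero)

lemma act_path_elem: "act (path_elem y) x = path_act y x"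
  by (subst act_conv[of "{y}"]) (auto simp: path_elem_def)

lemma act_idem: "act (path_elem (u, [], u)) x = e u x"
  by (simp add: act_path_elem e_e)

lemma act_arc: "a \<in> arcs G \<Longrightarrow> act (arc_elem G a) x = T a x"
  by (simp add: act_path_elem arc_elem_def T_e e_T)

lemma act_one: "act \<one> x = (\<Sum>u\<in>verts G. e u x)"
proof -
  let ?i = "\<lambda>u::'v. (u, [], u) :: ('v, 'e) path"
  have "act \<one> x = (\<Sum>y\<in>?i ` verts G. sc (\<one> y) (path_act y x))"
    by (rule act_conv) (auto simp: PA_one split: if_splits)
  also have "\<dots> = (\<Sum>u\<in>verts G. e u x)"
    by (subst sum.reindex) (auto simp: inj_on_def PA_one e_e intro!: sum.cong)
  finally show ?thesis .
qed

lemma act_add_right: "a \<in> carrier PA \<Longrightarrow> act a (x + y) = act a x + act a y"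
  unfolding act_def sum.distrib[symmetric]
  by (rule sum.cong) (auto simp: PA_carrier_iff path_act_add scale_right_distrib simp del: path_act.simps)

lemma act_0_right: "a \<in> carrier PA \<Longrightarrow> act a 0 = 0"
  using act_add_right[of a 0 0] by simp

lemma act_sum_right: "a \<in> carrier PA \<Longrightarrow> act a (\<Sum>i\<in>I. f i) = (\<Sum>i\<in>I. act a (f i))"
  by (induction I rule: infinite_finite_induct) (auto simp: act_0_right act_add_right)

text \<open>Both sides are sums over pairs of paths from the two supports. On the left the pairs are
  grouped by their concatenation; on the right the pairs that do not join contribute zero by
  \<open>path_act_cat\<close>.\<close>

lemma act_mult:
  assumes a: "a \<in> carrier PA" and b: "b \<in> carrier PA"
  shows "act (a \<otimes> b) x = act a (act b x)"
proof -
  let ?A = "{y. a y \<noteq> 0}" and ?B = "{z. b z \<noteq> 0}"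
  let ?J = "{(y, z) \<in> ?A \<times> ?B. joinable y z}"
  let ?U = "(\<lambda>(y, z). path_cat y z) ` ?J"
  have fA: "finite ?A" and fB: "finite ?B" using a b by (simp_all add: PA_finite)
  have fJ: "finite ?J" by (rule finite_subset[of _ "?A \<times> ?B"]) (use fA fB in auto)
  have "act (a \<otimes> b) x = (\<Sum>t\<in>?U. sc ((a \<otimes> b) t) (path_act t x))"
  proof (rule act_conv)
    show "finite ?U" using fJ by simp
    show "{t. (a \<otimes> b) t \<noteq> 0} \<subseteq> ?U"
    proof
      fix t assume "t \<in> {t. (a \<otimes> b) t \<noteq> 0}"
      then obtain y z where "a y \<noteq> 0" "b z \<noteq> 0" "joinable y z" "t = path_cat y z"
        by (auto elim: PA_mult_nonzeroE[OF a b])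
      then show "t \<in> ?U" by (intro image_eqI[of _ _ "(y, z)"]) auto
    qed
  qed
  also have "\<dots> = (\<Sum>t\<in>?U. \<Sum>(y, z) | (y, z) \<in> ?J \<and> path_cat y z = t. sc (a y * b z) (path_act t x))"
    by (intro sum.cong refl, subst PA_mult_conv[OF fA fB])
      (auto simp: scale_sum_left case_prod_beta intro!: sum.cong)
  also have "\<dots> = (\<Sum>t\<in>?U. \<Sum>yz | yz \<in> ?J \<and> (\<lambda>(y, z). path_cat y z) yz = t.
        (\<lambda>(y, z). sc (a y * b z) (path_act (path_cat y z) x)) yz)"
    by (intro sum.cong refl) auto
  also have "\<dots> = (\<Sum>(y, z)\<in>?J. sc (a y * b z) (path_act (path_cat y z) x))"
    using fJ by (subst sum.group) auto
  also have "\<dots> = (\<Sum>(y, z)\<in>?A \<times> ?B. if joinable y z then sc (a y * b z) (path_act (path_cat y z) x) else 0)"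
    using fA fB by (intro sum.mono_neutral_cong_left) (auto split: if_splits simp del: path_cat.simps path_act.simps)
  also have "\<dots> = (\<Sum>(y, z)\<in>?A \<times> ?B. sc (a y) (path_act y (sc (b z) (path_act z x))))"
  proof (rule sum.cong[OF refl], clarify)
    fix w q v u p w' assume nz: "a (w, q, v) \<noteq> 0" "b (u, p, w') \<noteq> 0"
    have w: "awalk w q v" "awalk u p w'" using nz a b by (auto simp: PA_carrier_iff)
    show "(if joinable (w, q, v) (u, p, w')
           then sc (a (w, q, v) * b (u, p, w')) (path_act (path_cat (w, q, v) (u, p, w')) x) else 0) =
          sc (a (w, q, v)) (path_act (w, q, v) (sc (b (u, p, w')) (path_act (u, p, w') x)))"
      by (simp only: path_act_sc[OF w(1)] path_act_cat[OF w] scale_scale scale_zero_right split: if_split)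
        simp
  qed
  also have "\<dots> = (\<Sum>z\<in>?B. act a (sc (b z) (path_act z x)))"
    unfolding act_def by (simp add: sum.cartesian_product[symmetric] sum.swap[of _ ?A])
  also have "\<dots> = act a (act b x)"
    unfolding act_def[of b] by (simp only: act_sum_right[OF a])
  finally show ?thesis .
qed

end


section \<open>Left modules and self-extensions\<close>

context left_module
begin

lemma smult_zero_right: assumes "a \<in> carrier R" shows "a \<odot>\<^bsub>M\<^esub> \<zero>\<^bsub>M\<^esub> = \<zero>\<^bsub>M\<^esub>"
proof -
  have "a \<odot>\<^bsub>M\<^esub> \<zero>\<^bsub>M\<^esub> \<oplus>\<^bsub>M\<^esub> a \<odot>\<^bsub>M\<^esub> \<zero>\<^bsub>M\<^esub> = a \<odot>\<^bsub>M\<^esub> \<zero>\<^bsub>M\<^esub>"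
    using lsmult_r_distr[OF assms, of "\<zero>\<^bsub>M\<^esub>" "\<zero>\<^bsub>M\<^esub>"] by simp
  then show ?thesis using assms by (simp add: lsmult_closed M.add.r_cancel_one)
qed

lemma smult_zero_left: assumes "x \<in> carrier M" shows "\<zero>\<^bsub>R\<^esub> \<odot>\<^bsub>M\<^esub> x = \<zero>\<^bsub>M\<^esub>"
proof -
  have "\<zero>\<^bsub>R\<^esub> \<odot>\<^bsub>M\<^esub> x \<oplus>\<^bsub>M\<^esub> \<zero>\<^bsub>R\<^esub> \<odot>\<^bsub>M\<^esub> x = \<zero>\<^bsub>R\<^esub> \<odot>\<^bsub>M\<^esub> x"
    using lsmult_l_distr[of "\<zero>\<^bsub>R\<^esub>" "\<zero>\<^bsub>R\<^esub>" x] assms by simp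
  then show ?thesis using assms by (simp add: lsmult_closed M.add.r_cancel_one)
qed

lemma smult_finsum_left:
  assumes "x \<in> carrier M" "f \<in> I \<rightarrow> carrier R"
  shows "(\<Oplus>\<^bsub>R\<^esub>i\<in>I. f i) \<odot>\<^bsub>M\<^esub> x = (\<Oplus>\<^bsub>M\<^esub>i\<in>I. f i \<odot>\<^bsub>M\<^esub> x)"
  using assms
  by (induction I rule: infinite_finite_induct)
    (auto simp: smult_zero_left lsmult_l_distr Pi_def lsmult_closed M.finsum_insert)

end

lemma lmod_homD:
  assumes "h \<in> lmod_hom R M N"
  shows "x \<in> carrier M \<Longrightarrow> h x \<in> carrier N"
    and "x \<in> carrier M \<Longrightarrow> y \<in> carrier M \<Longrightarrow> h (x \<oplus>\<^bsub>M\<^esub> y) = h x \<oplus>\<^bsub>N\<^esub> h y"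
    and "a \<in> carrier R \<Longrightarrow> x \<in> carrier M \<Longrightarrow> h (a \<odot>\<^bsub>M\<^esub> x) = a \<odot>\<^bsub>N\<^esub> h x"
  using assms by (auto simp: lmod_hom_def)

lemma additive_map_zero:
  assumes "abelian_group M" "abelian_group N" "h \<in> carrier M \<rightarrow> carrier N"
    and "\<And>x y. x \<in> carrier M \<Longrightarrow> y \<in> carrier M \<Longrightarrow> h (x \<oplus>\<^bsub>M\<^esub> y) = h x \<oplus>\<^bsub>N\<^esub> h y"
  shows "h \<zero>\<^bsub>M\<^esub> = \<zero>\<^bsub>N\<^esub>"
proof -
  interpret M: abelian_group M by fact
  interpret N: abelian_group N by fact
  have "h \<zero>\<^bsub>M\<^esub> \<oplus>\<^bsub>N\<^esub> h \<zero>\<^bsub>M\<^esub> = h \<zero>\<^bsub>M\<^esub>"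
    using assms(4)[of "\<zero>\<^bsub>M\<^esub>" "\<zero>\<^bsub>M\<^esub>"] by simp
  then show ?thesis using assms(3) by (auto simp: N.add.r_cancel_one Pi_def)
qed

lemma additive_map_uminus:
  assumes "abelian_group M" "abelian_group N" "h \<in> carrier M \<rightarrow> carrier N"
    and "\<And>x y. x \<in> carrier M \<Longrightarrow> y \<in> carrier M \<Longrightarrow> h (x \<oplus>\<^bsub>M\<^esub> y) = h x \<oplus>\<^bsub>N\<^esub> h y"
    and "x \<in> carrier M"
  shows "h (\<ominus>\<^bsub>M\<^esub> x) = \<ominus>\<^bsub>N\<^esub> h x"
proof -
  interpret M: abelian_group M by fact
  interpret N: abelian_group N by fact
  have "h (\<ominus>\<^bsub>M\<^esub> x) \<oplus>\<^bsub>N\<^esub> h x = \<zero>\<^bsub>N\<^esub>"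
    using assms(4)[of "\<ominus>\<^bsub>M\<^esub> x" x] assms(5) additive_map_zero[OF assms(1-4)]
    by (simp add: M.l_neg)
  then show ?thesis using assms(3,5) by (intro N.minus_equality[symmetric]) (auto simp: Pi_def)
qed

lemma lmod_hom_zero:
  assumes "left_module R M" "left_module R N" "h \<in> lmod_hom R M N"
  shows "h \<zero>\<^bsub>M\<^esub> = \<zero>\<^bsub>N\<^esub>"
  using assms by (intro additive_map_zero) (auto simp: left_module_def lmod_homD)

lemma lmod_hom_minus:
  assumes "left_module R M" "left_module R N" "h \<in> lmod_hom R M N" "x \<in> carrier M" "y \<in> carrier M"
  shows "h (x \<ominus>\<^bsub>M\<^esub> y) = h x \<ominus>\<^bsub>N\<^esub> h y"
proof -
  interpret M: left_module R M by fact
  interpret N: left_module R N by fact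
  have "h (\<ominus>\<^bsub>M\<^esub> y) = \<ominus>\<^bsub>N\<^esub> h y"
    using assms by (intro additive_map_uminus) (auto simp: left_module_def lmod_homD)
  then show ?thesis using assms by (simp add: a_minus_def lmod_homD)
qed

lemma lmod_hom_comp:
  "h \<in> lmod_hom R M N \<Longrightarrow> h' \<in> lmod_hom R N L \<Longrightarrow> (\<lambda>x. h' (h x)) \<in> lmod_hom R M L"
  by (auto simp: lmod_hom_def Pi_def)

lemma lmod_hom_inverse:
  assumes "left_module R M" "h \<in> lmod_hom R M N" "bij_betw h (carrier M) (carrier N)"
  shows "inv_into (carrier M) h \<in> lmod_hom R N M"
proof -
  interpret M: left_module R M by fact
  let ?g = "inv_into (carrier M) h"
  have g: "?g y \<in> carrier M" "h (?g y) = y" if "y \<in> carrier N" for y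
    using assms(3) that by (auto simp: bij_betw_def inv_into_into f_inv_into_f)
  have gh: "?g (h x) = x" if "x \<in> carrier M" for x
    using assms(3) that by (simp add: bij_betw_def)
  have "?g (y \<oplus>\<^bsub>N\<^esub> z) = ?g y \<oplus>\<^bsub>M\<^esub> ?g z" if "y \<in> carrier N" "z \<in> carrier N" for y z
    using gh[of "?g y \<oplus>\<^bsub>M\<^esub> ?g z"] that by (simp add: g lmod_homD[OF assms(2)])
  moreover have "?g (a \<odot>\<^bsub>N\<^esub> y) = a \<odot>\<^bsub>M\<^esub> ?g y" if "a \<in> carrier R" "y \<in> carrier N" for a y
    using gh[of "a \<odot>\<^bsub>M\<^esub> ?g y"] that by (simp add: g lmod_homD[OF assms(2)] M.lsmult_closed)
  ultimately show ?thesis by (auto simp: lmod_hom_def g)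
qed

lemma lmod_isomorphic_sym:
  assumes "left_module R M" "lmod_isomorphic R M N"
  shows "lmod_isomorphic R N M"
  using assms(2) lmod_hom_inverse[OF assms(1)] bij_betw_inv_into unfolding lmod_isomorphic_def by blast

lemma lmod_isomorphic_trans:
  "lmod_isomorphic R M N \<Longrightarrow> lmod_isomorphic R N L \<Longrightarrow> lmod_isomorphic R M L"
  unfolding lmod_isomorphic_def using lmod_hom_comp bij_betw_trans[unfolded comp_def] by blast

lemma left_module_direct_sum:
  assumes "left_module R M" "left_module R N"
  shows "left_module R (lmod_direct_sum M N)"
proof -
  interpret M: left_module R M by fact
  interpret N: left_module R N by fact
  have "abelian_group (lmod_direct_sum M N)"
  proof (rule abelian_groupI)
    fix x assume "x \<in> carrier (lmod_direct_sum M N)"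
    then show "\<exists>y\<in>carrier (lmod_direct_sum M N).
        y \<oplus>\<^bsub>lmod_direct_sum M N\<^esub> x = \<zero>\<^bsub>lmod_direct_sum M N\<^esub>"
      by (intro bexI[of _ "(\<ominus>\<^bsub>M\<^esub> fst x, \<ominus>\<^bsub>N\<^esub> snd x)"])
        (auto simp: lmod_direct_sum_def M.l_neg N.l_neg)
  qed (auto simp: lmod_direct_sum_def M.add.m_ac N.add.m_ac)
  then show ?thesis
    unfolding left_module_def left_module_axioms_def
    by (auto simp: M.ring_axioms lmod_direct_sum_def M.lsmult_closed N.lsmult_closed
        M.lsmult_l_distr N.lsmult_l_distr M.lsmult_r_distr N.lsmult_r_distr
        M.lsmult_assoc N.lsmult_assoc M.lsmult_one N.lsmult_one)
qed

text \<open>Transport of structure along an injection. It moves modules built from polynomial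
  vectors into the element types prescribed by \<open>extensions\<close> and by
  \<open>Hmod\<close>.\<close>

definition transported :: "('r, 'm) module \<Rightarrow> ('m \<Rightarrow> 'n) \<Rightarrow> ('r, 'n) module" where
  "transported M f = (let g = inv_into (carrier M) f in
    \<lparr> carrier = f ` carrier M, mult = undefined, one = undefined, zero = f \<zero>\<^bsub>M\<^esub>,
      add = (\<lambda>x y. f (g x \<oplus>\<^bsub>M\<^esub> g y)), smult = (\<lambda>a x. f (a \<odot>\<^bsub>M\<^esub> g x)) \<rparr>)"

lemma transported:
  assumes "left_module R M" "inj_on f (carrier M)"
  shows "left_module R (transported M f)" "f \<in> lmod_hom R M (transported M f)"
    "bij_betw f (carrier M) (carrier (transported M f))"
proof -
  interpret M: left_module R M by fact
  let ?N = "transported M f"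
  have [simp]: "carrier ?N = f ` carrier M" "\<zero>\<^bsub>?N\<^esub> = f \<zero>\<^bsub>M\<^esub>"
    by (simp_all add: transported_def Let_def)
  have [simp]: "f x \<oplus>\<^bsub>?N\<^esub> f y = f (x \<oplus>\<^bsub>M\<^esub> y)" "a \<odot>\<^bsub>?N\<^esub> f x = f (a \<odot>\<^bsub>M\<^esub> x)"
    if "x \<in> carrier M" "y \<in> carrier M" for x y a
    using that assms(2) by (simp_all add: transported_def Let_def)
  have "abelian_group ?N"
  proof (rule abelian_groupI)
    fix x assume "x \<in> carrier ?N"
    then obtain x' where "x = f x'" "x' \<in> carrier M" by auto
    then show "\<exists>y\<in>carrier ?N. y \<oplus>\<^bsub>?N\<^esub> x = \<zero>\<^bsub>?N\<^esub>"
      by (intro bexI[of _ "f (\<ominus>\<^bsub>M\<^esub> x')"]) (auto simp: M.l_neg)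
  qed (auto simp: M.add.m_ac)
  then show "left_module R ?N"
    unfolding left_module_def left_module_axioms_def
    by (auto simp: M.ring_axioms M.lsmult_closed M.lsmult_l_distr M.lsmult_r_distr
        M.lsmult_assoc M.lsmult_one)
  show "f \<in> lmod_hom R M ?N" by (auto simp: lmod_hom_def)
  show "bij_betw f (carrier M) (carrier ?N)" using assms(2) by (simp add: bij_betw_def)
qed

text \<open>The five lemma by a diagram chase: differences that vanish in \<open>M\<close> come from
  \<open>N\<close>, where \<open>h\<close> is known.\<close>

lemma extension_hom_bij:
  assumes "left_module R M" "left_module R N"
    and "(f, E, g) \<in> extensions R M N" "(f', E', g') \<in> extensions R M N"
    and h: "h \<in> lmod_hom R E E'" and hf: "\<And>x. x \<in> carrier N \<Longrightarrow> h (f x) = f' x"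
    and gh: "\<And>e. e \<in> carrier E \<Longrightarrow> g' (h e) = g e"
  shows "bij_betw h (carrier E) (carrier E')"
proof -
  have mods: "left_module R E" "left_module R E'" using assms(3,4) by (auto simp: extensions_def)
  interpret E: left_module R E by fact
  interpret E': left_module R E' by fact
  interpret M: left_module R M by fact
  interpret N: left_module R N by fact
  have f: "f \<in> lmod_hom R N E" and g: "g \<in> lmod_hom R E M" "g ` carrier E = carrier M"
    and f': "f' \<in> lmod_hom R N E'" "inj_on f' (carrier N)" and g': "g' \<in> lmod_hom R E' M"
    and ker: "f ` carrier N = {e \<in> carrier E. g e = \<zero>\<^bsub>M\<^esub>}"
    and ker': "f' ` carrier N = {e \<in> carrier E'. g' e = \<zero>\<^bsub>M\<^esub>}"
    using assms(3,4) by (auto simp: extensions_def)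
  show ?thesis unfolding bij_betw_def
  proof
    show "inj_on h (carrier E)"
    proof (rule inj_onI)
      fix x y assume xy: "x \<in> carrier E" "y \<in> carrier E" "h x = h y"
      have "g x = g y" using gh[of x] gh[of y] xy by simp
      then have "g (x \<ominus>\<^bsub>E\<^esub> y) = \<zero>\<^bsub>M\<^esub>"
        using xy lmod_homD(1)[OF g(1)] by (simp add: lmod_hom_minus[OF mods(1) assms(1) g(1)], simp add: a_minus_def M.r_neg)
      then obtain n where n: "n \<in> carrier N" "x \<ominus>\<^bsub>E\<^esub> y = f n" using ker xy by blast
      have "f' n = h (x \<ominus>\<^bsub>E\<^esub> y)" by (simp add: n hf)
      also have "\<dots> = \<zero>\<^bsub>E'\<^esub>"
        using xy lmod_homD(1)[OF h] by (simp add: lmod_hom_minus[OF mods h]) (simp add: a_minus_def E'.r_neg)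
      finally have "f' n = f' \<zero>\<^bsub>N\<^esub>" by (simp add: lmod_hom_zero[OF assms(2) mods(2) f'(1)])
      then have "n = \<zero>\<^bsub>N\<^esub>" using f'(2) n by (auto dest: inj_onD)
      then have "x \<ominus>\<^bsub>E\<^esub> y = \<zero>\<^bsub>E\<^esub>" by (simp add: n lmod_hom_zero[OF assms(2) mods(1) f])
      then show "x = y" using xy E.minus_equality[of x "\<ominus>\<^bsub>E\<^esub> y"] by (simp add: a_minus_def)
    qed
    show "h ` carrier E = carrier E'"
    proof (intro equalityI subsetI)
      fix y assume y: "y \<in> carrier E'"
      then have "g' y \<in> g ` carrier E" using g(2) lmod_homD(1)[OF g'] by blast
      then obtain x where x: "x \<in> carrier E" "g' y = g x" by auto
      have hx: "h x \<in> carrier E'" using lmod_homD(1)[OF h x(1)] .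
      have "g' (y \<ominus>\<^bsub>E'\<^esub> h x) = \<zero>\<^bsub>M\<^esub>"
        using x y hx lmod_homD(1)[OF g(1)]
        by (simp add: lmod_hom_minus[OF mods(2) assms(1) g'] gh) (simp add: a_minus_def M.r_neg)
      then obtain n where n: "n \<in> carrier N" "y \<ominus>\<^bsub>E'\<^esub> h x = f' n" using ker' y hx by blast
      have "h (f n \<oplus>\<^bsub>E\<^esub> x) = f' n \<oplus>\<^bsub>E'\<^esub> h x"
        using x n lmod_homD(1)[OF f] by (simp add: lmod_homD(2)[OF h] hf)
      also have "\<dots> = y" unfolding n(2)[symmetric]
        using y hx by (simp add: a_minus_def E'.add.m_assoc E'.l_neg)
      finally show "y \<in> h ` carrier E" using x n lmod_homD(1)[OF f] by (metis E.add.m_closed imageI)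
    qed (use lmod_homD(1)[OF h] in auto)
  qed
qed

text \<open>Symmetry is the point with content: connecting maps can be inverted by
  \<open>extension_hom_bij\<close>.\<close>

lemma equiv_extension_equiv:
  assumes "left_module R M" "left_module R N"
  shows "equiv (extensions R M N) (extension_equiv R M N)"
proof (rule equivI)
  show "extension_equiv R M N \<subseteq> extensions R M N \<times> extensions R M N"
    by (auto simp: extension_equiv_def)
  show "refl_on (extensions R M N) (extension_equiv R M N)"
  proof (rule refl_onI)
    fix X assume X: "X \<in> extensions R M N"
    obtain f E g where "X = (f, E, g)" by (cases X)
    moreover have "id \<in> lmod_hom R E E" by (simp add: lmod_hom_def)
    ultimately show "(X, X) \<in> extension_equiv R M N" using X by (auto simp: extension_equiv_def intro!: bexI[of _ id])
  qed
  show "sym (extension_equiv R M N)"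
  proof (rule symI)
    fix X Y assume XY: "(X, Y) \<in> extension_equiv R M N"
    obtain f E g f' E' g' where eqs: "X = (f, E, g)" "Y = (f', E', g')" by (cases X, cases Y)
    obtain h where X: "(f, E, g) \<in> extensions R M N" and Y: "(f', E', g') \<in> extensions R M N"
      and h: "h \<in> lmod_hom R E E'" and hf: "\<And>x. x \<in> carrier N \<Longrightarrow> h (f x) = f' x"
      and gh: "\<And>e. e \<in> carrier E \<Longrightarrow> g' (h e) = g e"
      using XY by (auto simp: extension_equiv_def eqs)
    have bij: "bij_betw h (carrier E) (carrier E')" by (rule extension_hom_bij[OF assms X Y h hf gh])
    have E: "left_module R E" and f: "f \<in> lmod_hom R N E" using X by (auto simp: extensions_def)
    have "inv_into (carrier E) h (f' x) = f x" if "x \<in> carrier N" for x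
      using bij lmod_homD(1)[OF f that] hf[OF that] by (metis bij_betw_def inv_into_f_f)
    moreover have "g (inv_into (carrier E) h e) = g' e" if "e \<in> carrier E'" for e
      using bij gh[of "inv_into (carrier E) h e"] that
      by (simp add: bij_betw_def f_inv_into_f inv_into_into)
    ultimately show "(Y, X) \<in> extension_equiv R M N"
      using X Y unfolding extension_equiv_def eqs
      by (auto intro!: bexI[OF _ lmod_hom_inverse[OF E h bij]])
  qed
  show "trans (extension_equiv R M N)"
  proof (rule transI, clarsimp simp: extension_equiv_def)
    fix f E g f' E' g' f'' E'' g'' h h'
    assume h: "h \<in> lmod_hom R E E'" and h': "h' \<in> lmod_hom R E' E''"
      and "\<forall>x\<in>carrier N. h (f x) = f' x" "\<forall>e\<in>carrier E. g' (h e) = g e"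
        "\<forall>x\<in>carrier N. h' (f' x) = f'' x" "\<forall>e\<in>carrier E'. g'' (h' e) = g' e"
    then show "\<exists>h\<in>lmod_hom R E E''. (\<forall>x\<in>carrier N. h (f x) = f'' x) \<and> (\<forall>e\<in>carrier E. g'' (h e) = g e)"
      using lmod_homD(1)[OF h] by (intro bexI[OF _ lmod_hom_comp[OF h h']]) auto
  qed
qed

lemma split_extension:
  assumes "left_module R M" "left_module R N"
  shows "(\<lambda>x. (x, \<zero>\<^bsub>M\<^esub>), lmod_direct_sum N M, snd) \<in> extensions R M N"
proof -
  interpret M: left_module R M by fact
  interpret N: left_module R N by fact
  show ?thesis
    using left_module_direct_sum[OF assms(2,1)]
    by (auto simp: extensions_def lmod_hom_def lmod_direct_sum_def M.smult_zero_right inj_on_def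
        intro!: image_eqI[of _ snd "(\<zero>\<^bsub>N\<^esub>, _)"])
qed

text \<open>\<open>Ext1\<close> is a quotient set, so it is trivial iff every extension is
  equivalent to the split one. A connecting map out of the split extension is \<open>f\<close> on
  the first summand, so its only freedom is a section of \<open>g\<close> on the second.\<close>

lemma rigid_iff_sections:
  fixes M :: "('r, 'm) module"
  assumes M: "left_module R M"
  shows "rigid R M \<longleftrightarrow> (\<forall>(f, E, g)\<in>extensions R M M. \<exists>s\<in>lmod_hom R M E. \<forall>x\<in>carrier M. g (s x) = x)"
proof -
  interpret M: left_module R M by fact
  define S where "S = (\<lambda>x :: 'm. (x, \<zero>\<^bsub>M\<^esub>), lmod_direct_sum M M, snd :: 'm \<times> 'm \<Rightarrow> 'm)"
  let ?X = "extensions R M M" and ?r = "extension_equiv R M M"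
  have S: "S \<in> ?X" unfolding S_def by (rule split_extension[OF M M])
  have eq: "equiv ?X ?r" by (rule equiv_extension_equiv[OF M M])
  have sec: "(S, (f, E, g)) \<in> ?r \<longleftrightarrow> (\<exists>s\<in>lmod_hom R M E. \<forall>x\<in>carrier M. g (s x) = x)"
    if X: "(f, E, g) \<in> ?X" for f E g
  proof
    assume "(S, (f, E, g)) \<in> ?r"
    then obtain h where h: "h \<in> lmod_hom R (lmod_direct_sum M M) E"
      and gh: "\<forall>e\<in>carrier (lmod_direct_sum M M). g (h e) = snd e"
      by (auto simp: S_def extension_equiv_def)
    have "(\<lambda>x. h (\<zero>\<^bsub>M\<^esub>, x)) \<in> lmod_hom R M E"
      by (rule lmod_hom_comp[OF _ h])
        (auto simp: lmod_hom_def lmod_direct_sum_def M.smult_zero_right)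
    then show "\<exists>s\<in>lmod_hom R M E. \<forall>x\<in>carrier M. g (s x) = x"
      by (rule rev_bexI) (use gh in \<open>auto simp: lmod_direct_sum_def\<close>)
  next
    assume "\<exists>s\<in>lmod_hom R M E. \<forall>x\<in>carrier M. g (s x) = x"
    then obtain s where s: "s \<in> lmod_hom R M E" and gs: "\<And>x. x \<in> carrier M \<Longrightarrow> g (s x) = x" by auto
    have E: "left_module R E" and f: "f \<in> lmod_hom R M E" and g: "g \<in> lmod_hom R E M"
      and ker: "f ` carrier M = {e \<in> carrier E. g e = \<zero>\<^bsub>M\<^esub>}"
      using X by (auto simp: extensions_def)
    interpret E: left_module R E by fact
    note [simp] = lmod_homD(1)[OF f] lmod_homD(1)[OF s] lmod_homD(1)[OF g]
    have gf: "g (f x) = \<zero>\<^bsub>M\<^esub>" if "x \<in> carrier M" for x using ker that by blast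
    let ?h = "\<lambda>(x, y). f x \<oplus>\<^bsub>E\<^esub> s y"
    have "?h \<in> lmod_hom R (lmod_direct_sum M M) E"
      by (auto simp: lmod_hom_def lmod_direct_sum_def lmod_homD[OF f] lmod_homD[OF s]
          E.lsmult_r_distr E.add.m_ac)
    moreover have "?h (x, \<zero>\<^bsub>M\<^esub>) = f x" if "x \<in> carrier M" for x
      using that lmod_hom_zero[OF M E s] by simp
    moreover have "g (?h e) = snd e" if "e \<in> carrier (lmod_direct_sum M M)" for e
      using that by (auto simp: lmod_direct_sum_def lmod_homD[OF g] gf gs)
    ultimately show "(S, (f, E, g)) \<in> ?r"
      using S X unfolding S_def extension_equiv_def by blast
  qed
  have "rigid R M \<longleftrightarrow> (\<forall>X\<in>?X. (S, X) \<in> ?r)"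
  proof
    assume r: "rigid R M"
    show "\<forall>X\<in>?X. (S, X) \<in> ?r"
    proof
      fix X assume X: "X \<in> ?X"
      then have "?r `` {X} \<in> Ext1 R M M" by (auto simp: Ext1_def quotient_def)
      then have "?r `` {X} = ?r `` {S}" using r by (simp add: rigid_def Ext1_zero_def S_def)
      then show "(S, X) \<in> ?r" using X eq_equiv_class[OF _ eq] by metis
    qed
  next
    assume r: "\<forall>X\<in>?X. (S, X) \<in> ?r"
    have "Ext1 R M M = (\<lambda>X. ?r `` {X}) ` ?X"
      unfolding Ext1_def quotient_def by blast
    also have "\<dots> = (\<lambda>X. ?r `` {S}) ` ?X"
      using equiv_class_eq[OF eq] r by (intro image_cong refl) metis
    finally have "Ext1 R M M = {?r `` {S}}" using S by blast
    then show "rigid R M" by (simp add: rigid_def Ext1_zero_def S_def)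
  qed
  then show ?thesis using sec by auto
qed


section \<open>Polynomial models of locally free modules\<close>

text \<open>The component at \<open>i\<close> of a vector is an element of \<open>K[x]\<^sup>r\<^sup>i\<close> for a rank vector \<open>r\<close>, where \<open>x\<close> stands
  for \<open>\<epsilon>\<^sub>i\<close>; its coordinates from \<open>r i\<close> on are cut off.\<close>

type_synonym ('n, 'k) pvec = "'n \<Rightarrow> nat \<Rightarrow> 'k poly"

text \<open>One polynomial per vertex, the same for all coordinates there. This covers the scalars
  of \<open>K\<close>, powers of the loops, the selection of a vertex, and \<epsilon>^k, which is
  \<open>x^(k c_i)\<close> at the vertex i.\<close>

definition dmul :: "('n \<Rightarrow> 'k::field poly) \<Rightarrow> ('n, 'k) pvec \<Rightarrow> ('n, 'k) pvec" where
  "dmul p v = (\<lambda>i l. p i * v i l)"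

abbreviation vsc :: "'k::field \<Rightarrow> ('n, 'k) pvec \<Rightarrow> ('n, 'k) pvec" where
  "vsc a \<equiv> dmul (\<lambda>_. [:a:])"

abbreviation shift :: "('n \<Rightarrow> nat) \<Rightarrow> ('n, 'k::field) pvec \<Rightarrow> ('n, 'k) pvec" where
  "shift d \<equiv> dmul (\<lambda>i. monom 1 (d i))"

definition cut :: "('n \<Rightarrow> nat) \<Rightarrow> ('n, 'k::field) pvec \<Rightarrow> ('n, 'k) pvec" where
  "cut r v = (\<lambda>i l. if l < r i then v i l else 0)"

definition vproj :: "('n \<Rightarrow> nat) \<Rightarrow> 'n \<Rightarrow> ('n, 'k::field) pvec \<Rightarrow> ('n, 'k) pvec" where
  "vproj r i v = (\<lambda>j l. if j = i \<and> l < r j then v j l else 0)"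

definition vunit :: "'n \<Rightarrow> nat \<Rightarrow> 'k::field poly \<Rightarrow> ('n, 'k) pvec" where
  "vunit i l p = (\<lambda>j m. if j = i \<and> m = l then p else 0)"

definition vdvd :: "('n \<Rightarrow> nat) \<Rightarrow> ('n, 'k::field) pvec \<Rightarrow> bool" where
  "vdvd d v \<longleftrightarrow> (\<forall>i l. monom 1 (d i) dvd v i l)"

definition klinear :: "(('n, 'k::field) pvec \<Rightarrow> ('n, 'k) pvec) \<Rightarrow> bool" where
  "klinear g \<longleftrightarrow> (\<forall>v w. g (v + w) = g v + g w) \<and> (\<forall>a v. g (vsc a v) = vsc a (g v))"

lemma monom_add_exp: "monom 1 (a + b) = monom 1 a * (monom 1 b :: 'k::field poly)"
  by (simp add: mult_monom)

lemma sum_fun_apply: "(\<Sum>i\<in>I. f i) x = (\<Sum>i\<in>I. f i x)"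
  by (induction I rule: infinite_finite_induct) auto

lemma dmul_add: "dmul p (v + w) = dmul p v + dmul p w"
  and dmul_diff: "dmul p (v - w) = dmul p v - dmul p w"
  and dmul_0: "dmul p 0 = 0"
  and dmul_dmul: "dmul p (dmul p' v) = dmul (\<lambda>i. p i * p' i) v"
  and dmul_1: "dmul (\<lambda>_. 1) v = v"
  and dmul_plus: "dmul (\<lambda>i. p i + p' i) v = dmul p v + dmul p' v"
  by (auto simp: dmul_def fun_eq_iff algebra_simps)

lemma dmul_sum: "dmul p (\<Sum>i\<in>I. f i) = (\<Sum>i\<in>I. dmul p (f i))"
  by (simp add: fun_eq_iff sum_fun_apply dmul_def sum_distrib_left)

lemma dmul_commute: "dmul p (dmul p' v) = dmul p' (dmul p v)"
  by (simp add: dmul_dmul mult.commute)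

lemma shift_shift: "shift d (shift d' v) = shift (\<lambda>i. d i + d' i) v"
  by (simp add: dmul_dmul mult_monom)

lemma shift_inj: "shift d v = shift d w \<longleftrightarrow> v = w"
  by (simp add: dmul_def fun_eq_iff)

lemma dmul_cut: "dmul p (cut r v) = cut r (dmul p v)"
  and dmul_vproj: "dmul p (vproj r i v) = vproj r i (dmul p v)"
  and dmul_vproj_const: "dmul p (vproj r i v) = dmul (\<lambda>_. p i) (vproj r i v)"
  and vproj_eq_cut: "vproj r i v = cut r (dmul (\<lambda>j. if j = i then 1 else 0) v)"
  and cut_cut: "cut r (cut r v) = cut r v"
  and cut_vproj: "cut r (vproj r i v) = vproj r i v"
  and vproj_cut: "vproj r i (cut r v) = vproj r i v"
  and vproj_vproj: "vproj r i (vproj r j v) = (if i = j then vproj r i v else 0)"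
  by (auto simp: dmul_def cut_def vproj_def fun_eq_iff)

lemma cut_add: "cut r (v + w) = cut r v + cut r w"
  and cut_diff: "cut r (v - w) = cut r v - cut r w"
  and vproj_add: "vproj r i (v + w) = vproj r i v + vproj r i w"
  and vproj_diff: "vproj r i (v - w) = vproj r i v - vproj r i w"
  and cut_0: "cut r 0 = 0" and vproj_0: "vproj r i 0 = 0"
  by (auto simp: cut_def vproj_def fun_eq_iff)

lemma vproj_sum:
  fixes g :: "'c \<Rightarrow> ('a, 'b::field) pvec"
  shows "vproj r i (\<Sum>l\<in>I. g l) = (\<Sum>l\<in>I. vproj r i (g l))"
proof (intro ext)
  fix j l show "vproj r i (\<Sum>l\<in>I. g l) j l = (\<Sum>l\<in>I. vproj r i (g l)) j l"
  proof (cases "j = i \<and> l < r j")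
    case False
    then have "vproj r i v j l = 0" for v :: "('a, 'b) pvec" by (auto simp: vproj_def)
    then show ?thesis by (simp add: sum_fun_apply)
  qed (simp add: sum_fun_apply vproj_def)
qed

lemma sum_vproj: "(\<Sum>i\<in>UNIV. vproj r i v) = cut r v" for v :: "('n::finite, 'k::field) pvec"
  by (auto simp: fun_eq_iff sum_fun_apply vproj_def cut_def)

lemma vproj_eq_sum_vunit: "vproj r i v = (\<Sum>l<r i. vunit i l (v i l))"
  by (auto simp: fun_eq_iff sum_fun_apply vproj_def vunit_def)

lemma vproj_vunit: "vproj r i (vunit j l p) = (if i = j \<and> l < r i then vunit j l p else 0)"
  by (auto simp: fun_eq_iff vproj_def vunit_def)

lemma dmul_vunit: "dmul p (vunit i l p') = vunit i l (p i * p')"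
  by (auto simp: fun_eq_iff dmul_def vunit_def)

lemma vdvd_iff_shift: "vdvd d v \<longleftrightarrow> (\<exists>w. v = shift d w)"
proof
  assume "vdvd d v"
  then have "v = shift d (\<lambda>i l. v i l div monom 1 (d i))"
    by (simp add: vdvd_def dmul_def)
  then show "\<exists>w. v = shift d w" by blast
qed (auto simp: vdvd_def dmul_def)

lemma vdvd_0: "vdvd d 0"
  and vdvd_add: "vdvd d v \<Longrightarrow> vdvd d w \<Longrightarrow> vdvd d (v + w)"
  and vdvd_diff: "vdvd d v \<Longrightarrow> vdvd d w \<Longrightarrow> vdvd d (v - w)"
  and vdvd_dmul: "vdvd d v \<Longrightarrow> vdvd d (dmul p v)"
  and vdvd_cut: "vdvd d v \<Longrightarrow> vdvd d (cut r v)"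
  and vdvd_vproj: "vdvd d v \<Longrightarrow> vdvd d (vproj r i v)"
  by (auto simp: vdvd_def dmul_def cut_def vproj_def)

lemma vdvd_minus: "vdvd d (- v) \<longleftrightarrow> vdvd d v"
  by (simp add: vdvd_def)

lemma vdvd_mono:
  assumes "vdvd d v" "\<And>i. d' i \<le> d i" shows "vdvd d' v"
proof -
  have "monom 1 (d' i) dvd (monom 1 (d i) :: 'b poly)" for i
    using monom_add_exp[of "d' i" "d i - d' i"] assms(2)[of i] by (metis dvd_triv_left le_add_diff_inverse)
  then show ?thesis using assms(1) unfolding vdvd_def by (meson dvd_trans)
qed

lemma vdvd_shift_iff: "vdvd (\<lambda>i. d i + d' i) (shift d v) \<longleftrightarrow> vdvd d' v"
  by (simp add: vdvd_def dmul_def monom_add_exp)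

lemma vdvd_cong: "vdvd d (v - w) \<Longrightarrow> vdvd d v \<longleftrightarrow> vdvd d w"
  using vdvd_add[of d "v - w" w] vdvd_diff[of d v "v - w"] by auto

lemma additive_simps:
  assumes "\<And>v w. g (v + w) = g v + g w"
  shows "g 0 = (0 :: 'b::ab_group_add)" "g (v - w) = g v - g (w :: 'a::ab_group_add)"
proof -
  show "g 0 = 0" using assms[of 0 0] by simp
  show "g (v - w) = g v - g w" using assms[of "v - w" w] by simp
qed

lemma klinearD:
  assumes "klinear g"
  shows "g (v + w) = g v + g w" "g (vsc a v) = vsc a (g v)" "g 0 = 0" "g (v - w) = g v - g w"
  using assms additive_simps[of g] by (auto simp: klinear_def)


subsection \<open>Homomorphisms over the loops, and arrow maps\<close>

text \<open>Commuting with \<open>dmul p\<close> for every family \<open>p\<close>, in particular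
  for the indicator of a vertex, forces such a map to respect the vertices. The two
  \<open>cut\<close> conditions make it a map between free modules of ranks \<open>r\<close> and
  \<open>r'\<close>, extended by zero.\<close>

definition hom_space :: "('n \<Rightarrow> nat) \<Rightarrow> ('n \<Rightarrow> nat) \<Rightarrow> (('n, 'k::field) pvec \<Rightarrow> ('n, 'k) pvec) set" where
  "hom_space r r' = {h. (\<forall>v w. h (v + w) = h v + h w) \<and> (\<forall>p v. h (dmul p v) = dmul p (h v)) \<and>
     (\<forall>v. h (cut r v) = h v) \<and> (\<forall>v. cut r' (h v) = h v)}"

text \<open>Such a map is linear over \<open>K\<close> only and turns \<open>x^f\<close> into
  \<open>x^f'\<close>. The condition is imposed on polynomials, not modulo a power of \<epsilon>, so
  the space is the same at all levels.\<close>

definition arrow_space :: "('n \<Rightarrow> nat) \<Rightarrow> ('n \<Rightarrow> nat) \<Rightarrow> 'n \<Rightarrow> 'n \<Rightarrow> nat \<Rightarrow> nat \<Rightarrow>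
    (('n, 'k::field) pvec \<Rightarrow> ('n, 'k) pvec) set" where
  "arrow_space r r' i j f' f = {g. klinear g \<and> (\<forall>v. g (vproj r j v) = g v) \<and>
     (\<forall>v. vproj r' i (g v) = g v) \<and> (\<forall>v. g (shift (\<lambda>_. f) v) = shift (\<lambda>_. f') (g v))}"

lemma hom_spaceD:
  assumes "h \<in> hom_space r r'"
  shows "h (v + w) = h v + h w" "h (dmul p v) = dmul p (h v)" "h (cut r v) = h v"
    "cut r' (h v) = h v" "h 0 = 0" "h (v - w) = h v - h w" "vproj r' i (h v) = h (vproj r i v)"
  using assms additive_simps[of h] by (auto simp: hom_space_def vproj_eq_cut) metis+

lemma arrow_spaceD:
  assumes "g \<in> arrow_space r r' i j f' f"
  shows "klinear g" "g (vproj r j v) = g v" "vproj r' i (g v) = g v"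
    "g (shift (\<lambda>_. f) v) = shift (\<lambda>_. f') (g v)"
  using assms by (auto simp: arrow_space_def)

lemma hom_space_comp:
  "h \<in> hom_space r r' \<Longrightarrow> h' \<in> hom_space r' r'' \<Longrightarrow> (\<lambda>v. h' (h v)) \<in> hom_space r r''"
  by (simp add: hom_space_def)

lemma hom_space_diff:
  "h \<in> hom_space r r' \<Longrightarrow> h' \<in> hom_space r r' \<Longrightarrow> (\<lambda>v. h v - h' v) \<in> hom_space r r'"
  by (simp add: hom_space_def dmul_diff cut_diff)

lemma hom_space_add:
  "h \<in> hom_space r r' \<Longrightarrow> h' \<in> hom_space r r' \<Longrightarrow> (\<lambda>v. h v + h' v) \<in> hom_space r r'"
  by (simp add: hom_space_def dmul_add cut_add add_ac)

lemma hom_space_dmul: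
  "h \<in> hom_space r r' \<Longrightarrow> (\<lambda>v. dmul p (h v)) \<in> hom_space r r'"
  by (simp add: hom_space_def dmul_add dmul_cut[symmetric] dmul_commute[of p])

lemma arrow_space_diff:
  "g \<in> arrow_space r r' i j f' f \<Longrightarrow> g' \<in> arrow_space r r' i j f' f \<Longrightarrow>
   (\<lambda>v. g v - g' v) \<in> arrow_space r r' i j f' f"
  by (simp add: arrow_space_def klinear_def dmul_diff vproj_diff)

lemma arrow_space_hom_left:
  assumes "g \<in> arrow_space r r' i j f' f" "h \<in> hom_space r' r''"
  shows "(\<lambda>v. h (g v)) \<in> arrow_space r r'' i j f' f"
  using arrow_spaceD[OF assms(1)] hom_spaceD[OF assms(2)] by (simp add: arrow_space_def klinear_def)

lemma arrow_space_hom_right: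
  assumes "g \<in> arrow_space r' r'' i j f' f" "h \<in> hom_space r r'"
  shows "(\<lambda>v. g (h v)) \<in> arrow_space r r'' i j f' f"
  using arrow_spaceD[OF assms(1)] hom_spaceD[OF assms(2)]
  by (simp add: arrow_space_def klinear_def) metis

lemma arrow_space_shift_mult:
  assumes "g \<in> arrow_space r r' i j f' f"
  shows "g (shift (\<lambda>_. n * f) v) = shift (\<lambda>_. n * f') (g v)"
proof (induction n)
  case (Suc n)
  have "g (shift (\<lambda>_. Suc n * f) v) = g (shift (\<lambda>_. f) (shift (\<lambda>_. n * f) v))"
    by (simp add: shift_shift)
  then show ?case by (simp add: arrow_spaceD(4)[OF assms] Suc) (simp add: shift_shift)
qed (simp add: dmul_1)

text \<open>Only the component at \<open>j\<close> enters and only the one at \<open>i\<close> comes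
  out, so just two exponents of \<open>d\<close> count, and they are the same multiple of
  \<open>f\<close> and of \<open>f'\<close>.\<close>

lemma arrow_space_shift:
  assumes g: "g \<in> arrow_space r r' i j f' f" and d: "d j = n * f" "d i = n * f'"
  shows "g (shift d v) = shift d (g v)"
proof -
  have "g (shift d v) = g (shift d (vproj r j v))"
    by (simp add: dmul_vproj arrow_spaceD(2)[OF g])
  also have "\<dots> = g (shift (\<lambda>_. n * f) (vproj r j v))" by (subst dmul_vproj_const) (simp add: d)
  also have "\<dots> = shift (\<lambda>_. n * f') (vproj r' i (g v))"
    by (simp add: arrow_space_shift_mult[OF g] arrow_spaceD[OF g])
  also have "\<dots> = shift d (vproj r' i (g v))" by (subst (2) dmul_vproj_const) (simp add: d)
  finally show ?thesis by (simp add: arrow_spaceD(3)[OF g])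
qed

text \<open>Multiplication by powers of \<open>x\<close> is injective and commutes with scalars,
  projections and shifts, so each identity for the quotient can be checked after multiplying
  back.\<close>

lemma arrow_space_divide:
  assumes g: "g \<in> arrow_space r r' i j f' f" and dvd: "\<And>v. vdvd d (g v)"
  obtains g' where "g' \<in> arrow_space r r' i j f' f" "\<And>v. g v = shift d (g' v)"
proof -
  define g' where "g' v = (\<lambda>i l. g v i l div monom 1 (d i))" for v
  have *: "shift d (g' v) = g v" for v
    using dvd[of v] by (simp add: g'_def vdvd_def dmul_def)
  have eqI: "u = u'" if "shift d u = shift d u'" for u u' :: "('a, 'b) pvec"
    using that by (simp add: shift_inj)
  have "g' \<in> arrow_space r r' i j f' f"
    unfolding arrow_space_def klinear_def mem_Collect_eq
  proof (intro conjI allI; rule eqI)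
    show "shift d (g' (v + w)) = shift d (g' v + g' w)" for v w
      by (simp add: dmul_add * klinearD[OF arrow_spaceD(1)[OF g]])
    show "shift d (g' (vsc a v)) = shift d (vsc a (g' v))" for a v
      by (simp add: dmul_commute[of _ "\<lambda>_. [:a:]"] * klinearD[OF arrow_spaceD(1)[OF g]])
    show "shift d (g' (vproj r j v)) = shift d (g' v)" for v
      by (simp add: * arrow_spaceD[OF g])
    show "shift d (vproj r' i (g' v)) = shift d (g' v)" for v
      by (simp add: dmul_vproj * arrow_spaceD[OF g])
    show "shift d (g' (shift (\<lambda>_. f) v)) = shift d (shift (\<lambda>_. f') (g' v))" for v
      by (simp add: dmul_commute[of "\<lambda>i. monom 1 (d i)" "\<lambda>_. monom 1 f'"] * arrow_spaceD[OF g])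
  qed
  then show thesis using that * by metis
qed

text \<open>For equal vertices and both exponents 1 an arrow map is linear over \<open>K[x]\<close>.
  Gluing one per vertex gives a homomorphism over the loops, so the lifting lemma for arrow maps
  will also lift homomorphisms.\<close>

lemma sum_arrow_space_in_hom_space:
  fixes g :: "'n::finite \<Rightarrow> ('n, 'k::field) pvec \<Rightarrow> ('n, 'k) pvec"
  assumes g: "\<And>i. g i \<in> arrow_space r r' i i 1 1"
  shows "(\<lambda>v. \<Sum>i\<in>UNIV. g i v) \<in> hom_space r r'"
proof -
  have const: "g i (dmul (\<lambda>_. p) v) = dmul (\<lambda>_. p) (g i v)" for i p v
  proof (induction p)
    case (pCons a p)
    have split: "dmul (\<lambda>_. pCons a p) w = vsc a w + shift (\<lambda>_. 1) (dmul (\<lambda>_. p) w)" for w :: "('n, 'k) pvec"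
      by (simp add: fun_eq_iff dmul_def algebra_simps monom_altdef)
    show ?case unfolding split
      by (simp add: klinearD[OF arrow_spaceD(1)[OF g]] arrow_spaceD(4)[OF g] pCons
          del: zero_fun_apply plus_fun_apply One_nat_def)
  next
    case 0
    have "dmul (\<lambda>_. 0) w = 0" for w :: "('n, 'k) pvec" by (simp add: dmul_def fun_eq_iff)
    then show ?case by (simp add: klinearD[OF arrow_spaceD(1)[OF g]] del: zero_fun_apply)
  qed
  have dm: "g i (dmul p v) = dmul p (g i v)" for i p v
  proof -
    have "g i (dmul p v) = g i (dmul (\<lambda>_. p i) (vproj r i v))"
      by (metis arrow_spaceD(2)[OF g] dmul_vproj dmul_vproj_const)
    also have "\<dots> = dmul (\<lambda>_. p i) (vproj r' i (g i v))"
      by (simp add: const arrow_spaceD[OF g])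
    also have "\<dots> = dmul p (vproj r' i (g i v))" by (rule dmul_vproj_const[symmetric])
    finally show ?thesis by (simp add: arrow_spaceD[OF g])
  qed
  have cut1: "g i (cut r v) = g i v" for i v by (metis arrow_spaceD(2)[OF g] vproj_cut)
  have cut2: "cut r' (g i v) = g i v" for i v by (metis arrow_spaceD(3)[OF g] cut_vproj)
  have cut_sum: "cut r' (\<Sum>i\<in>I. f i) = (\<Sum>i\<in>I. cut r' (f i))" for f :: "'n \<Rightarrow> ('n, 'k) pvec" and I
    by (simp add: fun_eq_iff sum_fun_apply cut_def)
  show ?thesis
    unfolding hom_space_def
    by (auto simp: klinearD[OF arrow_spaceD(1)[OF g]] sum.distrib dm dmul_sum cut1 cut2 cut_sum)
qed


subsection \<open>Lifting\<close>

text \<open>The linear extension of \<open>x^t \<mapsto> G t\<close>.\<close>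

definition poly_lin :: "(nat \<Rightarrow> ('n, 'k::field) pvec) \<Rightarrow> 'k poly \<Rightarrow> ('n, 'k) pvec" where
  "poly_lin G p = (\<Sum>t\<le>degree p. vsc (coeff p t) (G t))"

lemma dmul_zero: "dmul (\<lambda>_. 0) v = 0"
  by (simp add: dmul_def fun_eq_iff)

lemma poly_lin_conv: "degree p \<le> N \<Longrightarrow> poly_lin G p = (\<Sum>t\<le>N. vsc (coeff p t) (G t))"
  unfolding poly_lin_def by (rule sum.mono_neutral_left) (auto simp: coeff_eq_0 dmul_zero)

lemma poly_lin_0: "poly_lin G 0 = 0"
  by (simp add: poly_lin_def dmul_zero)

lemma poly_lin_pCons: "poly_lin G (pCons a p) = vsc a (G 0) + poly_lin (\<lambda>t. G (Suc t)) p"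
proof -
  have "poly_lin G (pCons a p) = (\<Sum>t\<le>Suc (degree p). vsc (coeff (pCons a p) t) (G t))"
    by (rule poly_lin_conv) (rule degree_pCons_le)
  then show ?thesis by (simp add: sum.atMost_Suc_shift poly_lin_def del: sum.atMost_Suc)
qed

lemma poly_lin_add: "poly_lin G (p + p') = poly_lin G p + poly_lin G p'"
proof (induction p p' arbitrary: G rule: poly_induct2)
  case (pCons a p b q)
  have "vsc (a + b) (G 0) = vsc a (G 0) + vsc b (G 0)"
    by (simp add: dmul_plus[symmetric])
  then show ?case by (simp add: poly_lin_pCons pCons add_ac del: zero_fun_apply plus_fun_apply)
qed (simp add: poly_lin_0 del: zero_fun_apply)

lemma poly_lin_smult: "poly_lin G ([:a:] * p) = vsc a (poly_lin G p)"
proof (induction p arbitrary: G)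
  case (pCons b p)
  have "vsc (b * a) (G 0) = vsc a (vsc b (G 0))" by (simp add: dmul_dmul mult.commute)
  then show ?case using pCons by (simp add: poly_lin_pCons dmul_add del: zero_fun_apply plus_fun_apply)
qed (simp add: poly_lin_0 dmul_0 del: zero_fun_apply)

lemma poly_lin_monom_mult: "poly_lin G (monom 1 n * p) = poly_lin (\<lambda>t. G (t + n)) p"
proof (induction n arbitrary: G)
  case (Suc n)
  have "poly_lin G (monom 1 (Suc n) * p) = poly_lin G (pCons 0 (monom 1 n * p))"
    by (simp add: monom_Suc)
  then show ?case by (simp add: poly_lin_pCons dmul_zero Suc del: zero_fun_apply plus_fun_apply)
qed simp

lemma poly_lin_dmul: "poly_lin (\<lambda>t. dmul q (G t)) p = dmul q (poly_lin G p)"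
  by (simp add: poly_lin_def dmul_sum dmul_commute[of q])

lemma poly_lin_vproj: "poly_lin (\<lambda>t. vproj r i (G t)) p = vproj r i (poly_lin G p)"
  by (simp add: poly_lin_def vproj_sum dmul_vproj)

lemma poly_lin_vunit: "poly_lin (\<lambda>t. vunit i l (monom 1 t)) p = vunit i l p"
proof -
  have "poly_lin (\<lambda>t. vunit i l (monom 1 t)) p = vunit i l (\<Sum>t\<le>degree p. monom (coeff p t) t)"
    by (auto simp: poly_lin_def fun_eq_iff sum_fun_apply dmul_def vunit_def smult_monom)
  then show ?thesis by (simp add: poly_as_sum_of_monoms)
qed

text \<open>\<open>K[x]\<^sup>r\<close> is free over \<open>K[x\<^sup>f]\<close>, so a map that turns the action of \<open>x\<^sup>f\<close> into \<open>\<xi>\<close> lifts along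
  a map that turns the action of \<open>x\<^sup>f'\<close> into \<open>\<xi>\<close>.\<close>

lemma arrow_space_lift:
  fixes pl :: "'m \<Rightarrow> 'm \<Rightarrow> 'm" and \<xi> :: "'m \<Rightarrow> 'm" and \<sigma> :: "'k::field \<Rightarrow> 'm \<Rightarrow> 'm"
    and H P :: "('n, 'k) pvec \<Rightarrow> 'm"
  assumes H: "\<And>v w. H (v + w) = pl (H v) (H w)" "\<And>a v. H (vsc a v) = \<sigma> a (H v)"
    and P: "\<And>v w. P (v + w) = pl (P v) (P w)" "\<And>a v. P (vsc a v) = \<sigma> a (P v)"
    and zero: "P 0 = H 0"
    and xH: "\<And>v. H (shift (\<lambda>_. f) (vproj r j v)) = \<xi> (H (vproj r j v))"
    and xP: "\<And>w. P (shift (\<lambda>_. f') (vproj r' i w)) = \<xi> (P (vproj r' i w))"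
    and ran: "\<And>v. \<exists>w. P (vproj r' i w) = H (vproj r j v)"
    and "0 < f"
  obtains g where "g \<in> arrow_space r r' i j f' f" "\<And>v. P (g v) = H (vproj r j v)"
proof -
  define w where "w l s = (SOME w. P (vproj r' i w) = H (vproj r j (vunit j l (monom 1 s))))" for l s
  have w: "P (vproj r' i (w l s)) = H (vproj r j (vunit j l (monom 1 s)))" for l s
    unfolding w_def by (rule someI_ex[OF ran])
  \<comment> \<open>\<open>x^t\<close> is \<open>x^(t mod f)\<close> shifted by a multiple of
    \<open>f\<close>: only the exponents below \<open>f\<close> receive a chosen lift, and shifts by
    \<open>x^f\<close> become shifts by \<open>x^f'\<close>.\<close>
  define G where "G l t = shift (\<lambda>_. t div f * f') (vproj r' i (w l (t mod f)))" for l t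
  define g where "g v = (\<Sum>l<r j. poly_lin (G l) (v j l))" for v
  have G_shift: "G l (t + f) = shift (\<lambda>_. f') (G l t)" for l t
    using \<open>0 < f\<close> by (simp add: G_def shift_shift add.commute)
  have G_vproj: "vproj r' i (G l t) = G l t" for l t
    by (simp add: G_def dmul_vproj[symmetric] vproj_vproj)
  have "g \<in> arrow_space r r' i j f' f"
    unfolding arrow_space_def klinear_def mem_Collect_eq
  proof (intro conjI allI)
    show "g (v + v') = g v + g v'" for v v' by (simp add: g_def poly_lin_add sum.distrib)
    show "g (vsc a v) = vsc a (g v)" for a v
      unfolding g_def dmul_sum by (simp add: poly_lin_smult[symmetric] dmul_def[of _ v])
    show "g (vproj r j v) = g v" for v by (simp add: g_def vproj_def)
    show "vproj r' i (g v) = g v" for v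
      by (simp add: g_def vproj_sum poly_lin_vproj[symmetric] G_vproj)
    show "g (shift (\<lambda>_. f) v) = shift (\<lambda>_. f') (g v)" for v
      unfolding g_def dmul_sum
      by (simp add: dmul_def[of _ v] poly_lin_monom_mult G_shift poly_lin_dmul)
  qed
  moreover have "P (g v) = H (vproj r j v)" for v
  proof -
    \<comment> \<open>Under \<open>P\<close> and \<open>H\<close> the two shifts become the same
      iterate of \<open>\<xi>\<close>.\<close>
    have HG: "P (G l t) = H (vunit j l (monom 1 t))" if "l < r j" for l t
    proof -
      have P_n: "P (shift (\<lambda>_. n * f') (vproj r' i u)) = (\<xi> ^^ n) (P (vproj r' i u))" for n u
      proof (induction n)
        case (Suc n)
        have "shift (\<lambda>_. Suc n * f') (vproj r' i u) = shift (\<lambda>_. f') (vproj r' i (shift (\<lambda>_. n * f') u))"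
          by (simp add: dmul_vproj shift_shift)
        moreover have "vproj r' i (shift (\<lambda>_. n * f') u) = shift (\<lambda>_. n * f') (vproj r' i u)"
          by (simp add: dmul_vproj)
        ultimately show ?case using xP[of "shift (\<lambda>_. n * f') u"] Suc by simp
      qed (simp add: dmul_1)
      have H_n: "H (shift (\<lambda>_. n * f) (vproj r j u)) = (\<xi> ^^ n) (H (vproj r j u))" for n u
      proof (induction n)
        case (Suc n)
        have "shift (\<lambda>_. Suc n * f) (vproj r j u) = shift (\<lambda>_. f) (vproj r j (shift (\<lambda>_. n * f) u))"
          by (simp add: dmul_vproj shift_shift)
        moreover have "vproj r j (shift (\<lambda>_. n * f) u) = shift (\<lambda>_. n * f) (vproj r j u)"
          by (simp add: dmul_vproj)
        ultimately show ?case using xH[of "shift (\<lambda>_. n * f) u"] Suc by simp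
      qed (simp add: dmul_1)
      have eq: "vunit j l (monom 1 t) = shift (\<lambda>_. t div f * f) (vproj r j (vunit j l (monom 1 (t mod f))))"
        using that by (simp add: vproj_vunit dmul_vunit mult_monom)
      have "H (vunit j l (monom 1 t)) = (\<xi> ^^ (t div f)) (H (vproj r j (vunit j l (monom 1 (t mod f)))))"
        by (subst eq) (rule H_n)
      then show ?thesis by (simp add: G_def P_n w)
    qed
    have lin: "P (poly_lin A p) = H (poly_lin B p)" if "\<And>t. P (A t) = H (B t)" for A B p
      using that
    proof (induction p arbitrary: A B)
      case (pCons a p)
      then show ?case by (simp add: poly_lin_pCons H P del: zero_fun_apply plus_fun_apply)
    qed (simp add: poly_lin_0 zero del: zero_fun_apply)
    have summand: "P (poly_lin (G l) (v j l)) = H (vunit j l (v j l))" if "l < r j" for l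
      using lin[OF HG[OF that], where p = "v j l"] by (simp add: poly_lin_vunit)
    have "P (\<Sum>l<n. poly_lin (G l) (v j l)) = H (\<Sum>l<n. vunit j l (v j l))" if "n \<le> r j" for n
      using that by (induction n) (simp_all add: zero H P summand del: zero_fun_apply plus_fun_apply)
    then show ?thesis by (simp add: g_def vproj_eq_sum_vunit)
  qed
  ultimately show thesis by (rule that)
qed


subsection \<open>Rigidity modulo powers of \<open>\<epsilon>\<close>\<close>

text \<open>Iterating the arrow relation \<open>q a\<close> times produces exactly the exponents of
  \<epsilon> at both ends, so \<epsilon> passes through every arrow map; this is
  \<open>reps_emul\<close>.\<close>

locale species =
  fixes Ar :: "'a set" and hd tl :: "'a \<Rightarrow> 'n" and f f' q :: "'a \<Rightarrow> nat" and c :: "'n \<Rightarrow> nat"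
  assumes c_tl: "a \<in> Ar \<Longrightarrow> c (tl a) = q a * f a" and c_hd: "a \<in> Ar \<Longrightarrow> c (hd a) = q a * f' a"
begin

definition reps :: "('n \<Rightarrow> nat) \<Rightarrow> ('n \<Rightarrow> nat) \<Rightarrow> ('a \<Rightarrow> ('n, 'k::field) pvec \<Rightarrow> ('n, 'k) pvec) set" where
  "reps r r' = {g. \<forall>a\<in>Ar. g a \<in> arrow_space r r' (hd a) (tl a) (f' a) (f a)}"

abbreviation ediv :: "nat \<Rightarrow> ('n, 'k::field) pvec \<Rightarrow> bool" where
  "ediv k \<equiv> vdvd (\<lambda>i. k * c i)"

abbreviation emul :: "nat \<Rightarrow> ('n, 'k::field) pvec \<Rightarrow> ('n, 'k) pvec" where
  "emul k \<equiv> shift (\<lambda>i. k * c i)"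

text \<open>No cocycle condition is imposed on \<open>\<gamma>\<close>: each arrow relation involves
  one \<alpha>, linearly, so every family in \<open>reps\<close> is a consistent first-order
  deformation of the arrows.\<close>

definition rigid_mod :: "nat \<Rightarrow> ('n \<Rightarrow> nat) \<Rightarrow> ('a \<Rightarrow> ('n, 'k::field) pvec \<Rightarrow> ('n, 'k) pvec) \<Rightarrow> bool" where
  "rigid_mod k r \<alpha> \<longleftrightarrow> (\<forall>\<gamma>\<in>reps r r. \<exists>\<phi>\<in>hom_space r r.
     \<forall>a\<in>Ar. \<forall>v. ediv k (\<gamma> a v - (\<alpha> a (\<phi> v) - \<phi> (\<alpha> a v))))"

lemma repsD: "g \<in> reps r r' \<Longrightarrow> a \<in> Ar \<Longrightarrow> g a \<in> arrow_space r r' (hd a) (tl a) (f' a) (f a)"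
  by (simp add: reps_def)

lemma repsD_linear: "g \<in> reps r r' \<Longrightarrow> a \<in> Ar \<Longrightarrow> klinear (g a)"
  by (rule arrow_spaceD(1)[OF repsD])

lemma reps_emul:
  assumes "g \<in> reps r r'" "a \<in> Ar"
  shows "g a (emul k v) = emul k (g a v)"
  by (rule arrow_space_shift[OF repsD[OF assms], of _ "k * q a"]) (simp_all add: c_tl c_hd assms)

lemma reps_ediv: "g \<in> reps r r' \<Longrightarrow> a \<in> Ar \<Longrightarrow> ediv k v \<Longrightarrow> ediv k (g a v)"
  by (auto simp: vdvd_iff_shift reps_emul)

lemma hom_ediv: "h \<in> hom_space r r' \<Longrightarrow> ediv k v \<Longrightarrow> ediv k (h v)"
  by (auto simp: vdvd_iff_shift hom_spaceD)

lemma ediv_mono: "ediv k v \<Longrightarrow> m \<le> k \<Longrightarrow> ediv m v"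
  by (erule vdvd_mono) simp

lemma ediv_emul: "ediv m v \<Longrightarrow> k \<le> n + m \<Longrightarrow> ediv k (emul n v)"
  by (rule ediv_mono[of "n + m"]) (simp_all add: distrib_right vdvd_shift_iff)

lemma ediv_emul_cancel: "ediv (n + m) (emul n v) \<Longrightarrow> ediv m v"
  by (simp add: distrib_right vdvd_shift_iff)

text \<open>The defect of \<open>h\<close> from commuting with the arrows is itself a family of
  arrow maps. So it can be divided by powers of \<epsilon> and treated as a cocycle.\<close>

lemma reps_diff_comp:
  assumes "\<beta> \<in> reps r' r'" "\<alpha> \<in> reps r r" "h \<in> hom_space r r'"
  shows "(\<lambda>a v. \<beta> a (h v) - h (\<alpha> a v)) \<in> reps r r'"
  using assms unfolding reps_def
  by (simp add: arrow_space_diff arrow_space_hom_left[OF _ assms(3)] arrow_space_hom_right[OF _ assms(3)])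

lemma reps_divide:
  assumes g: "g \<in> reps r r'" and "\<And>a v. a \<in> Ar \<Longrightarrow> ediv k (g a v)"
  shows "\<exists>g'\<in>reps r r'. \<forall>a\<in>Ar. \<forall>v. g a v = emul k (g' a v)"
proof -
  have "\<forall>a\<in>Ar. \<exists>g'. g' \<in> arrow_space r r' (hd a) (tl a) (f' a) (f a) \<and> (\<forall>v. g a v = emul k (g' v))"
    using arrow_space_divide[OF repsD[OF g] assms(2)] by metis
  then obtain g' where "\<forall>a\<in>Ar. g' a \<in> arrow_space r r' (hd a) (tl a) (f' a) (f a) \<and>
      (\<forall>v. g a v = emul k (g' a v))"
    by metis
  then show ?thesis by (intro bexI[of _ g']) (simp_all add: reps_def)
qed

text \<open>The cocycles do not depend on the level, so a solution modulo \<epsilon>^k serves modulo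
  \<epsilon>^m.\<close>

lemma rigid_mod_down:
  fixes \<alpha> :: "'a \<Rightarrow> ('n, 'k::field) pvec \<Rightarrow> ('n, 'k) pvec"
  assumes "rigid_mod k r \<alpha>" "m \<le> k"
  shows "rigid_mod m r \<alpha>"
  unfolding rigid_mod_def
proof
  fix \<gamma> :: "'a \<Rightarrow> ('n, 'k) pvec \<Rightarrow> ('n, 'k) pvec" assume \<gamma>: "\<gamma> \<in> reps r r"
  obtain \<phi> where "\<phi> \<in> hom_space r r"
    and "\<forall>a\<in>Ar. \<forall>v. ediv k (\<gamma> a v - (\<alpha> a (\<phi> v) - \<phi> (\<alpha> a v)))"
    using bspec[OF assms(1)[unfolded rigid_mod_def] \<gamma>] by blast
  then show "\<exists>\<phi>\<in>hom_space r r. \<forall>a\<in>Ar. \<forall>v. ediv m (\<gamma> a v - (\<alpha> a (\<phi> v) - \<phi> (\<alpha> a v)))"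
    by (intro bexI[of _ \<phi>] ballI allI ediv_mono[OF _ assms(2)]) auto
qed

lemma rigid_mod_up:
  fixes \<alpha> :: "'a \<Rightarrow> ('n, 'k::field) pvec \<Rightarrow> ('n, 'k) pvec"
  assumes \<alpha>: "\<alpha> \<in> reps r r" and rig: "rigid_mod m r \<alpha>" and "k \<le> m + m"
  shows "rigid_mod k r \<alpha>"
  unfolding rigid_mod_def
proof
  fix \<gamma> :: "'a \<Rightarrow> ('n, 'k) pvec \<Rightarrow> ('n, 'k) pvec" assume \<gamma>: "\<gamma> \<in> reps r r"
  obtain \<phi> where \<phi>: "\<phi> \<in> hom_space r r"
    and d: "\<And>a v. a \<in> Ar \<Longrightarrow> ediv m (\<gamma> a v - (\<alpha> a (\<phi> v) - \<phi> (\<alpha> a v)))"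
    using bspec[OF rig[unfolded rigid_mod_def] \<gamma>] by blast
  have rep: "(\<lambda>a v. \<gamma> a v - (\<alpha> a (\<phi> v) - \<phi> (\<alpha> a v))) \<in> reps r r"
    using reps_diff_comp[OF \<alpha> \<alpha> \<phi>] \<gamma> by (auto simp: reps_def intro: arrow_space_diff)
  obtain \<gamma>' where \<gamma>': "\<gamma>' \<in> reps r r"
    and eq: "\<And>a v. a \<in> Ar \<Longrightarrow> \<gamma> a v - (\<alpha> a (\<phi> v) - \<phi> (\<alpha> a v)) = emul m (\<gamma>' a v)"
    using reps_divide[OF rep d] by blast
  obtain \<phi>' where \<phi>': "\<phi>' \<in> hom_space r r"
    and d': "\<And>a v. a \<in> Ar \<Longrightarrow> ediv m (\<gamma>' a v - (\<alpha> a (\<phi>' v) - \<phi>' (\<alpha> a v)))"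
    using bspec[OF rig[unfolded rigid_mod_def] \<gamma>'] by blast
  let ?\<phi> = "\<lambda>v. \<phi> v + emul m (\<phi>' v)"
  have "?\<phi> \<in> hom_space r r" by (intro hom_space_add hom_space_dmul \<phi> \<phi>')
  moreover have "ediv k (\<gamma> a v - (\<alpha> a (?\<phi> v) - ?\<phi> (\<alpha> a v)))" if a: "a \<in> Ar" for a v
  proof -
    \<comment> \<open>As \<open>\<alpha>\<close> commutes with \<epsilon>^m, the correction
      subtracts \<epsilon>^m times the coboundary of \<open>\<phi>'\<close>. What remains is
      \<epsilon>^m times a multiple of \<epsilon>^m.\<close>
    have "\<gamma> a v - (\<alpha> a (?\<phi> v) - ?\<phi> (\<alpha> a v)) = emul m (\<gamma>' a v - (\<alpha> a (\<phi>' v) - \<phi>' (\<alpha> a v)))"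
      using eq[OF a, of v]
      by (simp add: klinearD[OF repsD_linear[OF \<alpha> a]] reps_emul[OF \<alpha> a] dmul_diff dmul_add algebra_simps)
    then show ?thesis using ediv_emul[OF d'[OF a] \<open>k \<le> m + m\<close>] by simp
  qed
  ultimately show "\<exists>\<phi>\<in>hom_space r r. \<forall>a\<in>Ar. \<forall>v. ediv k (\<gamma> a v - (\<alpha> a (\<phi> v) - \<phi> (\<alpha> a v)))"
    by (intro bexI[of _ ?\<phi>] ballI allI)
qed

text \<open>The obstruction to lifting the isomorphism \<open>\<theta>\<close> is \<open>\<epsilon>\<^sup>m \<gamma>\<close> for a cocycle \<open>\<gamma>\<close>, and \<open>\<eta> \<gamma>\<close> is
  a coboundary modulo \<open>\<epsilon>\<^sup>m\<close>.\<close>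

lemma iso_lift:
  fixes \<alpha> \<beta> :: "'a \<Rightarrow> ('n, 'k::field) pvec \<Rightarrow> ('n, 'k) pvec"
  assumes \<alpha>: "\<alpha> \<in> reps r r" and \<beta>: "\<beta> \<in> reps r' r'" and rig: "rigid_mod m r \<alpha>"
    and m: "0 < m" "k \<le> m + m"
    and \<theta>: "\<theta> \<in> hom_space r r'" and \<eta>: "\<eta> \<in> hom_space r' r"
    and \<eta>\<theta>: "\<And>v. ediv m (\<eta> (\<theta> v) - cut r v)" and \<theta>\<eta>: "\<And>v. ediv m (\<theta> (\<eta> v) - cut r' v)"
    and hom: "\<And>a v. a \<in> Ar \<Longrightarrow> ediv m (\<beta> a (\<theta> v) - \<theta> (\<alpha> a v))"
  obtains \<theta>' where "\<theta>' \<in> hom_space r r'" "\<And>a v. a \<in> Ar \<Longrightarrow> ediv k (\<beta> a (\<theta>' v) - \<theta>' (\<alpha> a v))"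
    "\<And>v. m \<le> k \<Longrightarrow> ediv k (\<theta>' v) \<Longrightarrow> ediv k (cut r v)" "\<And>w. \<exists>v. ediv k (cut r' w - \<theta>' v)"
proof -
  obtain \<gamma> where \<gamma>: "\<gamma> \<in> reps r r'" and eq: "\<And>a v. a \<in> Ar \<Longrightarrow> \<beta> a (\<theta> v) - \<theta> (\<alpha> a v) = emul m (\<gamma> a v)"
    using reps_divide[OF reps_diff_comp[OF \<beta> \<alpha> \<theta>] hom] by blast
  \<comment> \<open>\<open>\<gamma>\<close> goes between two different models; composition with
    \<open>\<eta>\<close> makes it a self-cocycle of the rigid one.\<close>
  have rep: "(\<lambda>a v. \<eta> (\<gamma> a v)) \<in> reps r r"
    using \<gamma> by (auto simp: reps_def intro: arrow_space_hom_left[OF _ \<eta>])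
  obtain \<phi> where \<phi>: "\<phi> \<in> hom_space r r"
    and d: "\<And>a v. a \<in> Ar \<Longrightarrow> ediv m (\<eta> (\<gamma> a v) - (\<alpha> a (\<phi> v) - \<phi> (\<alpha> a v)))"
    using bspec[OF rig[unfolded rigid_mod_def] rep] by blast
  have \<gamma>_cob: "ediv m (\<gamma> a v - (\<beta> a (\<theta> (\<phi> v)) - \<theta> (\<phi> (\<alpha> a v))))" if a: "a \<in> Ar" for a v
  proof -
    have cut\<gamma>: "cut r' (\<gamma> a v) = \<gamma> a v"
      by (metis arrow_spaceD(3)[OF repsD[OF \<gamma> a]] cut_vproj)
    have 1: "ediv m (\<theta> (\<eta> (\<gamma> a v) - (\<alpha> a (\<phi> v) - \<phi> (\<alpha> a v))))"
      by (rule hom_ediv[OF \<theta> d[OF a]])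
    \<comment> \<open>Apply \<open>\<theta>\<close> to the previous congruence. Replacing
      \<open>\<theta> \<eta>\<close> by the identity and moving \<open>\<theta>\<close> past the
      arrow cost two more multiples of \<epsilon>^m.\<close>
    have "\<gamma> a v - (\<beta> a (\<theta> (\<phi> v)) - \<theta> (\<phi> (\<alpha> a v))) = \<theta> (\<eta> (\<gamma> a v) - (\<alpha> a (\<phi> v) - \<phi> (\<alpha> a v)))
       - (\<theta> (\<eta> (\<gamma> a v)) - cut r' (\<gamma> a v)) - (\<beta> a (\<theta> (\<phi> v)) - \<theta> (\<alpha> a (\<phi> v)))"
      by (simp add: hom_spaceD[OF \<theta>] cut\<gamma> algebra_simps)
    then show ?thesis by (simp only: vdvd_diff 1 \<theta>\<eta> hom[OF a])
  qed
  \<comment> \<open>The defect of the correction term is \<epsilon>^m times a coboundary congruent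
    to \<open>\<gamma>\<close>, so subtracting it cancels the obstruction modulo
    \<epsilon>^(2m).\<close>
  define \<theta>' where "\<theta>' v = \<theta> v - emul m (\<theta> (\<phi> v))" for v
  have \<theta>': "\<theta>' \<in> hom_space r r'"
    unfolding \<theta>'_def by (rule hom_space_diff[OF \<theta> hom_space_dmul[OF hom_space_comp[OF \<phi> \<theta>]]])
  have hom': "ediv k (\<beta> a (\<theta>' v) - \<theta>' (\<alpha> a v))" if a: "a \<in> Ar" for a v
  proof -
    have "\<beta> a (\<theta>' v) - \<theta>' (\<alpha> a v) = emul m (\<gamma> a v - (\<beta> a (\<theta> (\<phi> v)) - \<theta> (\<phi> (\<alpha> a v))))"
      using eq[OF a, of v]
      by (simp add: \<theta>'_def klinearD[OF repsD_linear[OF \<beta> a]] reps_emul[OF \<beta> a] dmul_diff dmul_add algebra_simps)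
    then show ?thesis using ediv_emul[OF \<gamma>_cob[OF a] m(2)] by simp
  qed
  \<comment> \<open>The correction is a multiple of \<epsilon>^m, hence \<open>\<eta>\<close> stays
    an inverse of \<open>\<theta>'\<close> modulo \<epsilon>^m.\<close>
  have "ediv m (emul m u)" for u :: "('n, 'k) pvec" by (rule ediv_emul[of 0]) (auto simp: vdvd_def)
  then have close: "ediv m (\<theta>' v - \<theta> v)" for v
    by (simp add: \<theta>'_def vdvd_minus)
  have \<eta>\<theta>': "ediv m (\<eta> (\<theta>' v) - cut r v)" for v
  proof -
    have "\<eta> (\<theta>' v) - cut r v = \<eta> (\<theta>' v - \<theta> v) + (\<eta> (\<theta> v) - cut r v)" by (simp add: hom_spaceD[OF \<eta>])
    then show ?thesis by (simp only: vdvd_add hom_ediv[OF \<eta> close] \<eta>\<theta>)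
  qed
  have \<theta>'\<eta>: "ediv m (\<theta>' (\<eta> v) - cut r' v)" for v
  proof -
    have "\<theta>' (\<eta> v) - cut r' v = (\<theta>' (\<eta> v) - \<theta> (\<eta> v)) + (\<theta> (\<eta> v) - cut r' v)" by simp
    then show ?thesis by (simp only: vdvd_add close \<theta>\<eta>)
  qed
  \<comment> \<open>A left inverse modulo \<epsilon>^m reflects divisibility only up to
    \<epsilon>^m. To get from \<open>m\<close> to \<open>k\<close>, divide by \<epsilon>^m and use
    this once more for \<open>k - m \<le> m\<close>.\<close>
  have inj: "ediv j (cut r v)" if "j \<le> m" "ediv j (\<theta>' v)" for j v
    using vdvd_cong[OF ediv_mono[OF \<eta>\<theta>' that(1), of v]] hom_ediv[OF \<eta> that(2)] by simp
  have "ediv k (cut r v)" if "m \<le> k" "ediv k (\<theta>' v)" for v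
  proof -
    have "ediv m (cut r v)" using inj[of m v] ediv_mono[OF that(2,1)] by simp
    then obtain u where u: "cut r v = emul m u" by (auto simp: vdvd_iff_shift)
    have "emul m (\<theta>' u) = \<theta>' (cut r v)" unfolding u by (rule hom_spaceD(2)[OF \<theta>', symmetric])
    then have "emul m (\<theta>' u) = \<theta>' v" by (simp add: hom_spaceD(3)[OF \<theta>'])
    then have "ediv (m + (k - m)) (emul m (\<theta>' u))" using that by simp
    then have "ediv (k - m) (\<theta>' u)" by (rule ediv_emul_cancel)
    then have "ediv (k - m) (cut r u)" by (rule inj[rotated]) (use m in simp)
    then have "ediv k (emul m (cut r u))" using that by (intro ediv_emul) auto
    moreover have "emul m (cut r u) = cut r v" by (simp add: dmul_cut u[symmetric] cut_cut)
    ultimately show ?thesis by simp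
  qed
  moreover have "\<exists>v. ediv k (cut r' w - \<theta>' v)" for w
  proof -
    \<comment> \<open>Two rounds of approximation: the error of the first preimage is \<epsilon>^m
      times a vector, which is approximated in turn.\<close>
    have step: "\<exists>v u. cut r' w - \<theta>' v = emul m u" for w
      using vdvd_minus[THEN iffD2, OF \<theta>'\<eta>[of w]] by (auto simp: vdvd_iff_shift)
    obtain v u where 1: "cut r' w - \<theta>' v = emul m u" using step by blast
    obtain v' u' where 2: "cut r' u - \<theta>' v' = emul m u'" using step by blast
    have "cut r' w - \<theta>' v = emul m (cut r' u)"
      by (metis 1 cut_diff cut_cut hom_spaceD(4)[OF \<theta>'] dmul_cut)
    then have "cut r' w - \<theta>' (v + emul m v') = emul m (cut r' u - \<theta>' v')"
      by (simp add: hom_spaceD[OF \<theta>'] dmul_diff algebra_simps)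
    also have "\<dots> = emul m (emul m u')" by (simp add: 2)
    finally show ?thesis
      using ediv_emul[of m "emul m u'" k m] \<open>\<And>u. ediv m (emul m u)\<close> m(2) by metis
  qed
  ultimately show thesis using that \<theta>' hom' by blast
qed

end


section \<open>The algebra \<open>H(C,D,\<Omega>)\<close> as a quotient of the path algebra\<close>

context path_alg
begin

text \<open>The operations are parameters, so that the notion covers polynomial spaces with their
  type class operations as well as module records.\<close>

definition is_action ::
    "'x set \<Rightarrow> ('x \<Rightarrow> 'x \<Rightarrow> 'x) \<Rightarrow> 'x \<Rightarrow> ('k \<Rightarrow> 'x \<Rightarrow> 'x) \<Rightarrow> ((('v, 'e) path \<Rightarrow> 'k) \<Rightarrow> 'x \<Rightarrow> 'x) \<Rightarrow> bool" where
  "is_action X pl z \<sigma> ac \<longleftrightarrow> (\<forall>x\<in>X. ac \<zero> x = z \<and> (\<forall>a\<in>carrier PA. ac a x \<in> X \<and>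
     (\<forall>r. ac (\<lambda>y. r * a y) x = \<sigma> r (ac a x)) \<and>
     (\<forall>b\<in>carrier PA. ac (a \<otimes> b) x = ac a (ac b x) \<and> ac (a \<oplus> b) x = pl (ac a x) (ac b x))))"

lemma is_action_intertwine:
  assumes X: "is_action X pl z \<sigma> ac" and Y: "is_action Y pl' z' \<sigma>' ac'"
    and F: "\<And>x. x \<in> X \<Longrightarrow> F x \<in> Y" "\<And>x y. x \<in> X \<Longrightarrow> y \<in> X \<Longrightarrow> F (pl x y) = pl' (F x) (F y)"
      "F z = z'" "\<And>r x. x \<in> X \<Longrightarrow> F (\<sigma> r x) = \<sigma>' r (F x)"
    and idem: "\<And>u x. u \<in> verts G \<Longrightarrow> x \<in> X \<Longrightarrow>
        F (ac (path_elem (u, [], u)) x) = ac' (path_elem (u, [], u)) (F x)"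
    and arc: "\<And>e x. e \<in> arcs G \<Longrightarrow> x \<in> X \<Longrightarrow> F (ac (arc_elem G e) x) = ac' (arc_elem G e) (F x)"
    and "a \<in> carrier PA" "x \<in> X"
  shows "F (ac a x) = ac' a (F x)"
proof -
  have "\<forall>x\<in>X. F (ac a x) = ac' a (F x)"
    using \<open>a \<in> carrier PA\<close>
  proof (induction rule: PA_induct)
    case zero
    then show ?case using X Y F by (simp add: is_action_def)
  next
    case (mult a b)
    then show ?case using X Y F(1) by (simp add: is_action_def)
  next
    case (add a b)
    then show ?case using X Y F by (simp add: is_action_def)
  next
    case (scale r a)
    then show ?case using X Y F by (simp add: is_action_def)
  qed (use idem arc in auto)
  then show ?thesis using \<open>x \<in> X\<close> by blast
qed

end

lemma wf_quiver: "wf_digraph (quiver C \<Omega>)"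
  by unfold_locales (auto simp: quiver_def)

lemma verts_quiver [simp]: "verts (quiver C \<Omega>) = UNIV"
  and tail_quiver [simp]: "tail (quiver C \<Omega>) = arrow_tail"
  and head_quiver [simp]: "head (quiver C \<Omega>) = arrow_head"
  by (simp_all add: quiver_def)

definition alphas :: "int^'n^'n \<Rightarrow> ('n \<times> 'n) set \<Rightarrow> 'n arrow set" where
  "alphas C \<Omega> = {Alpha i j g | i j g. (i, j) \<in> \<Omega> \<and> 1 \<le> g \<and> g \<le> g_num C i j}"

lemma arcs_quiver: "arcs (quiver C \<Omega>) = alphas C \<Omega> \<union> range Eps"
  by (simp add: quiver_def alphas_def)

text \<open>The relation of \<open>\<alpha>\<close> is \<open>\<epsilon>\<^bsup>head_exp\<^esup> \<alpha> = \<alpha> \<epsilon>\<^bsup>tail_exp\<^esup>\<close>.\<close>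

fun tail_exp :: "int^'n^'n \<Rightarrow> 'n arrow \<Rightarrow> nat" where
  "tail_exp C (Alpha i j g) = f_num C i j"
| "tail_exp C (Eps i) = 1"

fun head_exp :: "int^'n^'n \<Rightarrow> 'n arrow \<Rightarrow> nat" where
  "head_exp C (Alpha i j g) = f_num C j i"
| "head_exp C (Eps i) = 1"

locale cartan =
  fixes C :: "int^'n::finite^'n" and c :: "'n \<Rightarrow> nat" and \<Omega> :: "('n \<times> 'n) set"
    and A :: "(('n, 'n arrow) path \<Rightarrow> 'k::field) ring" (structure)
  assumes gcm: "generalized_cartan_matrix C" and symm: "symmetrizer C c" and orient: "orientation C \<Omega>"
    and A_def: "A = KQ C \<Omega>"
begin

lemma c_pos: "0 < c i"
  using symm by (simp add: symmetrizer_def)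

text \<open>Up to sign, dividing \<open>c_i c_ij = c_j c_ji\<close> by the gcd gives
  \<open>c_i f_ij = c_j f_ji\<close>. As \<open>f_ij\<close> and \<open>f_ji\<close> are coprime,
  \<open>f_ij\<close> divides \<open>c_j\<close>, and the quotient is the common factor.\<close>

lemma f_num_facts:
  assumes "(i, j) \<in> \<Omega>"
  shows "0 < f_num C i j" "0 < f_num C j i" "\<exists>q. c j = q * f_num C i j \<and> c i = q * f_num C j i"
proof -
  have "{(i, j), (j, i)} \<inter> \<Omega> \<noteq> {}" "{(j, i), (i, j)} \<inter> \<Omega> \<noteq> {}" using assms by auto
  then have neg: "C $ i $ j < 0" "C $ j $ i < 0"
    using orient unfolding orientation_def by blast+
  define a b g where "a = nat \<bar>C $ i $ j\<bar>" and "b = nat \<bar>C $ j $ i\<bar>" and "g = gcd a b"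
  have pos: "0 < a" "0 < b" using neg by (auto simp: a_def b_def)
  then have g: "0 < g" by (simp add: g_def)
  have "int g = gcd (C $ i $ j) (C $ j $ i)"
    by (simp add: g_def a_def b_def gcd_int_int_eq[symmetric] del: gcd_int_int_eq)
  then have gn: "g_num C i j = g" "g_num C j i = g"
    by (simp_all add: g_num_def gcd.commute[of "C $ j $ i"])
  have f: "f_num C i j = a div g" "f_num C j i = b div g"
    by (simp_all add: f_num_def gn a_def b_def)
  have ab: "a = g * f_num C i j" "b = g * f_num C j i" by (simp_all add: f g_def)
  show fpos: "0 < f_num C i j" "0 < f_num C j i" using ab pos by (auto intro: Nat.gr0I)
  have cop: "coprime (f_num C i j) (f_num C j i)"
    unfolding f g_def using pos by (intro div_gcd_coprime) simp
  have "int (c i) * C $ i $ j = int (c j) * C $ j $ i" using symm by (simp add: symmetrizer_def)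
  then have "int (c i * a) = int (c j * b)" using neg by (simp add: a_def b_def)
  then have "c i * a = c j * b" by (simp only: of_nat_eq_iff)
  then have eq: "c i * f_num C i j = c j * f_num C j i" using g by (simp add: ab)
  have "f_num C i j dvd c j * f_num C j i" by (simp flip: eq)
  then have "f_num C i j dvd c j" using cop by (simp add: coprime_dvd_mult_left_iff)
  then obtain q where q: "c j = q * f_num C i j" by (metis dvd_def mult.commute)
  have "c i = q * f_num C j i" using eq fpos by (simp add: q mult_ac)
  then show "\<exists>q. c j = q * f_num C i j \<and> c i = q * f_num C j i" using q by blast
qed

lemma alphas_exp_pos: assumes "a \<in> alphas C \<Omega>" shows "0 < tail_exp C a" "0 < head_exp C a"
  using assms f_num_facts(1,2) by (auto simp: alphas_def)

lemma species_cartan: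
  "species (alphas C \<Omega>) arrow_head arrow_tail (tail_exp C) (head_exp C) (\<lambda>a. c (arrow_tail a) div tail_exp C a) c"
proof
  fix a assume a: "a \<in> alphas C \<Omega>"
  then obtain i j g where a': "a = Alpha i j g" "(i, j) \<in> \<Omega>" by (auto simp: alphas_def)
  obtain q where q: "c j = q * f_num C i j" "c i = q * f_num C j i" using f_num_facts(3)[OF a'(2)] by blast
  show "c (arrow_tail a) = c (arrow_tail a) div tail_exp C a * tail_exp C a" by (simp add: a' q)
  show "c (arrow_head a) = c (arrow_tail a) div tail_exp C a * head_exp C a"
    using f_num_facts(1)[OF a'(2)] by (simp add: a' q)
qed

end

sublocale cartan \<subseteq> path_alg "quiver C \<Omega>" A
  by (intro path_alg.intro wf_quiver path_alg_axioms.intro) (rule A_def)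

sublocale cartan \<subseteq> species "alphas C \<Omega>" arrow_head arrow_tail "tail_exp C" "head_exp C"
    "\<lambda>a. c (arrow_tail a) div tail_exp C a" c
  by (rule species_cartan)

context cartan
begin

abbreviation idm :: "'n \<Rightarrow> ('n, 'n arrow) path \<Rightarrow> 'k" where "idm i \<equiv> path_elem (i, [], i)"
abbreviation arrow :: "'n arrow \<Rightarrow> ('n, 'n arrow) path \<Rightarrow> 'k" where "arrow \<equiv> arc_elem (quiver C \<Omega>)"

lemma idm_closed [simp]: "idm i \<in> carrier A"
  by (rule path_elem_closed) (simp add: awalk_def)

lemma arrow_closed [simp]: "a \<in> alphas C \<Omega> \<Longrightarrow> arrow a \<in> carrier A" "arrow (Eps i) \<in> carrier A"
  by (simp_all add: arc_elem_closed arcs_quiver)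

lemma idm_mult: "idm i \<otimes> idm j = (if i = j then idm i else \<zero>)"
  by (simp add: path_elem_mult joinable_def)

lemma idm_arrow: "idm (arrow_head a) \<otimes> arrow a = arrow a" "arrow a \<otimes> idm (arrow_tail a) = arrow a"
  by (simp_all add: arc_elem_def path_elem_mult joinable_def)

lemma idm_eps: "idm i \<otimes> arrow (Eps i) = arrow (Eps i)" "arrow (Eps i) \<otimes> idm i = arrow (Eps i)"
  using idm_arrow[of "Eps i"] by simp_all

definition ascale :: "'k \<Rightarrow> (('n, 'n arrow) path \<Rightarrow> 'k) \<Rightarrow> ('n, 'n arrow) path \<Rightarrow> 'k" where
  "ascale r a = (\<lambda>x. r * a x)"

lemma ascale_eq_mult: "a \<in> carrier A \<Longrightarrow> ascale r a = ascale r \<one> \<otimes> a"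
  by (simp add: ascale_def PA_scale_mult)

lemma ascale_closed [simp]: "a \<in> carrier A \<Longrightarrow> ascale r a \<in> carrier A"
  by (simp add: ascale_def PA_scale_closed)

lemma ascale_simps:
  "ascale 0 a = \<zero>" "ascale r \<zero> = \<zero>" "ascale (r + s) a = ascale r a \<oplus> ascale s a" "ascale 1 a = a"
  "ascale r (a \<oplus> b) = ascale r a \<oplus> ascale r b" "ascale r (ascale s a) = ascale (r * s) a"
  "ascale r (a \<otimes> b) = ascale r a \<otimes> b" "ascale r (a \<otimes> b) = a \<otimes> ascale r b"
proof -
  show "ascale r (a \<otimes> b) = ascale r a \<otimes> b" "ascale r (a \<otimes> b) = a \<otimes> ascale r b"
    by (rule ext, clarify, simp add: PA_mult ascale_def sum_distrib_left mult_ac)+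
qed (auto simp: ascale_def PA_zero PA_add algebra_simps)

text \<open>The value of a polynomial at the loop, by Horner's scheme, with its constant term times
  the idempotent of the vertex. Thus \<open>x^0\<close> gives the idempotent and not the unit, and
  \<open>kpol_monom\<close> holds for positive exponents.\<close>

definition kpol :: "'n \<Rightarrow> 'k poly \<Rightarrow> ('n, 'n arrow) path \<Rightarrow> 'k" where
  "kpol i p = fold_coeffs (\<lambda>a b. ascale a (idm i) \<oplus> (arrow (Eps i) \<otimes> b)) p \<zero>"

lemma kpol_0 [simp]: "kpol i 0 = \<zero>"
  by (simp add: kpol_def)

lemma kpol_pCons: "kpol i (pCons a p) = ascale a (idm i) \<oplus> (arrow (Eps i) \<otimes> kpol i p)"
proof (cases "p = 0 \<and> a = 0")
  case True
  then show ?thesis by (simp add: ascale_simps)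
next
  case False
  then show ?thesis by (cases "a = 0") (auto simp: kpol_def)
qed

lemma kpol_closed [simp]: "kpol i p \<in> carrier A"
  by (induction p) (simp_all add: kpol_pCons)

lemma kpol_add: "kpol i (p + q) = kpol i p \<oplus> kpol i q"
  by (induction p q rule: poly_induct2)
    (simp_all add: kpol_pCons ascale_simps PA.r_distr PA.add.m_ac)

lemma kpol_smult: "kpol i (Polynomial.smult r p) = ascale r (kpol i p)"
  by (induction p) (simp_all add: kpol_pCons ascale_simps(1-6) ascale_simps(8))

lemma idm_kpol: "idm i \<otimes> kpol i p = kpol i p"
  by (induction p)
    (simp_all add: kpol_pCons PA.r_distr ascale_simps(8)[symmetric] idm_mult PA.m_assoc[symmetric] idm_eps)

lemma kpol_mult: "kpol i (p * q) = kpol i p \<otimes> kpol i q"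
proof (induction p)
  case (pCons a p)
  then show ?case
    by (simp add: kpol_add kpol_smult kpol_pCons PA.l_distr ascale_simps(1) ascale_simps(7)[symmetric]
        idm_kpol PA.m_assoc)
qed simp

lemma kpol_1: "kpol i 1 = idm i"
  by (simp add: one_pCons kpol_pCons ascale_simps)

lemma kpol_X: "kpol i (monom 1 1) = arrow (Eps i)"
  by (simp add: monom_altdef kpol_pCons ascale_simps idm_eps)

lemma kpol_monom: "0 < n \<Longrightarrow> kpol i (monom 1 n) = arrow (Eps i) [^] n"
proof (induction n)
  case (Suc n)
  show ?case
  proof (cases "n = 0")
    case True
    then show ?thesis using kpol_X by simp
  next
    case False
    have "kpol i (monom 1 (Suc n)) = kpol i (monom 1 n) \<otimes> kpol i (monom 1 1)"
      by (simp add: kpol_mult[symmetric] mult_monom)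
    then show ?thesis using Suc False by (simp only: kpol_X) simp
  qed
qed simp

lemma one_eq_finsum: "\<one> = (\<Oplus>i\<in>UNIV. idm i)"
proof -
  have "(\<Oplus>i\<in>I. idm i) = (\<lambda>x. \<Sum>i\<in>I. idm i x)" if "finite I" for I :: "'n set"
    using that by induction (simp_all add: PA_zero PA_add)
  then have "(\<Oplus>i\<in>UNIV. idm i) = (\<lambda>x. \<Sum>i\<in>UNIV. idm i x)" by simp
  also have "\<dots> = \<one>"
    by (rule ext, clarify) (auto simp: PA_one path_elem_def intro: sum.neutral)
  finally show ?thesis by simp
qed


abbreviation R :: "('n \<Rightarrow> nat) \<Rightarrow> ('n, 'k) KQ set ring" where "R d \<equiv> H_algebra C d \<Omega>"
abbreviation pr :: "('n \<Rightarrow> nat) \<Rightarrow> ('n, 'k) KQ \<Rightarrow> ('n, 'k) KQ set" where "pr d \<equiv> H_proj C d \<Omega>"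

text \<open>All exponents are positive, so the powers in the relations are values of
  \<open>kpol\<close>, which acts on the polynomial models by multiplication.\<close>

lemma relations_eq:
  assumes "\<And>i. 0 < d i"
  shows "relations C d \<Omega> = {kpol i (monom 1 (d i)) | i. True} \<union>
    {(kpol (arrow_head a) (monom 1 (head_exp C a)) \<otimes> arrow a) \<ominus>
     (arrow a \<otimes> kpol (arrow_tail a) (monom 1 (tail_exp C a))) | a. a \<in> alphas C \<Omega>}"
proof -
  have 1: "kpol i (monom 1 (d i)) = arrow (Eps i) [^] d i" for i
    by (rule kpol_monom[OF assms])
  have 2: "{(kpol (arrow_head a) (monom 1 (head_exp C a)) \<otimes> arrow a) \<ominus>
       (arrow a \<otimes> kpol (arrow_tail a) (monom 1 (tail_exp C a))) | a. a \<in> alphas C \<Omega>} =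
     {(arrow (Eps i) [^] f_num C j i \<otimes> arrow (Alpha i j g)) \<ominus> (arrow (Alpha i j g) \<otimes> arrow (Eps j) [^] f_num C i j)
        | i j g. (i, j) \<in> \<Omega> \<and> 1 \<le> g \<and> g \<le> g_num C i j}"
    (is "{?f a | a. _} = ?S")
  proof -
    have "?f (Alpha i j g) = (arrow (Eps i) [^] f_num C j i \<otimes> arrow (Alpha i j g)) \<ominus>
        (arrow (Alpha i j g) \<otimes> arrow (Eps j) [^] f_num C i j)" if "(i, j) \<in> \<Omega>" for i j g
      using f_num_facts(1,2)[OF that] by (simp add: kpol_monom)
    then have "?f ` {Alpha i j g | i j g. (i, j) \<in> \<Omega> \<and> 1 \<le> g \<and> g \<le> g_num C i j} = ?S" by (force simp: image_def)
    then show ?thesis unfolding alphas_def by (simp only: Setcompr_eq_image)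
  qed
  show ?thesis unfolding relations_def Let_def A_def[symmetric] 1 2 ..
qed

lemma relations_closed: assumes "\<And>i. 0 < d i" shows "relations C d \<Omega> \<subseteq> carrier A"
  unfolding relations_eq[OF assms] by auto

lemma ideal_relation: "(\<And>i. 0 < d i) \<Longrightarrow> ideal (relation_ideal C d \<Omega>) A"
  unfolding relation_ideal_def A_def[symmetric] by (rule PA.genideal_ideal[OF relations_closed])

lemma pr_ring_hom: "(\<And>i. 0 < d i) \<Longrightarrow> ring_hom_ring A (R d) (pr d)"
  unfolding H_algebra_def H_proj_def A_def[symmetric]
  by (rule ideal.rcos_ring_hom_ring[OF ideal_relation])

end

locale cartan_level = cartan C c \<Omega> A for C :: "int^'n::finite^'n" and c \<Omega> and
    A :: "(('n, 'n arrow) path \<Rightarrow> 'k::field) ring" (structure) +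
  fixes d :: "'n \<Rightarrow> nat"
  assumes d_pos: "0 < d i"
begin

sublocale pr: ring_hom_ring A "R d" "pr d"
  by (rule pr_ring_hom) (rule d_pos)

sublocale I: ideal "relation_ideal C d \<Omega>" A
  by (rule ideal_relation) (rule d_pos)

lemma pr_surj: "h \<in> carrier (R d) \<Longrightarrow> \<exists>a\<in>carrier A. h = pr d a"
  by (auto simp: H_algebra_def H_proj_def FactRing_def A_RCOSETS_def' A_def)

lemma subgroup_I: "abelian_subgroup (relation_ideal C d \<Omega>) A"
  by (rule abelian_subgroupI3[OF I.is_additive_subgroup PA.is_abelian_group])

lemma pr_self: "a \<in> carrier A \<Longrightarrow> a \<in> pr d a"
  unfolding H_proj_def A_def[symmetric] by (rule abelian_subgroup.a_rcos_self[OF subgroup_I])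

lemma pr_mem:
  assumes "a \<in> carrier A" "b \<in> pr d a"
  shows "b \<in> carrier A" "pr d b = pr d a"
  using abelian_subgroup.a_elemrcos_carrier[OF subgroup_I assms(1)]
    abelian_subgroup.a_repr_independence'[OF subgroup_I _ assms(1)] assms(2)
  unfolding H_proj_def A_def[symmetric] by auto

lemma pr_relation: assumes "\<rho> \<in> relations C d \<Omega>" shows "pr d \<rho> = \<zero>\<^bsub>R d\<^esub>"
proof -
  have "\<rho> \<in> relation_ideal C d \<Omega>"
    using PA.genideal_self[OF relations_closed[of d]] assms d_pos
    unfolding relation_ideal_def A_def by blast
  then show ?thesis
    using abelian_subgroup.a_rcos_const[OF subgroup_I]
    by (simp add: H_proj_def H_algebra_def FactRing_def A_def[symmetric])
qed

lemma pr_kpol_zero: "pr d (kpol i (monom 1 (d i))) = \<zero>\<^bsub>R d\<^esub>"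
  by (rule pr_relation) (auto simp: relations_eq d_pos)

lemma pr_arrow_relation:
  assumes "a \<in> alphas C \<Omega>"
  shows "pr d (kpol (arrow_head a) (monom 1 (head_exp C a))) \<otimes>\<^bsub>R d\<^esub> pr d (arrow a)
    = pr d (arrow a) \<otimes>\<^bsub>R d\<^esub> pr d (kpol (arrow_tail a) (monom 1 (tail_exp C a)))"
    (is "?x = ?y")
proof -
  have "pr d ((kpol (arrow_head a) (monom 1 (head_exp C a)) \<otimes> arrow a) \<ominus>
     (arrow a \<otimes> kpol (arrow_tail a) (monom 1 (tail_exp C a)))) = \<zero>\<^bsub>R d\<^esub>"
    using assms by (intro pr_relation) (auto simp: relations_eq d_pos)
  then have "?x \<ominus>\<^bsub>R d\<^esub> ?y = \<zero>\<^bsub>R d\<^esub>"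
    using assms by (simp add: a_minus_def)
  then show ?thesis using pr.S.minus_equality[of ?x "\<ominus>\<^bsub>R d\<^esub> ?y"] assms by (simp add: a_minus_def)
qed

lemma H_scalar_eq: "H_scalar C d \<Omega> r = pr d (ascale r \<one>)"
  by (simp add: H_scalar_def ascale_def A_def)

lemma H_scalar_closed: "H_scalar C d \<Omega> r \<in> carrier (R d)"
  by (simp add: H_scalar_eq)

lemma pr_ascale: "a \<in> carrier A \<Longrightarrow> pr d (ascale r a) = H_scalar C d \<Omega> r \<otimes>\<^bsub>R d\<^esub> pr d a"
  by (subst ascale_eq_mult) (simp_all add: H_scalar_eq)

lemma module_is_action:
  assumes "left_module (R d) M"
  shows "is_action (carrier M) (add M) \<zero>\<^bsub>M\<^esub> (\<lambda>r x. H_scalar C d \<Omega> r \<odot>\<^bsub>M\<^esub> x) (\<lambda>a x. pr d a \<odot>\<^bsub>M\<^esub> x)"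
proof -
  interpret M: left_module "R d" M by fact
  show ?thesis unfolding is_action_def ascale_def[symmetric]
    by (auto simp: M.smult_zero_left M.lsmult_closed M.lsmult_assoc M.lsmult_l_distr pr_ascale
        H_scalar_closed)
qed

end


subsection \<open>Modules from representations\<close>

text \<open>A representation on a vector space, read modulo the kernel of an idempotent \<open>\<pi>\<close> that contains
  the images of the relations; the module lives on the range of \<open>\<pi>\<close>.\<close>

locale rep_module = cartan_level C c \<Omega> A d + quiver_rep "quiver C \<Omega>" A sc e T
  for C :: "int^'n::finite^'n" and c \<Omega> and A :: "(('n, 'n arrow) path \<Rightarrow> 'k::field) ring" (structure)
    and d and sc :: "'k \<Rightarrow> 'w::ab_group_add \<Rightarrow> 'w" and e T +
  fixes \<pi> :: "'w \<Rightarrow> 'w"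
  assumes \<pi>_add: "\<pi> (x + y) = \<pi> x + \<pi> y" and \<pi>_sc: "\<pi> (sc r x) = sc r (\<pi> x)"
    and \<pi>_idem: "\<pi> (\<pi> x) = \<pi> x" and \<pi>_sum_e: "\<pi> (\<Sum>u\<in>UNIV. e u x) = \<pi> x"
    and ker_e: "\<pi> x = 0 \<Longrightarrow> \<pi> (e u x) = 0"
    and ker_T: "a \<in> arcs (quiver C \<Omega>) \<Longrightarrow> \<pi> x = 0 \<Longrightarrow> \<pi> (T a x) = 0"
    and ker_rel: "\<rho> \<in> relations C d \<Omega> \<Longrightarrow> \<pi> (act \<rho> x) = 0"
begin

lemma \<pi>_0: "\<pi> 0 = 0" and \<pi>_diff: "\<pi> (x - y) = \<pi> x - \<pi> y"
  using additive_simps[of \<pi>] \<pi>_add by auto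

lemma act_diff_right: "a \<in> carrier A \<Longrightarrow> act a (x - y) = act a x - act a y"
  using additive_simps[of "act a"] act_add_right by auto

lemma ker_act: assumes "a \<in> carrier A" shows "\<pi> x = 0 \<Longrightarrow> \<pi> (act a x) = 0"
  using assms
proof (induction arbitrary: x rule: PA_induct)
  case (idem u)
  then show ?case by (simp add: act_idem ker_e)
next
  case (arc b)
  then show ?case by (simp add: act_arc ker_T)
qed (simp_all add: act_zero \<pi>_0 act_mult act_add \<pi>_add act_scale \<pi>_sc scale_zero_right)

lemma \<pi>_act_\<pi>: assumes "a \<in> carrier A" shows "\<pi> (act a (\<pi> x)) = \<pi> (act a x)"
proof -
  have "\<pi> (act a (\<pi> x - x)) = 0" by (rule ker_act[OF assms]) (simp add: \<pi>_diff \<pi>_idem)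
  then show ?thesis by (simp add: act_diff_right[OF assms] \<pi>_diff)
qed

lemma \<pi>_act_act_\<pi>:
  "a \<in> carrier A \<Longrightarrow> b \<in> carrier A \<Longrightarrow> \<pi> (act a (act b (\<pi> x))) = \<pi> (act a (act b x))"
  using \<pi>_act_\<pi>[of "a \<otimes> b"] by (simp add: act_mult)

text \<open>The elements whose action vanishes under \<open>\<pi>\<close> form a two-sided ideal:
  factors on the right are absorbed since \<open>x\<close> is arbitrary, factors on the left since
  the kernel of \<open>\<pi>\<close> is invariant.\<close>

lemma \<pi>_relation_ideal: assumes "a \<in> relation_ideal C d \<Omega>" shows "\<pi> (act a x) = 0"
proof -
  let ?J = "{a \<in> carrier A. \<forall>x. \<pi> (act a x) = 0}"
  have "ideal ?J A"
  proof (rule idealI[OF PA.ring_axioms])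
    show "subgroup ?J (add_monoid A)"
    proof
      fix a assume a: "a \<in> ?J"
      have "\<pi> (act (\<ominus> a) x) = 0" for x
      proof -
        have "\<pi> (act (\<ominus> a \<oplus> a) x) = \<pi> (act (\<ominus> a) x)"
          using a by (subst act_add) (auto simp: \<pi>_add)
        then show ?thesis using a by (simp add: PA.l_neg act_zero \<pi>_0)
      qed
      then show "inv\<^bsub>add_monoid A\<^esub> a \<in> ?J" unfolding a_inv_def[symmetric] using a by simp
    qed (auto simp: act_zero \<pi>_0 act_add \<pi>_add)
  qed (auto simp: act_mult ker_act)
  then have "Idl (relations C d \<Omega>) \<subseteq> ?J"
    by (rule PA.genideal_minimal) (use relations_closed[of d] d_pos ker_rel in auto)
  then show ?thesis using assms unfolding relation_ideal_def A_def[symmetric] by blast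
qed

text \<open>A coset acts through an arbitrary representative; by \<open>\<pi>_relation_ideal\<close>
  the choice does not matter, which \<open>rep_mod_smult\<close> makes explicit.\<close>

definition rep_mod :: "(('n, 'k) KQ set, 'w) module" where
  "rep_mod = \<lparr> carrier = range \<pi>, mult = undefined, one = undefined, zero = 0, add = (+),
     smult = (\<lambda>h x. \<pi> (act (SOME a. a \<in> h) x)) \<rparr>"

lemma rep_mod_simps [simp]: "carrier rep_mod = range \<pi>" "\<zero>\<^bsub>rep_mod\<^esub> = 0" "x \<oplus>\<^bsub>rep_mod\<^esub> y = x + y"
  by (simp_all add: rep_mod_def)

lemma rep_mod_smult: assumes a: "a \<in> carrier A" shows "pr d a \<odot>\<^bsub>rep_mod\<^esub> x = \<pi> (act a x)"
proof -
  define b where "b = (SOME b. b \<in> pr d a)"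
  have "b \<in> pr d a" unfolding b_def using pr_self[OF a] by (rule someI[of "\<lambda>b. b \<in> pr d a"])
  note b = pr_mem[OF a this]
  have "b \<ominus> a \<in> relation_ideal C d \<Omega>"
    using PA.quotient_eq_iff_same_a_r_cos[OF I.is_ideal b(1) a] b(2)
    by (simp add: H_proj_def A_def)
  then have "\<pi> (act (b \<ominus> a) x) = 0" by (rule \<pi>_relation_ideal)
  moreover have "act b x = act (b \<ominus> a) x + act a x"
    using a b(1) by (simp add: act_add[symmetric] a_minus_def PA.add.m_assoc PA.l_neg)
  ultimately have "\<pi> (act b x) = \<pi> (act a x)" by (simp add: \<pi>_add)
  then show ?thesis by (simp add: rep_mod_def b_def)
qed

lemma left_module_rep_mod: "left_module (R d) rep_mod"
proof -
  have "abelian_group rep_mod"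
  proof (rule abelian_groupI)
    show "x \<oplus>\<^bsub>rep_mod\<^esub> y \<in> carrier rep_mod" if "x \<in> carrier rep_mod" "y \<in> carrier rep_mod" for x y
      using that by (auto simp: \<pi>_add[symmetric])
    show "\<zero>\<^bsub>rep_mod\<^esub> \<in> carrier rep_mod" using \<pi>_0 by (auto intro: range_eqI[symmetric])
    show "\<exists>y\<in>carrier rep_mod. y \<oplus>\<^bsub>rep_mod\<^esub> x = \<zero>\<^bsub>rep_mod\<^esub>" if x: "x \<in> carrier rep_mod" for x
    proof -
      obtain y where "x = \<pi> y" using x by auto
      then have "\<pi> (0 - y) + x = 0" by (simp only: \<pi>_diff \<pi>_0) simp
      then show ?thesis by auto
    qed
  qed (auto simp: add_ac)
  moreover have "left_module_axioms (R d) rep_mod"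
  proof
    show "\<one>\<^bsub>R d\<^esub> \<odot>\<^bsub>rep_mod\<^esub> x = x" if "x \<in> carrier rep_mod" for x
      using that rep_mod_smult[of \<one> x] by (auto simp: act_one \<pi>_sum_e \<pi>_idem)
  qed (auto dest!: pr_surj simp: rep_mod_smult \<pi>_idem \<pi>_add act_add_right \<pi>_act_\<pi> \<pi>_act_act_\<pi> act_mult act_add
        simp flip: pr.hom_mult pr.hom_add)
  ultimately show ?thesis by (simp add: left_module_def pr.S.ring_axioms)
qed

end


section \<open>Presentations of modules by polynomial models\<close>

lemma vector_space_pvec: "vector_space (vsc :: 'k::field \<Rightarrow> ('n, 'k) pvec \<Rightarrow> _)"
  by unfold_locales (auto simp: dmul_def fun_eq_iff algebra_simps smult_add_left)

fun rep_T :: "('n \<Rightarrow> nat) \<Rightarrow> ('n arrow \<Rightarrow> ('n, 'k::field) pvec \<Rightarrow> ('n, 'k) pvec) \<Rightarrow>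
    'n arrow \<Rightarrow> ('n, 'k) pvec \<Rightarrow> ('n, 'k) pvec" where
  "rep_T r \<alpha> (Eps i) = (\<lambda>v. shift (\<lambda>_. 1) (vproj r i v))"
| "rep_T r \<alpha> (Alpha i j g) = \<alpha> (Alpha i j g)"

text \<open>The action of the path algebra before truncation: the arrow relations hold exactly,
  whereas the nilpotency of the loops appears only modulo \<epsilon>^m.\<close>

definition vact where "vact r \<alpha> = quiver_rep.act vsc (vproj r) (rep_T r \<alpha>)"

locale cartan_mult = cartan C c \<Omega> A for C :: "int^'n::finite^'n" and c \<Omega> and
    A :: "(('n, 'n arrow) path \<Rightarrow> 'k::field) ring" (structure) +
  fixes m :: nat
  assumes m_pos: "0 < m"

sublocale cartan_mult \<subseteq> cartan_level C c \<Omega> A "\<lambda>i. m * c i"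
  by unfold_locales (simp add: m_pos c_pos)

section \<open>Polynomial models read modulo a power of \<epsilon>\<close>

context cartan
begin

abbreviation lev :: "nat \<Rightarrow> 'n \<Rightarrow> nat" where "lev m \<equiv> (\<lambda>i. m * c i)"

text \<open>Remainders are the canonical representatives modulo \<epsilon>^m. This gives an
  idempotent map, as \<open>rep_module\<close> demands.\<close>

definition trunc :: "nat \<Rightarrow> ('n \<Rightarrow> nat) \<Rightarrow> ('n, 'k) pvec \<Rightarrow> ('n, 'k) pvec" where
  "trunc m r v = (\<lambda>i l. if l < r i then v i l mod monom 1 (m * c i) else 0)"

lemma trunc_add: "trunc m r (v + w) = trunc m r v + trunc m r w"
  by (auto simp: trunc_def fun_eq_iff poly_mod_add_left)

lemma trunc_vsc: "trunc m r (vsc a v) = vsc a (trunc m r v)"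
  by (auto simp: trunc_def fun_eq_iff dmul_def mod_smult_left)

lemma trunc_0: "trunc m r 0 = 0" and trunc_diff: "trunc m r (v - w) = trunc m r v - trunc m r w"
  using additive_simps[of "trunc m r"] trunc_add by auto

lemma trunc_trunc: "trunc m r (trunc m r v) = trunc m r v"
  and trunc_cut: "trunc m r (cut r v) = trunc m r v"
  and cut_trunc: "cut r (trunc m r v) = trunc m r v"
  by (auto simp: trunc_def cut_def fun_eq_iff)

lemma trunc_eq_0_iff: "trunc m r v = 0 \<longleftrightarrow> ediv m (cut r v)"
  by (auto simp: trunc_def cut_def fun_eq_iff vdvd_def mod_eq_0_iff_dvd)

lemma quiver_rep_vec:
  assumes \<alpha>: "\<alpha> \<in> reps r r"
  shows "quiver_rep (quiver C \<Omega>) A vsc (vproj r) (rep_T r \<alpha>)"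
proof -
  interpret vector_space "vsc :: 'k \<Rightarrow> ('n, 'k) pvec \<Rightarrow> _" by (rule vector_space_pvec)
  have al: "rep_T r \<alpha> a = \<alpha> a" if "a \<in> alphas C \<Omega>" for a
    using that by (auto simp: alphas_def)
  note D = arrow_spaceD[OF repsD[OF \<alpha>]] klinearD[OF repsD_linear[OF \<alpha>]]
  show ?thesis
  proof unfold_locales
    fix a x y and s :: 'k assume "a \<in> arcs (quiver C \<Omega>)"
    then show "rep_T r \<alpha> a (x + y) = rep_T r \<alpha> a x + rep_T r \<alpha> a y"
      "rep_T r \<alpha> a (vsc s x) = vsc s (rep_T r \<alpha> a x)"
      "vproj r (head (quiver C \<Omega>) a) (rep_T r \<alpha> a x) = rep_T r \<alpha> a x"
      "rep_T r \<alpha> a (vproj r (tail (quiver C \<Omega>) a) x) = rep_T r \<alpha> a x"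
      by (auto simp: arcs_quiver al D vproj_add dmul_add dmul_vproj vproj_vproj dmul_commute[of _ "\<lambda>_. [:s:]"])
  qed (auto simp: vproj_add dmul_vproj vproj_vproj)
qed

lemma vact_simps:
  assumes \<alpha>: "\<alpha> \<in> reps r r"
  shows "vact r \<alpha> (idm i) v = vproj r i v" "vact r \<alpha> \<one> v = cut r v"
    "a \<in> alphas C \<Omega> \<Longrightarrow> vact r \<alpha> (arrow a) v = \<alpha> a v"
    "vact r \<alpha> (arrow (Eps i)) v = shift (\<lambda>_. 1) (vproj r i v)"
    "vact r \<alpha> (kpol i p) v = dmul (\<lambda>_. p) (vproj r i v)"
proof -
  interpret V: quiver_rep "quiver C \<Omega>" A vsc "vproj r" "rep_T r \<alpha>" by (rule quiver_rep_vec[OF \<alpha>])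
  show 1: "vact r \<alpha> (idm i) v = vproj r i v" for v by (simp add: vact_def V.act_idem)
  show 2: "vact r \<alpha> (arrow (Eps i)) v = shift (\<lambda>_. 1) (vproj r i v)" for v
    by (simp add: vact_def V.act_arc arcs_quiver)
  show "vact r \<alpha> \<one> v = cut r v" by (simp add: vact_def V.act_one sum_vproj)
  show "vact r \<alpha> (arrow a) v = \<alpha> a v" if "a \<in> alphas C \<Omega>"
    using that by (auto simp: vact_def V.act_arc arcs_quiver alphas_def)
  show "vact r \<alpha> (kpol i p) v = dmul (\<lambda>_. p) (vproj r i v)"
  proof (induction p)
    case 0
    then show ?case by (simp add: vact_def V.act_zero dmul_zero del: zero_fun_apply)
  next
    case (pCons a p)
    have "vact r \<alpha> (kpol i (pCons a p)) v
      = vsc a (vproj r i v) + shift (\<lambda>_. 1) (vproj r i (dmul (\<lambda>_. p) (vproj r i v)))"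
      using 1 2 pCons unfolding kpol_pCons ascale_def vact_def
      by (simp only: V.act_add V.act_scale V.act_mult PA_scale_closed idm_closed kpol_closed
          arrow_closed PA_mult_closed)
    also have "\<dots> = dmul (\<lambda>_. pCons a p) (vproj r i v)"
      by (auto simp: fun_eq_iff dmul_def vproj_def monom_altdef)
    finally show ?case .
  qed
qed

lemma vact_is_action:
  assumes \<alpha>: "\<alpha> \<in> reps r r"
  shows "is_action UNIV (+) 0 vsc (vact r \<alpha>)"
proof -
  interpret V: quiver_rep "quiver C \<Omega>" A vsc "vproj r" "rep_T r \<alpha>" by (rule quiver_rep_vec[OF \<alpha>])
  show ?thesis unfolding is_action_def vact_def
    by (auto simp: V.act_zero V.act_scale V.act_mult V.act_add)
qed

definition vmod :: "nat \<Rightarrow> ('n \<Rightarrow> nat) \<Rightarrow> ('n arrow \<Rightarrow> ('n, 'k) pvec \<Rightarrow> ('n, 'k) pvec) \<Rightarrow>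
    (('n, 'k) KQ set, ('n, 'k) pvec) module" where
  "vmod m r \<alpha> = rep_module.rep_mod vsc (vproj r) (rep_T r \<alpha>) (trunc m r)"

text \<open>\<open>frame m r M \<Psi>\<close>: the map \<open>\<Psi>\<close> induces an isomorphism from \<open>\<Oplus>\<^sub>i K[x]\<^bsup>r i\<^esup>\<close> modulo \<open>\<epsilon>\<^sup>m\<close>
  onto \<open>M\<close> that respects the loops.  In \<open>presents\<close>, it also respects the arrows.\<close>

definition frame :: "nat \<Rightarrow> ('n \<Rightarrow> nat) \<Rightarrow> (('n, 'k) KQ set, 'm) module \<Rightarrow> (('n, 'k) pvec \<Rightarrow> 'm) \<Rightarrow> bool" where
  "frame m r M \<Psi> \<longleftrightarrow> left_module (R (lev m)) M \<and> range \<Psi> = carrier M \<and>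
     (\<forall>v w. \<Psi> (v + w) = \<Psi> v \<oplus>\<^bsub>M\<^esub> \<Psi> w) \<and> (\<forall>v. \<Psi> v = \<zero>\<^bsub>M\<^esub> \<longleftrightarrow> ediv m (cut r v)) \<and>
     (\<forall>a v. \<Psi> (vsc a v) = H_scalar C (lev m) \<Omega> a \<odot>\<^bsub>M\<^esub> \<Psi> v) \<and>
     (\<forall>i p v. \<Psi> (dmul (\<lambda>_. p) (vproj r i v)) = pr (lev m) (kpol i p) \<odot>\<^bsub>M\<^esub> \<Psi> v)"

definition presents :: "nat \<Rightarrow> ('n \<Rightarrow> nat) \<Rightarrow> ('n arrow \<Rightarrow> ('n, 'k) pvec \<Rightarrow> ('n, 'k) pvec) \<Rightarrow>
    (('n, 'k) KQ set, 'm) module \<Rightarrow> (('n, 'k) pvec \<Rightarrow> 'm) \<Rightarrow> bool" where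
  "presents m r \<alpha> M \<Psi> \<longleftrightarrow> frame m r M \<Psi> \<and> \<alpha> \<in> reps r r \<and>
     (\<forall>a\<in>alphas C \<Omega>. \<forall>v. \<Psi> (\<alpha> a v) = pr (lev m) (arrow a) \<odot>\<^bsub>M\<^esub> \<Psi> v)"

end

context cartan_mult
begin

text \<open>The power of a loop in the relations acts as multiplication by \<epsilon>^m at its
  vertex and is killed by \<open>trunc\<close>; an arrow relation acts as zero already, by the
  definition of \<open>arrow_space\<close>.\<close>

lemma rep_module_vec:
  assumes \<alpha>: "\<alpha> \<in> reps r r"
  shows "rep_module C c \<Omega> A (lev m) vsc (vproj r) (rep_T r \<alpha>) (trunc m r)"
proof -
  interpret V: quiver_rep "quiver C \<Omega>" A vsc "vproj r" "rep_T r \<alpha>" by (rule quiver_rep_vec[OF \<alpha>])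
  show ?thesis
  proof unfold_locales
    show "trunc m r (rep_T r \<alpha> a v) = 0" if "a \<in> arcs (quiver C \<Omega>)" "trunc m r v = 0" for a v
    proof -
      have v: "ediv m (cut r v)" using that by (simp add: trunc_eq_0_iff)
      have "ediv m (rep_T r \<alpha> a v)"
        using that(1) unfolding arcs_quiver
      proof
        assume a: "a \<in> alphas C \<Omega>"
        then have "rep_T r \<alpha> a v = \<alpha> a (cut r v)"
          by (auto simp: alphas_def) (metis a arrow_spaceD(2)[OF repsD[OF \<alpha>]] vproj_cut)
        then show ?thesis by (simp add: reps_ediv[OF \<alpha> a v])
      next
        assume "a \<in> range Eps"
        then obtain i where "a = Eps i" by auto
        then have "rep_T r \<alpha> a v = shift (\<lambda>_. 1) (vproj r i (cut r v))" by (simp add: vproj_cut)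
        then show ?thesis using v by (simp only: vdvd_dmul vdvd_vproj)
      qed
      then show ?thesis by (simp add: trunc_eq_0_iff vdvd_cut)
    qed
    show "trunc m r (vproj r u v) = 0" if "trunc m r v = 0" for u v
      using that vdvd_vproj[of _ "cut r v" r u] by (simp add: trunc_eq_0_iff cut_vproj vproj_cut)
    show "trunc m r (V.act \<rho> v) = 0" if "\<rho> \<in> relations C (lev m) \<Omega>" for \<rho> v
      using that unfolding relations_eq[of "lev m", OF d_pos]
    proof
      assume "\<rho> \<in> {kpol i (monom 1 (m * c i)) | i. True}"
      then obtain i where "\<rho> = kpol i (monom 1 (m * c i))" by auto
      then have "V.act \<rho> v = dmul (\<lambda>_. monom 1 (m * c i)) (vproj r i v)"
        using vact_simps(5)[OF \<alpha>] by (simp add: vact_def)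
      also have "\<dots> = shift (lev m) (vproj r i v)" by (rule dmul_vproj_const[symmetric])
      finally have "ediv m (V.act \<rho> v)" unfolding vdvd_iff_shift by blast
      then show ?thesis by (simp add: trunc_eq_0_iff vdvd_cut)
    next
      assume "\<rho> \<in> {(kpol (arrow_head a) (monom 1 (head_exp C a)) \<otimes> arrow a) \<ominus>
         (arrow a \<otimes> kpol (arrow_tail a) (monom 1 (tail_exp C a))) | a. a \<in> alphas C \<Omega>}"
      then obtain a where a: "a \<in> alphas C \<Omega>" and \<rho>: "\<rho> = (kpol (arrow_head a) (monom 1 (head_exp C a)) \<otimes> arrow a) \<ominus>
         (arrow a \<otimes> kpol (arrow_tail a) (monom 1 (tail_exp C a)))" (is "_ = ?x \<ominus> ?y") by auto
      have xy: "?x \<in> carrier A" "?y \<in> carrier A" using a by simp_all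
      have "V.act ?x v = V.act ?y v"
        using a arrow_spaceD[OF repsD[OF \<alpha> a]] vact_simps[OF \<alpha>, unfolded vact_def]
        by (simp add: V.act_mult)
      moreover have "V.act (\<rho> \<oplus> ?y) v = V.act \<rho> v + V.act ?y v"
        using xy unfolding \<rho> by (intro V.act_add) auto
      moreover have "\<rho> \<oplus> ?y = ?x" using xy unfolding \<rho> by (simp add: a_minus_def PA.add.m_assoc PA.l_neg)
      ultimately show ?thesis by (simp add: trunc_0)
    qed
  qed (auto simp: trunc_add trunc_vsc trunc_trunc sum_vproj trunc_cut)
qed

lemma presents_vmod:
  assumes \<alpha>: "\<alpha> \<in> reps r r"
  shows "presents m r \<alpha> (vmod m r \<alpha>) (trunc m r)"
proof -
  interpret V: rep_module C c \<Omega> A "lev m" vsc "vproj r" "rep_T r \<alpha>" "trunc m r"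
    by (rule rep_module_vec[OF \<alpha>])
  note S = vact_simps[OF \<alpha>, unfolded vact_def]
  have M: "vmod m r \<alpha> = V.rep_mod" by (simp add: vmod_def)
  have act: "trunc m r (V.act a v) = pr (lev m) a \<odot>\<^bsub>V.rep_mod\<^esub> trunc m r v" if "a \<in> carrier A" for a v
    using that by (simp add: V.rep_mod_smult V.\<pi>_act_\<pi>)
  have "trunc m r (vsc a v) = H_scalar C (lev m) \<Omega> a \<odot>\<^bsub>V.rep_mod\<^esub> trunc m r v" for a v
  proof -
    have "V.act (ascale a \<one>) v = vsc a (cut r v)" by (simp add: ascale_def V.act_scale S)
    then show ?thesis using act[of "ascale a \<one>" v] by (simp add: H_scalar_eq trunc_vsc trunc_cut)
  qed
  moreover have "trunc m r (dmul (\<lambda>_. p) (vproj r i v)) = pr (lev m) (kpol i p) \<odot>\<^bsub>V.rep_mod\<^esub> trunc m r v" for i p v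
    using act[of "kpol i p" v] by (simp add: S)
  moreover have "trunc m r (\<alpha> a v) = pr (lev m) (arrow a) \<odot>\<^bsub>V.rep_mod\<^esub> trunc m r v"
    if "a \<in> alphas C \<Omega>" for a v
    using act[of "arrow a" v] that by (simp add: S)
  ultimately show ?thesis
    unfolding presents_def frame_def M using \<alpha> V.left_module_rep_mod
    by (simp add: trunc_add trunc_eq_0_iff)
qed

context
  fixes r :: "'n \<Rightarrow> nat" and M :: "(('n, 'k) KQ set, 'm) module" and \<Psi> :: "('n, 'k) pvec \<Rightarrow> 'm"
  assumes fr: "frame m r M \<Psi>"
begin

lemma frame_module: "left_module (R (lev m)) M"
  and frame_range: "range \<Psi> = carrier M"
  and frame_closed: "\<Psi> v \<in> carrier M"
  and frame_add: "\<Psi> (v + w) = \<Psi> v \<oplus>\<^bsub>M\<^esub> \<Psi> w"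
  and frame_zero_iff: "\<Psi> v = \<zero>\<^bsub>M\<^esub> \<longleftrightarrow> ediv m (cut r v)"
  and frame_vsc: "\<Psi> (vsc a v) = H_scalar C (lev m) \<Omega> a \<odot>\<^bsub>M\<^esub> \<Psi> v"
  and frame_kpol: "\<Psi> (dmul (\<lambda>_. p) (vproj r i v)) = pr (lev m) (kpol i p) \<odot>\<^bsub>M\<^esub> \<Psi> v"
  using fr by (auto simp: frame_def)

interpretation M: left_module "R (lev m)" M by (rule frame_module)

lemma frame_0: "\<Psi> 0 = \<zero>\<^bsub>M\<^esub>"
  by (simp add: frame_zero_iff cut_0 vdvd_0)

lemma frame_diff: "\<Psi> (v - w) = \<Psi> v \<ominus>\<^bsub>M\<^esub> \<Psi> w"
proof -
  have "\<Psi> v = \<Psi> (v - w) \<oplus>\<^bsub>M\<^esub> \<Psi> w" by (simp add: frame_add[symmetric])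
  then show ?thesis
    by (simp add: a_minus_def M.add.m_assoc frame_closed M.r_neg)
qed

lemma frame_eq_iff: "\<Psi> v = \<Psi> w \<longleftrightarrow> ediv m (cut r (v - w))"
proof -
  have "\<Psi> v = \<Psi> w \<longleftrightarrow> \<Psi> (v - w) = \<zero>\<^bsub>M\<^esub>"
    unfolding frame_diff by (auto simp: a_minus_def frame_closed M.r_neg)
      (metis M.add.inv_closed M.add.inv_inv M.minus_equality M.add.m_comm frame_closed)
  then show ?thesis by (simp add: frame_zero_iff)
qed

lemma frame_cut: "\<Psi> (cut r v) = \<Psi> v"
  by (simp add: frame_eq_iff cut_diff cut_cut vdvd_0)

lemma frame_idm: "\<Psi> (vproj r i v) = pr (lev m) (idm i) \<odot>\<^bsub>M\<^esub> \<Psi> v"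
  using frame_kpol[of 1 i v] by (simp add: kpol_1 dmul_1)

lemma frame_sum: "\<Psi> (\<Sum>i\<in>I. g i) = (\<Oplus>\<^bsub>M\<^esub>i\<in>I. \<Psi> (g i))"
  by (induction I rule: infinite_finite_induct) (simp_all add: frame_0 frame_add frame_closed del: zero_fun_apply plus_fun_apply)

text \<open>Turns a module-valued map that obeys the relation of an arrow into a polynomial one. It
  serves for the action of an arrow in \<open>frame_presents\<close> and for a cocycle in
  \<open>rigid_mod_imp_rigid\<close>.\<close>

lemma frame_lift_arrow:
  assumes F: "\<And>v. F v \<in> carrier M" "\<And>v w. F (v + w) = F v \<oplus>\<^bsub>M\<^esub> F w"
      "\<And>a v. F (vsc a v) = H_scalar C (lev m) \<Omega> a \<odot>\<^bsub>M\<^esub> F v"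
    and head: "\<And>v. pr (lev m) (idm i) \<odot>\<^bsub>M\<^esub> F (vproj r' j v) = F (vproj r' j v)"
    and shift: "\<And>v. F (shift (\<lambda>_. f) (vproj r' j v)) = pr (lev m) (kpol i (monom 1 f')) \<odot>\<^bsub>M\<^esub> F (vproj r' j v)"
    and "0 < f"
  obtains g where "g \<in> arrow_space r' r i j f' f" "\<And>v. \<Psi> (g v) = F (vproj r' j v)"
proof (rule arrow_space_lift[where H = F and P = \<Psi> and pl = "add M" and j = j and r = r' and r' = r and i = i
      and f = f and f' = f' and
      \<sigma> = "\<lambda>a x. H_scalar C (lev m) \<Omega> a \<odot>\<^bsub>M\<^esub> x" and \<xi> = "\<lambda>x. pr (lev m) (kpol i (monom 1 f')) \<odot>\<^bsub>M\<^esub> x"])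
  have "F 0 \<oplus>\<^bsub>M\<^esub> F 0 = F 0" using F(2)[of 0 0] by simp
  then show "\<Psi> 0 = F 0" using F(1)[of 0] by (simp add: frame_0 M.add.r_cancel_one)
  show "\<exists>w. \<Psi> (vproj r i w) = F (vproj r' j v)" for v
  proof -
    obtain w where "\<Psi> w = F (vproj r' j v)" using F(1) frame_range by (metis rangeE)
    then show ?thesis using head[of v] by (intro exI[of _ w]) (simp add: frame_idm)
  qed
  show "\<Psi> (shift (\<lambda>_. f') (vproj r i w)) = pr (lev m) (kpol i (monom 1 f')) \<odot>\<^bsub>M\<^esub> \<Psi> (vproj r i w)" for w
    using frame_kpol[of "monom 1 f'" i "vproj r i w"] by (simp add: vproj_vproj)
qed (use assms that in \<open>auto simp: frame_add frame_vsc\<close>)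

text \<open>Projectivity of free modules over the loops: one lift per vertex, with both exponents 1,
  glued by \<open>sum_arrow_space_in_hom_space\<close>.\<close>

lemma frame_lift_hom:
  assumes F: "\<And>v. F v \<in> carrier M" "\<And>v w. F (v + w) = F v \<oplus>\<^bsub>M\<^esub> F w"
      "\<And>a v. F (vsc a v) = H_scalar C (lev m) \<Omega> a \<odot>\<^bsub>M\<^esub> F v"
    and kpol: "\<And>i p v. F (dmul (\<lambda>_. p) (vproj r' i v)) = pr (lev m) (kpol i p) \<odot>\<^bsub>M\<^esub> F v"
    and F_cut: "\<And>v. F (cut r' v) = F v"
  obtains h where "h \<in> hom_space r' r" "\<And>v. \<Psi> (h v) = F v"
proof -
  have idm: "F (vproj r' i v) = pr (lev m) (idm i) \<odot>\<^bsub>M\<^esub> F v" for i v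
    using kpol[of 1 i v] by (simp add: kpol_1 dmul_1)
  have "\<exists>g. g \<in> arrow_space r' r i i 1 1 \<and> (\<forall>v. \<Psi> (g v) = F (vproj r' i v))" for i
  proof -
    have "pr (lev m) (idm i) \<odot>\<^bsub>M\<^esub> F (vproj r' i v) = F (vproj r' i v)" for v
      unfolding idm[symmetric] by (simp add: vproj_vproj)
    moreover have "F (shift (\<lambda>_. 1) (vproj r' i v)) = pr (lev m) (kpol i (monom 1 1)) \<odot>\<^bsub>M\<^esub> F (vproj r' i v)" for v
      using kpol[of "monom 1 1" i "vproj r' i v"] by (simp add: vproj_vproj)
    ultimately show ?thesis by (rule frame_lift_arrow[OF F]) auto
  qed
  then obtain g where g: "\<And>i. g i \<in> arrow_space r' r i i 1 1" "\<And>i v. \<Psi> (g i v) = F (vproj r' i v)" by metis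
  have "F 0 \<oplus>\<^bsub>M\<^esub> F 0 = F 0" using F(2)[of 0 0] by simp
  then have F0: "F 0 = \<zero>\<^bsub>M\<^esub>" using F(1)[of 0] by (simp add: M.add.r_cancel_one)
  have F_sum: "F (\<Sum>i\<in>I. u i) = (\<Oplus>\<^bsub>M\<^esub>i\<in>I. F (u i))" for u and I :: "'n set"
    by (induction I rule: infinite_finite_induct) (simp_all add: F0 F del: zero_fun_apply plus_fun_apply)
  have "\<Psi> (\<Sum>i\<in>UNIV. g i v) = F v" for v
    unfolding frame_sum g(2) F_sum[symmetric] by (simp add: sum_vproj F_cut)
  then show thesis using that[of "\<lambda>v. \<Sum>i\<in>UNIV. g i v"] sum_arrow_space_in_hom_space[OF g(1)] by simp
qed

lemma presents_act:
  assumes "presents m r \<alpha> M \<Psi>" "a \<in> carrier A"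
  shows "\<Psi> (vact r \<alpha> a v) = pr (lev m) a \<odot>\<^bsub>M\<^esub> \<Psi> v"
proof (rule is_action_intertwine[OF vact_is_action module_is_action[OF frame_module] _ _ _ _ _ _ assms(2)])
  show \<alpha>: "\<alpha> \<in> reps r r" using assms(1) by (simp add: presents_def)
  show "\<Psi> (vact r \<alpha> (arrow b) x) = pr (lev m) (arrow b) \<odot>\<^bsub>M\<^esub> \<Psi> x" if "b \<in> arcs (quiver C \<Omega>)" for b x
    using that assms(1) frame_kpol[of "monom 1 1" _ x] kpol_X
    by (auto simp: arcs_quiver presents_def vact_simps[OF \<alpha>])
qed (use assms(1) in \<open>auto simp: presents_def frame_closed frame_add frame_0 frame_vsc
    vact_simps frame_idm simp del: zero_fun_apply plus_fun_apply\<close>)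

end

text \<open>\<open>F\<close> vanishes on the kernel of \<open>\<Psi>\<close>, so its value does not
  depend on the chosen preimage; compatibility with the generators extends to the whole algebra by
  \<open>is_action_intertwine\<close>.\<close>

lemma presents_induced_hom:
  assumes M: "presents m r \<alpha> M \<Psi>" and N: "left_module (R (lev m)) N"
    and F: "\<And>v. F v \<in> carrier N" "\<And>v w. F (v + w) = F v \<oplus>\<^bsub>N\<^esub> F w"
      "\<And>a v. F (vsc a v) = H_scalar C (lev m) \<Omega> a \<odot>\<^bsub>N\<^esub> F v"
    and idm: "\<And>i v. F (vproj r i v) = pr (lev m) (idm i) \<odot>\<^bsub>N\<^esub> F v"
    and eps: "\<And>i v. F (shift (\<lambda>_. 1) (vproj r i v)) = pr (lev m) (arrow (Eps i)) \<odot>\<^bsub>N\<^esub> F v"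
    and alpha: "\<And>a v. a \<in> alphas C \<Omega> \<Longrightarrow> F (\<alpha> a v) = pr (lev m) (arrow a) \<odot>\<^bsub>N\<^esub> F v"
    and ker: "\<And>v. ediv m (cut r v) \<Longrightarrow> F v = \<zero>\<^bsub>N\<^esub>"
  obtains h where "h \<in> lmod_hom (R (lev m)) M N" "\<And>v. h (\<Psi> v) = F v"
proof -
  interpret N: left_module "R (lev m)" N by fact
  have fr: "frame m r M \<Psi>" and \<alpha>: "\<alpha> \<in> reps r r" using M by (auto simp: presents_def)
  note D = frame_module[OF fr] frame_range[OF fr] frame_closed[OF fr] frame_add[OF fr]
  define h where "h x = F (SOME v. \<Psi> v = x)" for x
  have h: "h (\<Psi> v) = F v" for v
  proof -
    let ?w = "SOME w. \<Psi> w = \<Psi> v"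
    have "\<Psi> ?w = \<Psi> v" by (rule someI[of "\<lambda>w. \<Psi> w = \<Psi> v"]) simp
    then have "F (?w - v) = \<zero>\<^bsub>N\<^esub>" by (intro ker) (simp add: frame_eq_iff[OF fr])
    moreover have "F ?w = F (?w - v) \<oplus>\<^bsub>N\<^esub> F v" by (simp add: F(2)[symmetric])
    ultimately show ?thesis by (simp add: h_def F)
  qed
  have act: "F (vact r \<alpha> a v) = pr (lev m) a \<odot>\<^bsub>N\<^esub> F v" if "a \<in> carrier A" for a v
  proof (rule is_action_intertwine[OF vact_is_action[OF \<alpha>] module_is_action[OF N] _ _ _ _ _ _ that])
    show "F (vact r \<alpha> (arrow b) x) = pr (lev m) (arrow b) \<odot>\<^bsub>N\<^esub> F x" if "b \<in> arcs (quiver C \<Omega>)" for b x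
      using that eps alpha by (auto simp: arcs_quiver vact_simps[OF \<alpha>])
  qed (auto simp: F vact_simps[OF \<alpha>] idm ker cut_0 vdvd_0 simp del: zero_fun_apply plus_fun_apply)
  have "h \<in> lmod_hom (R (lev m)) M N"
    unfolding lmod_hom_def mem_Collect_eq
  proof (intro conjI ballI)
    show "h \<in> carrier M \<rightarrow> carrier N" by (auto simp: D(2)[symmetric] h F)
    fix x assume x: "x \<in> carrier M"
    then obtain v where v: "x = \<Psi> v" using D(2) by blast
    show "h (x \<oplus>\<^bsub>M\<^esub> y) = h x \<oplus>\<^bsub>N\<^esub> h y" if "y \<in> carrier M" for y
      using that by (auto simp: D(2)[symmetric] v D(4)[symmetric] h F)
    fix a assume "a \<in> carrier (R (lev m))"
    then obtain b where b: "b \<in> carrier A" "a = pr (lev m) b" using pr_surj by blast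
    show "h (a \<odot>\<^bsub>M\<^esub> x) = a \<odot>\<^bsub>N\<^esub> h x"
      unfolding v b(2) presents_act[OF fr M b(1), symmetric] h by (rule act[OF b(1)])
  qed
  then show thesis using h by (rule that)
qed

lemma presents_isomorphic:
  assumes M: "presents m r \<alpha> M \<Psi>" and N: "presents m r' \<beta> N \<Phi>" and \<theta>: "\<theta> \<in> hom_space r r'"
    and hom: "\<And>a v. a \<in> alphas C \<Omega> \<Longrightarrow> ediv m (\<beta> a (\<theta> v) - \<theta> (\<alpha> a v))"
    and inj: "\<And>v. ediv m (\<theta> v) \<Longrightarrow> ediv m (cut r v)"
    and surj: "\<And>w. \<exists>v. ediv m (cut r' w - \<theta> v)"
  shows "lmod_isomorphic (R (lev m)) M N"
proof -
  have frM: "frame m r M \<Psi>" and frN: "frame m r' N \<Phi>" using M N by (auto simp: presents_def)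
  note T = hom_spaceD[OF \<theta>]
  note D = frame_closed[OF frN] frame_add[OF frN] frame_vsc[OF frN] frame_idm[OF frN]
  have cong: "\<Phi> v = \<Phi> w" if "ediv m (v - w)" for v w
    using that by (simp add: frame_eq_iff[OF frN] vdvd_cut)
  obtain h where h: "h \<in> lmod_hom (R (lev m)) M N" and h_\<Psi>: "\<And>v. h (\<Psi> v) = \<Phi> (\<theta> v)"
  proof (rule presents_induced_hom[OF M frame_module[OF frN], of "\<lambda>v. \<Phi> (\<theta> v)"])
    show "\<Phi> (\<theta> (shift (\<lambda>_. 1) (vproj r i v))) = pr (lev m) (arrow (Eps i)) \<odot>\<^bsub>N\<^esub> \<Phi> (\<theta> v)" for i v
      using frame_kpol[OF frN, of "monom 1 1" i "\<theta> v"] kpol_X[of i] by (simp add: T)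
    show "\<Phi> (\<theta> (\<alpha> a v)) = pr (lev m) (arrow a) \<odot>\<^bsub>N\<^esub> \<Phi> (\<theta> v)" if a: "a \<in> alphas C \<Omega>" for a v
    proof -
      have "\<Phi> (\<beta> a (\<theta> v)) = \<Phi> (\<theta> (\<alpha> a v))" by (rule cong[OF hom[OF a]])
      then show ?thesis using N a by (simp add: presents_def)
    qed
    show "\<Phi> (\<theta> v) = \<zero>\<^bsub>N\<^esub>" if "ediv m (cut r v)" for v
      using hom_ediv[OF \<theta> that] by (simp add: T frame_zero_iff[OF frN])
  qed (auto simp: T(1-6) T(7)[symmetric] D)
  have "inj_on h (carrier M)"
  proof (rule inj_onI)
    fix x y assume xy: "x \<in> carrier M" "y \<in> carrier M" "h x = h y"
    then obtain v w where vw: "x = \<Psi> v" "y = \<Psi> w" using frame_range[OF frM] by blast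
    have "\<Phi> (\<theta> v) = \<Phi> (\<theta> w)" using xy by (simp add: vw h_\<Psi>)
    then have "ediv m (\<theta> (v - w))" by (simp add: frame_eq_iff[OF frN] T cut_diff)
    then show "x = y" unfolding vw frame_eq_iff[OF frM] by (rule inj)
  qed
  moreover have "h ` carrier M = carrier N"
  proof (intro equalityI subsetI)
    fix y assume "y \<in> carrier N"
    then obtain w where w: "y = \<Phi> w" using frame_range[OF frN] by blast
    obtain v where "ediv m (cut r' w - \<theta> v)" using surj by blast
    then have "y = h (\<Psi> v)" using cong frame_cut[OF frN] by (metis w h_\<Psi>)
    then show "y \<in> h ` carrier M" using frame_closed[OF frM] by blast
  qed (use lmod_homD(1)[OF h] in auto)
  ultimately show ?thesis using h by (auto simp: lmod_isomorphic_def bij_betw_def)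
qed

text \<open>The isomorphism is induced by \<open>cut r\<close>, the identity of the model of rank
  \<open>r\<close>.\<close>

lemma presents_unique:
  assumes "presents m r \<alpha> M \<Psi>" "presents m r \<alpha> N \<Phi>"
  shows "lmod_isomorphic (R (lev m)) M N"
proof -
  have \<alpha>: "\<alpha> \<in> reps r r" using assms(1) by (simp add: presents_def)
  have "cut r (\<alpha> a v) = \<alpha> a v" "\<alpha> a (cut r v) = \<alpha> a v" if "a \<in> alphas C \<Omega>" for a v
    by (metis arrow_spaceD(3)[OF repsD[OF \<alpha> that]] cut_vproj)
      (metis arrow_spaceD(2)[OF repsD[OF \<alpha> that]] vproj_cut)
  moreover have "\<exists>v. ediv m (cut r w - cut r v)" for w :: "('n, 'k) pvec"
    by (rule exI[of _ w]) (simp add: vdvd_0)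
  ultimately show ?thesis
    by (intro presents_isomorphic[OF assms, of "cut r"])
      (auto simp: hom_space_def cut_add dmul_cut cut_cut vdvd_0)
qed

lemma presents_transfer:
  assumes M: "presents m r \<alpha> M \<Psi>" and N: "left_module (R (lev m)) N"
    and h: "h \<in> lmod_hom (R (lev m)) M N" "bij_betw h (carrier M) (carrier N)"
  shows "presents m r \<alpha> N (\<lambda>v. h (\<Psi> v))"
proof -
  have fr: "frame m r M \<Psi>" using M by (auto simp: presents_def)
  note D = frame_closed[OF fr] frame_add[OF fr] frame_vsc[OF fr] frame_kpol[OF fr]
  have "h (\<Psi> v) = \<zero>\<^bsub>N\<^esub> \<longleftrightarrow> \<Psi> v = \<zero>\<^bsub>M\<^esub>" for v
    using h(2) frame_closed[OF fr] frame_0[OF fr] lmod_hom_zero[OF frame_module[OF fr] N h(1)]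
    by (metis bij_betw_def inj_on_def)
  moreover have "range (\<lambda>v. h (\<Psi> v)) = carrier N"
    using h(2) frame_range[OF fr] by (metis bij_betw_def image_image)
  ultimately show ?thesis
    using M N unfolding presents_def frame_def
    by (simp add: D lmod_homD[OF h(1)] H_scalar_closed)
qed

end


section \<open>Locally free modules are presented by polynomial models\<close>

lemma (in left_module) smult_finsum_right:
  assumes "a \<in> carrier R" "f \<in> I \<rightarrow> carrier M"
  shows "a \<odot>\<^bsub>M\<^esub> (\<Oplus>\<^bsub>M\<^esub>i\<in>I. f i) = (\<Oplus>\<^bsub>M\<^esub>i\<in>I. a \<odot>\<^bsub>M\<^esub> f i)"
  using assms
  by (induction I rule: infinite_finite_induct)
    (auto simp: smult_zero_right lsmult_r_distr Pi_def lsmult_closed M.finsum_insert)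

lemma lmod_hom_finsum:
  assumes "left_module R M" "left_module R N" "h \<in> lmod_hom R M N" "f \<in> I \<rightarrow> carrier M"
  shows "h (\<Oplus>\<^bsub>M\<^esub>i\<in>I. f i) = (\<Oplus>\<^bsub>N\<^esub>i\<in>I. h (f i))"
proof -
  interpret M: left_module R M by fact
  interpret N: left_module R N by fact
  show ?thesis using assms(4)
  proof (induction I rule: infinite_finite_induct)
    case (insert i I)
    then show ?case
      using lmod_homD(1,2)[OF assms(3)] by (auto simp: M.finsum_insert N.finsum_insert Pi_def)
  qed (simp_all add: lmod_hom_zero[OF assms(1-3)])
qed

context cartan
begin

text \<open>The given isomorphism and its inverse lift separately to polynomial maps over the loops.
  The lifts are mutually inverse and commute with the arrows only modulo \<epsilon>^m, which is just
  what \<open>iso_lift\<close> takes as input.\<close>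

lemma lift_isomorphic:
  assumes M': "presents m r \<alpha> M' \<Psi>'" and N': "presents m r' \<beta> N' \<Phi>'"
    and iso: "lmod_isomorphic (R (lev m)) M' N'" and rig: "rigid_mod m r \<alpha>"
    and M: "presents k r \<alpha> M \<Psi>" and N: "presents k r' \<beta> N \<Phi>"
    and m: "0 < m" "m \<le> k" "k \<le> m + m"
  shows "lmod_isomorphic (R (lev k)) M N"
proof -
  interpret K: cartan_mult C c \<Omega> A k by unfold_locales (use m in simp)
  interpret L: cartan_mult C c \<Omega> A m by unfold_locales (use m in simp)
  have fM: "frame m r M' \<Psi>'" and fN: "frame m r' N' \<Phi>'" and \<alpha>: "\<alpha> \<in> reps r r" and \<beta>: "\<beta> \<in> reps r' r'"
    using M' N' by (simp_all add: presents_def)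
  note DM = L.frame_closed[OF fM] L.frame_add[OF fM] L.frame_vsc[OF fM] L.frame_kpol[OF fM] L.frame_cut[OF fM]
  note DN = L.frame_closed[OF fN] L.frame_add[OF fN] L.frame_vsc[OF fN] L.frame_kpol[OF fN] L.frame_cut[OF fN]
  obtain h where h: "h \<in> lmod_hom (R (lev m)) M' N'" and bij: "bij_betw h (carrier M') (carrier N')"
    using iso by (auto simp: lmod_isomorphic_def)
  define g where "g = inv_into (carrier M') h"
  have g: "g \<in> lmod_hom (R (lev m)) N' M'"
    unfolding g_def by (rule lmod_hom_inverse[OF L.frame_module[OF fM] h bij])
  have gh: "g (h x) = x" if "x \<in> carrier M'" for x using bij that by (simp add: g_def bij_betw_def)
  have hg: "h (g y) = y" if "y \<in> carrier N'" for y using bij that by (simp add: g_def bij_betw_def f_inv_into_f)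
  obtain \<theta> where \<theta>: "\<theta> \<in> hom_space r r'" and \<Phi>\<theta>: "\<And>v. \<Phi>' (\<theta> v) = h (\<Psi>' v)"
    by (rule L.frame_lift_hom[OF fN, of "\<lambda>v. h (\<Psi>' v)" r])
      (auto simp: DM lmod_homD[OF h] L.H_scalar_closed)
  obtain \<eta> where \<eta>: "\<eta> \<in> hom_space r' r" and \<Psi>\<eta>: "\<And>v. \<Psi>' (\<eta> v) = g (\<Phi>' v)"
    by (rule L.frame_lift_hom[OF fM, of "\<lambda>v. g (\<Phi>' v)" r'])
      (auto simp: DN lmod_homD[OF g] L.H_scalar_closed)
  have 1: "ediv m (\<eta> (\<theta> v) - cut r v)" for v
  proof -
    have "\<Psi>' (\<eta> (\<theta> v)) = \<Psi>' v" by (simp add: \<Psi>\<eta> \<Phi>\<theta> gh DM)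
    then show ?thesis by (simp add: L.frame_eq_iff[OF fM] cut_diff hom_spaceD[OF \<eta>])
  qed
  have 2: "ediv m (\<theta> (\<eta> v) - cut r' v)" for v
  proof -
    have "\<Phi>' (\<theta> (\<eta> v)) = \<Phi>' v" by (simp add: \<Psi>\<eta> \<Phi>\<theta> hg DN)
    then show ?thesis by (simp add: L.frame_eq_iff[OF fN] cut_diff hom_spaceD[OF \<theta>])
  qed
  have 3: "ediv m (\<beta> a (\<theta> v) - \<theta> (\<alpha> a v))" if a: "a \<in> alphas C \<Omega>" for a v
  proof -
    have "\<Phi>' (\<beta> a (\<theta> v)) = \<Phi>' (\<theta> (\<alpha> a v))"
      using M' N' a by (simp add: presents_def \<Phi>\<theta> DM lmod_homD[OF h])
    moreover have "cut r' (\<beta> a (\<theta> v)) = \<beta> a (\<theta> v)"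
      by (metis arrow_spaceD(3)[OF repsD[OF \<beta> a]] cut_vproj)
    ultimately show ?thesis by (simp add: L.frame_eq_iff[OF fN] cut_diff hom_spaceD[OF \<theta>])
  qed
  show ?thesis
  proof (rule iso_lift[OF \<alpha> \<beta> rig m(1,3) \<theta> \<eta> 1 2 3])
    fix \<theta>' assume T: "\<theta>' \<in> hom_space r r'" "\<And>a v. a \<in> alphas C \<Omega> \<Longrightarrow> ediv k (\<beta> a (\<theta>' v) - \<theta>' (\<alpha> a v))"
      "\<And>v. m \<le> k \<Longrightarrow> ediv k (\<theta>' v) \<Longrightarrow> ediv k (cut r v)" "\<And>w. \<exists>v. ediv k (cut r' w - \<theta>' v)"
    show ?thesis by (rule K.presents_isomorphic[OF M N T(1,2) T(3)[OF m(2)] T(4)])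
  qed
qed

lemma cut_vunit: "cut r (vunit i l p) = (if l < r i then vunit i l p else 0)"
  by (auto simp: cut_def vunit_def fun_eq_iff)

lemma kpol_mult_neq: "i \<noteq> j \<Longrightarrow> kpol i p \<otimes> kpol j q = \<zero>"
proof -
  assume "i \<noteq> j"
  have "kpol i p \<otimes> kpol j q = (kpol i p \<otimes> idm i) \<otimes> (idm j \<otimes> kpol j q)"
    using kpol_mult[of i p 1] by (simp add: idm_kpol kpol_1)
  also have "\<dots> = kpol i p \<otimes> ((idm i \<otimes> idm j) \<otimes> kpol j q)" by (simp add: PA.m_assoc)
  also have "\<dots> = \<zero>" using \<open>i \<noteq> j\<close> by (simp add: idm_mult)
  finally show ?thesis .
qed

definition coords :: "('n \<Rightarrow> nat) \<Rightarrow> ('n \<times> nat) set" where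
  "coords r = (SIGMA i:UNIV. {..<r i})"

lemma finite_coords: "finite (coords r)"
  by (simp add: coords_def)

lemma cut_eq_sum_vunit: "cut r v = (\<Sum>(i, l)\<in>coords r. vunit i l (v i l))"
proof -
  have "cut r v = (\<Sum>i\<in>UNIV. \<Sum>l<r i. vunit i l (v i l))"
    by (simp add: sum_vproj[symmetric] vproj_eq_sum_vunit)
  then show ?thesis by (simp add: coords_def sum.Sigma)
qed

end

section \<open>Coordinates with respect to bases at the vertices\<close>

context cartan_mult
begin

lemma pr_kpol_eq_0:
  assumes "monom 1 (m * c i) dvd p" shows "pr (lev m) (kpol i p) = \<zero>\<^bsub>R (lev m)\<^esub>"
proof -
  obtain q where "p = monom 1 (m * c i) * q" using assms by (elim dvdE)
  then show ?thesis using pr_kpol_zero[of i] by (simp add: kpol_mult)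
qed

text \<open>The relations must not force a smaller power of a loop to vanish. This is seen on a
  module: in the model of rank one at every vertex, the value of \<open>p\<close> at the loop moves
  the unit vector to \<open>p\<close>.\<close>

lemma pr_kpol_eq_0_iff: "pr (lev m) (kpol i p) = \<zero>\<^bsub>R (lev m)\<^esub> \<longleftrightarrow> monom 1 (m * c i) dvd p"
proof
  define r where "r = (\<lambda>_::'n. 1::nat)"
  \<comment> \<open>Zero arrow maps satisfy every arrow relation, so this is a model.\<close>
  let ?\<alpha> = "\<lambda>(_::'n arrow) (_::('n, 'k) pvec). 0 :: ('n, 'k) pvec"
  assume 0: "pr (lev m) (kpol i p) = \<zero>\<^bsub>R (lev m)\<^esub>"
  have \<alpha>: "?\<alpha> \<in> reps r r"
    by (simp add: reps_def arrow_space_def klinear_def dmul_0 vproj_0 del: zero_fun_apply)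
  let ?M = "vmod m r ?\<alpha>"
  have fr: "frame m r ?M (trunc m r)" using presents_vmod[OF \<alpha>] by (simp add: presents_def)
  interpret M: left_module "R (lev m)" ?M by (rule frame_module[OF fr])
  let ?v = "vunit i 0 1"
  have "trunc m r (dmul (\<lambda>_. p) (vproj r i ?v)) = \<zero>\<^bsub>?M\<^esub>"
    by (simp add: frame_kpol[OF fr] 0 M.smult_zero_left frame_closed[OF fr])
  then have "ediv m (vunit i 0 p)"
    unfolding frame_zero_iff[OF fr] by (simp add: dmul_cut[symmetric] cut_vproj cut_vunit vproj_vunit dmul_vunit r_def)
  then show "monom 1 (m * c i) dvd p" unfolding vdvd_def vunit_def by (metis (full_types))
qed (rule pr_kpol_eq_0)

lemma pr_kpol_eq_iff:
  "pr (lev m) (kpol i p) = pr (lev m) (kpol i q) \<longleftrightarrow> monom 1 (m * c i) dvd p - q"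
proof -
  have "pr (lev m) (kpol i p) = pr (lev m) (kpol i (p - q)) \<oplus>\<^bsub>R (lev m)\<^esub> pr (lev m) (kpol i q)"
    using kpol_add[of i "p - q" q] by simp
  then show ?thesis
    unfolding pr_kpol_eq_0_iff[symmetric] by (simp add: pr.S.add.r_cancel_one)
qed

text \<open>The map from the free module that sends the unit vector at \<open>(i, l)\<close> to the
  part of \<open>b i l\<close> at \<open>i\<close>: the coefficients contain the idempotent of the
  vertex, so \<open>b i l\<close> may be any element of the module.\<close>

definition fmap :: "('n \<Rightarrow> nat) \<Rightarrow> (('n, 'k) KQ set, 'm) module \<Rightarrow> ('n \<Rightarrow> nat \<Rightarrow> 'm) \<Rightarrow> ('n, 'k) pvec \<Rightarrow> 'm" where
  "fmap r N b v = (\<Oplus>\<^bsub>N\<^esub>x\<in>coords r. pr (lev m) (kpol (fst x) (v (fst x) (snd x))) \<odot>\<^bsub>N\<^esub> b (fst x) (snd x))"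

context
  fixes N :: "(('n, 'k) KQ set, 'm) module" and b :: "'n \<Rightarrow> nat \<Rightarrow> 'm" and r :: "'n \<Rightarrow> nat"
  assumes N: "left_module (R (lev m)) N" and b: "b i l \<in> carrier N"
begin

interpretation N: left_module "R (lev m)" N by (rule N)

lemma fmap_closed: "fmap r N b v \<in> carrier N"
  unfolding fmap_def by (rule N.M.finsum_closed) (simp add: N.lsmult_closed b)

lemma fmap_add: "fmap r N b (v + w) = fmap r N b v \<oplus>\<^bsub>N\<^esub> fmap r N b w"
  unfolding fmap_def
  by (subst N.M.finsum_addf[symmetric]) (auto simp: N.lsmult_closed b kpol_add N.lsmult_l_distr)

lemma fmap_vsc: "fmap r N b (vsc a v) = H_scalar C (lev m) \<Omega> a \<odot>\<^bsub>N\<^esub> fmap r N b v"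
  unfolding fmap_def
  by (subst N.smult_finsum_right)
    (auto simp: N.lsmult_closed b H_scalar_closed N.lsmult_assoc[symmetric] pr_ascale[symmetric] dmul_def kpol_smult)

lemma fmap_kpol: "fmap r N b (dmul (\<lambda>_. p) (vproj r i v)) = pr (lev m) (kpol i p) \<odot>\<^bsub>N\<^esub> fmap r N b v"
proof -
  have "kpol j (p * (if j = i \<and> l < r j then q else 0)) = kpol i p \<otimes> kpol j q" if "l < r j" for j l q
    using that by (simp add: kpol_mult kpol_mult_neq)
  then show ?thesis
    unfolding fmap_def
    by (subst N.smult_finsum_right)
      (auto simp: N.lsmult_closed b N.lsmult_assoc[symmetric] dmul_def vproj_def coords_def
        simp flip: pr.hom_mult intro!: N.M.finsum_cong')
qed

lemma fmap_eq_0: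
  assumes "ediv m (cut r v)" shows "fmap r N b v = \<zero>\<^bsub>N\<^esub>"
proof -
  have "fmap r N b v = (\<Oplus>\<^bsub>N\<^esub>x\<in>coords r. \<zero>\<^bsub>N\<^esub>)"
    unfolding fmap_def
  proof (rule N.M.finsum_cong')
    fix x assume "x \<in> coords r"
    then have "snd x < r (fst x)" by (auto simp: coords_def)
    then have "monom 1 (m * c (fst x)) dvd v (fst x) (snd x)"
      using assms by (auto simp: vdvd_def cut_def dest!: spec[of _ "fst x"] spec[of _ "snd x"])
    then show "pr (lev m) (kpol (fst x) (v (fst x) (snd x))) \<odot>\<^bsub>N\<^esub> b (fst x) (snd x) = \<zero>\<^bsub>N\<^esub>"
      by (simp add: pr_kpol_eq_0 N.smult_zero_left b)
  qed auto
  then show ?thesis by simp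
qed

lemma fmap_vproj:
  "fmap r N b (vproj r i v) = (\<Oplus>\<^bsub>N\<^esub>l\<in>{..<r i}. pr (lev m) (kpol i (v i l)) \<odot>\<^bsub>N\<^esub> b i l)"
proof -
  have "fmap r N b (vproj r i v) = (\<Oplus>\<^bsub>N\<^esub>x\<in>Pair i ` {..<r i}. pr (lev m) (kpol (fst x) (v (fst x) (snd x))) \<odot>\<^bsub>N\<^esub> b (fst x) (snd x))"
    unfolding fmap_def
    by (rule N.M.add.finprod_mono_neutral_cong_right[OF finite_coords])
      (auto simp: coords_def vproj_def N.lsmult_closed b N.smult_zero_left)
  then show ?thesis
    by (subst (asm) N.M.finsum_reindex) (auto simp: N.lsmult_closed b inj_on_def)
qed

end

lemma frame_eq_fmap:
  assumes fr: "frame m r M \<Psi>"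
  shows "\<Psi> v = fmap r M (\<lambda>i l. \<Psi> (vunit i l 1)) v"
proof -
  interpret M: left_module "R (lev m)" M by (rule frame_module[OF fr])
  have "\<Psi> v = \<Psi> (\<Sum>(i, l)\<in>coords r. vunit i l (v i l))"
    by (simp add: cut_eq_sum_vunit[symmetric] frame_cut[OF fr])
  also have "\<dots> = (\<Oplus>\<^bsub>M\<^esub>x\<in>coords r. \<Psi> (vunit (fst x) (snd x) (v (fst x) (snd x))))"
    by (simp add: frame_sum[OF fr] case_prod_beta)
  also have "\<dots> = fmap r M (\<lambda>i l. \<Psi> (vunit i l 1)) v"
    unfolding fmap_def
  proof (rule M.M.finsum_cong')
    fix x assume "x \<in> coords r"
    then have "vproj r (fst x) (vunit (fst x) (snd x) 1) = (vunit (fst x) (snd x) 1 :: ('n, 'k) pvec)"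
      by (auto simp: coords_def vproj_vunit)
    then show "\<Psi> (vunit (fst x) (snd x) (v (fst x) (snd x))) =
        pr (lev m) (kpol (fst x) (v (fst x) (snd x))) \<odot>\<^bsub>M\<^esub> \<Psi> (vunit (fst x) (snd x) 1)"
      using frame_kpol[OF fr, of "v (fst x) (snd x)" "fst x" "vunit (fst x) (snd x) 1"]
      by (simp add: dmul_vunit)
  qed (auto simp: M.lsmult_closed frame_closed[OF fr])
  finally show ?thesis .
qed

section \<open>The vertex algebras and the vertex parts of a module\<close>

lemma generated_subalgebra_eq:
  "generated_subalgebra (R (lev m)) (H_scalar C (lev m) \<Omega>) (H_idem C (lev m) \<Omega> i) {H_eps C (lev m) \<Omega> i}
    = range (\<lambda>p. pr (lev m) (kpol i p))" (is "?G = ?P")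
proof (intro equalityI subsetI)
  fix x assume "x \<in> ?G"
  then show "x \<in> ?P"
  proof induction
    case unit
    then show ?case by (auto simp: H_idem_def kpol_1[symmetric])
  next
    case (gen x)
    then show ?case by (auto simp: H_eps_def kpol_X[symmetric])
  next
    case (scale x a)
    then show ?case by (auto simp: pr_ascale[symmetric] kpol_smult[symmetric])
  next
    case (add x y)
    then show ?case by (auto simp: kpol_add[symmetric] simp flip: pr.hom_add)
  next
    case (mult x y)
    then show ?case by (auto simp: kpol_mult[symmetric] simp flip: pr.hom_mult)
  qed
next
  fix x assume "x \<in> ?P"
  then obtain p where "x = pr (lev m) (kpol i p)" by auto
  moreover have "pr (lev m) (kpol i p) \<in> ?G"
  proof (induction p)
    case 0
    \<comment> \<open>The generation rules produce zero as the zero multiple of the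
      idempotent.\<close>
    have "pr (lev m) (kpol i 0) = H_scalar C (lev m) \<Omega> 0 \<otimes>\<^bsub>R (lev m)\<^esub> H_idem C (lev m) \<Omega> i"
      by (simp add: H_idem_def pr_ascale[symmetric] ascale_simps)
    then show ?case by (simp only: generated_subalgebra.scale generated_subalgebra.unit)
  next
    case (pCons a p)
    have "pr (lev m) (kpol i (pCons a p)) = (H_scalar C (lev m) \<Omega> a \<otimes>\<^bsub>R (lev m)\<^esub> H_idem C (lev m) \<Omega> i)
        \<oplus>\<^bsub>R (lev m)\<^esub> (H_eps C (lev m) \<Omega> i \<otimes>\<^bsub>R (lev m)\<^esub> pr (lev m) (kpol i p))"
      by (simp add: H_idem_def H_eps_def kpol_pCons pr_ascale)
    then show ?case
      using pCons by (simp only: generated_subalgebra.intros insertI1)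
  qed
  ultimately show "x \<in> ?G" by simp
qed

lemma H_vertex_simps:
  "carrier (H_vertex C (lev m) \<Omega> i) = range (\<lambda>p. pr (lev m) (kpol i p))"
  "\<one>\<^bsub>H_vertex C (lev m) \<Omega> i\<^esub> = pr (lev m) (idm i)"
  "x \<oplus>\<^bsub>H_vertex C (lev m) \<Omega> i\<^esub> y = x \<oplus>\<^bsub>R (lev m)\<^esub> y"
  "x \<otimes>\<^bsub>H_vertex C (lev m) \<Omega> i\<^esub> y = x \<otimes>\<^bsub>R (lev m)\<^esub> y"
  "\<zero>\<^bsub>H_vertex C (lev m) \<Omega> i\<^esub> = \<zero>\<^bsub>R (lev m)\<^esub>"
  by (simp_all add: H_vertex_def generated_subalgebra_eq) (simp add: H_idem_def)

text \<open>All elements are polynomials in the loop, so the axioms reduce to polynomial arithmetic.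
  The unit is the idempotent of the vertex, which in general differs from the unit of the ambient
  algebra.\<close>

lemma ring_H_vertex: "ring (H_vertex C (lev m) \<Omega> i :: ('n, 'k) KQ set ring)"
proof (rule ringI)
  let ?H = "H_vertex C (lev m) \<Omega> i :: ('n, 'k) KQ set ring"
  note S = H_vertex_simps[of i]
  have zero: "\<zero>\<^bsub>R (lev m)\<^esub> = pr (lev m) (kpol i 0)" by simp
  have add: "pr (lev m) (kpol i p) \<oplus>\<^bsub>R (lev m)\<^esub> pr (lev m) (kpol i q) = pr (lev m) (kpol i (p + q))" for p q
    by (simp add: kpol_add)
  have mult: "pr (lev m) (kpol i p) \<otimes>\<^bsub>R (lev m)\<^esub> pr (lev m) (kpol i q) = pr (lev m) (kpol i (p * q))" for p q
    by (simp add: kpol_mult)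
  have one: "pr (lev m) (idm i) = pr (lev m) (kpol i 1)" by (simp add: kpol_1)
  show "abelian_group ?H"
  proof (rule abelian_groupI)
    show "\<exists>y\<in>carrier ?H. y \<oplus>\<^bsub>?H\<^esub> x = \<zero>\<^bsub>?H\<^esub>" if x: "x \<in> carrier ?H" for x
    proof -
      obtain p where "x = pr (lev m) (kpol i p)" using x by (auto simp: S)
      then show ?thesis unfolding S zero
        by (intro bexI[of _ "pr (lev m) (kpol i (- p))"]) (auto simp: add simp del: kpol_0)
    qed
  qed (auto simp: S zero add add_ac simp del: kpol_0)
  show "monoid ?H"
    by (rule monoidI) (auto simp: S one mult mult_ac)
  show "(x \<oplus>\<^bsub>?H\<^esub> y) \<otimes>\<^bsub>?H\<^esub> z = x \<otimes>\<^bsub>?H\<^esub> z \<oplus>\<^bsub>?H\<^esub> y \<otimes>\<^bsub>?H\<^esub> z"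
    "z \<otimes>\<^bsub>?H\<^esub> (x \<oplus>\<^bsub>?H\<^esub> y) = z \<otimes>\<^bsub>?H\<^esub> x \<oplus>\<^bsub>?H\<^esub> z \<otimes>\<^bsub>?H\<^esub> y"
    if "x \<in> carrier ?H" "y \<in> carrier ?H" "z \<in> carrier ?H" for x y z
    using that by (auto simp: S add mult algebra_simps)
qed

lemma vertex_part_simps:
  "carrier (vertex_part C (lev m) \<Omega> M i) = (\<lambda>x. pr (lev m) (idm i) \<odot>\<^bsub>M\<^esub> x) ` carrier M"
  "x \<oplus>\<^bsub>vertex_part C (lev m) \<Omega> M i\<^esub> y = x \<oplus>\<^bsub>M\<^esub> y" "\<zero>\<^bsub>vertex_part C (lev m) \<Omega> M i\<^esub> = \<zero>\<^bsub>M\<^esub>"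
  "a \<odot>\<^bsub>vertex_part C (lev m) \<Omega> M i\<^esub> x = a \<odot>\<^bsub>M\<^esub> x"
  by (simp_all add: vertex_part_def H_idem_def)

context
  fixes M :: "(('n, 'k) KQ set, 'm) module"
  assumes M: "left_module (R (lev m)) M"
begin

interpretation M: left_module "R (lev m)" M by (rule M)

lemma vertex_part_carrier_iff:
  "x \<in> carrier (vertex_part C (lev m) \<Omega> M i) \<longleftrightarrow> x \<in> carrier M \<and> pr (lev m) (idm i) \<odot>\<^bsub>M\<^esub> x = x"
proof -
  have "pr (lev m) (idm i) \<odot>\<^bsub>M\<^esub> (pr (lev m) (idm i) \<odot>\<^bsub>M\<^esub> x) = pr (lev m) (idm i) \<odot>\<^bsub>M\<^esub> x" if "x \<in> carrier M" for x
    using that idm_mult[of i i] by (simp add: M.lsmult_assoc[symmetric] flip: pr.hom_mult)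
  then show ?thesis unfolding vertex_part_simps by (auto simp: M.lsmult_closed intro: image_eqI[OF sym])
qed

lemma idm_kpol_smult:
  "x \<in> carrier M \<Longrightarrow> pr (lev m) (idm i) \<odot>\<^bsub>M\<^esub> (pr (lev m) (kpol i p) \<odot>\<^bsub>M\<^esub> x) = pr (lev m) (kpol i p) \<odot>\<^bsub>M\<^esub> x"
  by (simp add: M.lsmult_assoc[symmetric] idm_kpol flip: pr.hom_mult)

lemma left_module_vertex_part: "left_module (H_vertex C (lev m) \<Omega> i) (vertex_part C (lev m) \<Omega> M i)"
proof -
  let ?V = "vertex_part C (lev m) \<Omega> M i"
  have "abelian_group ?V"
  proof (rule abelian_groupI)
    show "\<exists>y\<in>carrier ?V. y \<oplus>\<^bsub>?V\<^esub> x = \<zero>\<^bsub>?V\<^esub>" if x: "x \<in> carrier ?V" for x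
    proof -
      obtain y where y: "y \<in> carrier M" "x = pr (lev m) (idm i) \<odot>\<^bsub>M\<^esub> y"
        using x by (auto simp: vertex_part_simps)
      have "pr (lev m) (idm i) \<odot>\<^bsub>M\<^esub> (\<ominus>\<^bsub>M\<^esub> y) \<oplus>\<^bsub>M\<^esub> x = \<zero>\<^bsub>M\<^esub>"
        using y by (simp add: M.lsmult_r_distr[symmetric] M.l_neg M.smult_zero_right)
      then show ?thesis using y by (auto simp: vertex_part_simps)
    qed
  qed (auto simp: vertex_part_carrier_iff vertex_part_simps(2-4) M.lsmult_r_distr M.smult_zero_right M.add.m_ac)
  moreover have "left_module_axioms (H_vertex C (lev m) \<Omega> i) ?V"
    by unfold_locales (auto simp: vertex_part_carrier_iff vertex_part_simps(2-4) H_vertex_simps M.lsmult_closed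
      idm_kpol_smult M.lsmult_l_distr M.lsmult_r_distr M.lsmult_assoc)
  ultimately show ?thesis by (simp add: left_module_def ring_H_vertex)
qed

lemma finsum_vertex_part:
  assumes "f \<in> B \<rightarrow> carrier (vertex_part C (lev m) \<Omega> M i)"
  shows "(\<Oplus>\<^bsub>vertex_part C (lev m) \<Omega> M i\<^esub>b\<in>B. f b) = (\<Oplus>\<^bsub>M\<^esub>b\<in>B. f b)"
proof -
  interpret V: left_module "H_vertex C (lev m) \<Omega> i" "vertex_part C (lev m) \<Omega> M i"
    by (rule left_module_vertex_part)
  show ?thesis using assms
  proof (induction B rule: infinite_finite_induct)
    case (insert b B)
    then have "f \<in> B \<rightarrow> carrier M" "f b \<in> carrier M" by (auto simp: vertex_part_carrier_iff)
    then show ?case using insert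
      by (subst V.M.finsum_insert) (auto simp: M.finsum_insert vertex_part_simps(2))
  qed (simp_all add: vertex_part_simps(3))
qed

lemma eq_finsum_idm: "x \<in> carrier M \<Longrightarrow> x = (\<Oplus>\<^bsub>M\<^esub>i\<in>UNIV. pr (lev m) (idm i) \<odot>\<^bsub>M\<^esub> x)"
proof -
  assume x: "x \<in> carrier M"
  have "x = pr (lev m) (\<Oplus>i\<in>UNIV. idm i) \<odot>\<^bsub>M\<^esub> x"
    using M.lsmult_one[OF x] by (simp add: one_eq_finsum[symmetric])
  also have "pr (lev m) (\<Oplus>i\<in>UNIV. idm i) = (\<Oplus>\<^bsub>R (lev m)\<^esub>i\<in>UNIV. pr (lev m) (idm i))"
  proof -
    have "pr (lev m) (\<Oplus>i\<in>I. idm i) = (\<Oplus>\<^bsub>R (lev m)\<^esub>i\<in>I. pr (lev m) (idm i))" if "finite I" for I :: "'n set"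
      using that by induction simp_all
    then show ?thesis by simp
  qed
  also have "\<dots> \<odot>\<^bsub>M\<^esub> x = (\<Oplus>\<^bsub>M\<^esub>i\<in>UNIV. pr (lev m) (idm i) \<odot>\<^bsub>M\<^esub> x)"
    using x by (intro M.smult_finsum_left) auto
  finally show ?thesis .
qed

text \<open>Bases of all vertex parts together define the map. Existence of coordinates makes it
  surjective, and their uniqueness, with \<open>pr_kpol_eq_iff\<close>, gives its kernel.\<close>

lemma locally_free_frame:
  assumes lf: "locally_free C (lev m) \<Omega> M"
  obtains r \<Psi> where "frame m r M \<Psi>"
proof -
  let ?V = "vertex_part C (lev m) \<Omega> M" and ?H = "H_vertex C (lev m) \<Omega>"
  have "\<forall>i. \<exists>B. finite B \<and> B \<subseteq> carrier (?V i) \<and>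
      (\<forall>x\<in>carrier (?V i). \<exists>!r. r \<in> B \<rightarrow>\<^sub>E carrier (?H i) \<and> x = (\<Oplus>\<^bsub>?V i\<^esub>b\<in>B. r b \<odot>\<^bsub>?V i\<^esub> b))"
    using lf by (simp add: locally_free_def finite_free_module_def)
  from choice[OF this] obtain B where B': "\<forall>i. finite (B i) \<and> B i \<subseteq> carrier (?V i) \<and>
      (\<forall>x\<in>carrier (?V i). \<exists>!r. r \<in> B i \<rightarrow>\<^sub>E carrier (?H i) \<and> x = (\<Oplus>\<^bsub>?V i\<^esub>b\<in>B i. r b \<odot>\<^bsub>?V i\<^esub> b))" ..
  have B: "finite (B i)" "B i \<subseteq> carrier (?V i)" for i using B' by auto
  have uniq: "\<exists>!r. r \<in> B i \<rightarrow>\<^sub>E carrier (?H i) \<and> x = (\<Oplus>\<^bsub>?V i\<^esub>b\<in>B i. r b \<odot>\<^bsub>?V i\<^esub> b)"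
    if "x \<in> carrier (?V i)" for i x
    using spec[OF B', of i] that by simp
  define r where "r i = card (B i)" for i
  have "\<exists>b. bij_betw b {..<r i} (B i)" for i
    using ex_bij_betw_nat_finite[OF B(1)[of i]] by (simp add: r_def atLeast0LessThan)
  then obtain b where b: "\<And>i. bij_betw (b i) {..<r i} (B i)" by metis
  \<comment> \<open>The default zero beyond the rank keeps all values inside \<open>M\<close>, as
    the lemmas on \<open>fmap\<close> require.\<close>
  define b' where "b' i l = (if l < r i then b i l else \<zero>\<^bsub>M\<^esub>)" for i l
  have bB: "b i l \<in> B i" if "l < r i" for i l using bij_betwE[OF b] that by blast
  have bV: "b i l \<in> carrier (?V i)" if "l < r i" for i l using bB[OF that] B(2) by blast
  have bM: "b i l \<in> carrier M" if "l < r i" for i l using bV[OF that] by (simp add: vertex_part_carrier_iff)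
  have b_closed: "b' i l \<in> carrier M" for i l
    by (simp add: b'_def bM)
  let ?\<Psi> = "fmap r M b'"
  note fm = fmap_closed[OF M b_closed] fmap_add[OF M b_closed]
    fmap_vsc[OF M b_closed] fmap_kpol[OF M b_closed] fmap_eq_0[OF M b_closed]
  have idm: "?\<Psi> (vproj r i v) = pr (lev m) (idm i) \<odot>\<^bsub>M\<^esub> ?\<Psi> v" for i v
    using fm(4)[where p = 1 and r = r and i = i and v = v] by (simp add: kpol_1 dmul_1)
  have sum_B: "(\<Oplus>\<^bsub>?V i\<^esub>y\<in>B i. \<rho> y \<odot>\<^bsub>?V i\<^esub> y) = (\<Oplus>\<^bsub>M\<^esub>l\<in>{..<r i}. \<rho> (b i l) \<odot>\<^bsub>M\<^esub> b i l)"
    if \<rho>: "\<rho> \<in> B i \<rightarrow> carrier (?H i)" for i \<rho>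
  proof -
    have c: "\<rho> y \<odot>\<^bsub>M\<^esub> y \<in> carrier (?V i)" if "y \<in> B i" for y
      using left_module.lsmult_closed[OF left_module_vertex_part, of "\<rho> y" i y] that \<rho> B(2)[of i]
      by (auto simp: vertex_part_simps(4) Pi_def)
    have "(\<Oplus>\<^bsub>?V i\<^esub>y\<in>B i. \<rho> y \<odot>\<^bsub>?V i\<^esub> y) = (\<Oplus>\<^bsub>M\<^esub>y\<in>B i. \<rho> y \<odot>\<^bsub>M\<^esub> y)"
      unfolding vertex_part_simps(4) using c by (intro finsum_vertex_part) auto
    also have "\<dots> = (\<Oplus>\<^bsub>M\<^esub>y\<in>b i ` {..<r i}. \<rho> y \<odot>\<^bsub>M\<^esub> y)"
      using b[of i] by (simp add: bij_betw_def)
    also have "(\<Oplus>\<^bsub>M\<^esub>y\<in>b i ` {..<r i}. \<rho> y \<odot>\<^bsub>M\<^esub> y) = (\<Oplus>\<^bsub>M\<^esub>l\<in>{..<r i}. \<rho> (b i l) \<odot>\<^bsub>M\<^esub> b i l)"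
      using b[of i] c bB by (intro M.M.finsum_reindex) (auto simp: bij_betw_def vertex_part_carrier_iff)
    finally show ?thesis .
  qed
  have \<Psi>_vproj: "?\<Psi> (vproj r i v) = (\<Oplus>\<^bsub>M\<^esub>l\<in>{..<r i}. pr (lev m) (kpol i (v i l)) \<odot>\<^bsub>M\<^esub> b i l)" for i v
    unfolding fmap_vproj[OF M b_closed]
    by (rule M.M.finsum_cong') (auto simp: b'_def bM M.lsmult_closed)
  have "x \<in> range ?\<Psi>" if x: "x \<in> carrier M" for x
  proof -
    have part: "\<exists>v. ?\<Psi> v = pr (lev m) (idm i) \<odot>\<^bsub>M\<^esub> x" for i
    proof -
      have "pr (lev m) (idm i) \<odot>\<^bsub>M\<^esub> x \<in> carrier (?V i)" using x by (simp add: vertex_part_simps)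
      from ex1_implies_ex[OF uniq[OF this]] obtain \<rho> where \<rho>_eq: "\<rho> \<in> B i \<rightarrow>\<^sub>E carrier (?H i) \<and>
        pr (lev m) (idm i) \<odot>\<^bsub>M\<^esub> x = (\<Oplus>\<^bsub>?V i\<^esub>y\<in>B i. \<rho> y \<odot>\<^bsub>?V i\<^esub> y)" ..
      note \<rho> = conjunct1[OF \<rho>_eq] and eq = conjunct2[OF \<rho>_eq]
      have "\<forall>l<r i. \<exists>p. \<rho> (b i l) = pr (lev m) (kpol i p)"
        using PiE_mem[OF \<rho> bB] by (auto simp: H_vertex_simps)
      then obtain p where p: "\<And>l. l < r i \<Longrightarrow> \<rho> (b i l) = pr (lev m) (kpol i (p l))" by metis
      have "?\<Psi> (vproj r i (\<lambda>_. p)) = (\<Oplus>\<^bsub>M\<^esub>l\<in>{..<r i}. \<rho> (b i l) \<odot>\<^bsub>M\<^esub> b i l)"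
        unfolding \<Psi>_vproj
        by (rule M.M.finsum_cong') (auto simp: p bM M.lsmult_closed)
      also have "\<dots> = pr (lev m) (idm i) \<odot>\<^bsub>M\<^esub> x"
        unfolding eq using \<rho> by (intro sum_B[symmetric]) auto
      finally show ?thesis by blast
    qed
    then obtain v where v: "\<And>i. ?\<Psi> (v i) = pr (lev m) (idm i) \<odot>\<^bsub>M\<^esub> x" by metis
    have 0: "?\<Psi> 0 = \<zero>\<^bsub>M\<^esub>" by (rule fm(5)) (simp add: cut_0 vdvd_0 del: zero_fun_apply)
    have "(\<Oplus>\<^bsub>M\<^esub>i\<in>I. pr (lev m) (idm i) \<odot>\<^bsub>M\<^esub> x) = ?\<Psi> (\<Sum>i\<in>I. v i)" if "finite I" for I
      using that
    proof induction
      case (insert i I)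
      have "?\<Psi> (\<Sum>i\<in>insert i I. v i) = ?\<Psi> (v i) \<oplus>\<^bsub>M\<^esub> ?\<Psi> (\<Sum>i\<in>I. v i)"
        unfolding sum.insert[OF insert.hyps] by (rule fm(2))
      then show ?case using x insert by (simp add: v M.lsmult_closed M.finsum_insert del: plus_fun_apply)
    qed (simp add: 0 del: zero_fun_apply)
    then have x_eq: "x = ?\<Psi> (\<Sum>i\<in>UNIV. v i)" by (intro trans[OF eq_finsum_idm[OF x]]) simp
    show ?thesis by (subst x_eq) (rule rangeI)
  qed
  then have "carrier M \<subseteq> range ?\<Psi>" by (rule subsetI)
  moreover have "range ?\<Psi> \<subseteq> carrier M" by (rule image_subsetI) (rule fm(1))
  ultimately have ran: "range ?\<Psi> = carrier M" by simp
  have ker: "?\<Psi> v = \<zero>\<^bsub>M\<^esub> \<longleftrightarrow> ediv m (cut r v)" for v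
  proof
    assume 0: "?\<Psi> v = \<zero>\<^bsub>M\<^esub>"
    have "monom 1 (m * c i) dvd v i l" if l: "l < r i" for i l
    proof -
      \<comment> \<open>Coordinates are functions on the basis \<open>B i\<close>, restricted to it
        because uniqueness is stated for extensional functions.\<close>
      define \<rho> where "\<rho> = (\<lambda>p. restrict (\<lambda>y. pr (lev m) (kpol i (p (inv_into {..<r i} (b i) y)))) (B i))"
      have \<rho>: "\<rho> p \<in> B i \<rightarrow>\<^sub>E carrier (?H i)" for p by (auto simp: H_vertex_simps \<rho>_def)
      have val: "\<rho> p (b i l) = pr (lev m) (kpol i (p l))" if "l < r i" for p l
        using that bB b[of i] by (simp add: bij_betw_def \<rho>_def)
      have sum: "(\<Oplus>\<^bsub>?V i\<^esub>y\<in>B i. \<rho> p y \<odot>\<^bsub>?V i\<^esub> y) = ?\<Psi> (vproj r i (\<lambda>_. p))" for p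
        unfolding \<Psi>_vproj using \<rho>[of p]
        by (subst sum_B, force) (rule M.M.finsum_cong', auto simp: val bM M.lsmult_closed simp del: restrict_apply)
      have 1: "?\<Psi> (vproj r i (\<lambda>_. v i)) = \<zero>\<^bsub>M\<^esub>"
        using idm[of i v] by (simp add: \<Psi>_vproj 0 M.smult_zero_right)
      have 2: "?\<Psi> (vproj r i (\<lambda>_ _. 0)) = \<zero>\<^bsub>M\<^esub>"
        by (rule fm(5)) (simp add: cut_def vproj_def vdvd_def)
      have z: "\<zero>\<^bsub>M\<^esub> \<in> carrier (?V i)" by (simp add: vertex_part_carrier_iff M.smult_zero_right)
      \<comment> \<open>Both sides are coordinates of zero with respect to the basis.\<close>
      have "\<rho> (v i) = \<rho> (\<lambda>_. 0)"
        by (rule trans[OF the1_equality[OF uniq[OF z], symmetric] the1_equality[OF uniq[OF z]]]) (use \<rho> in \<open>simp_all add: sum 1 2\<close>)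
      then have "pr (lev m) (kpol i (v i l)) = pr (lev m) (kpol i 0)"
        using val[OF l, of "v i"] val[OF l, of "\<lambda>_. 0"] by metis
      then show ?thesis by (simp add: pr_kpol_eq_iff del: kpol_0)
    qed
    then show "ediv m (cut r v)" by (simp add: vdvd_def cut_def)
  qed (rule fm(5))
  have "frame m r M ?\<Psi>"
    unfolding frame_def by (intro conjI allI M ran ker fm(2-4))
  then show thesis by (rule that)
qed

text \<open>Composed with \<open>\<Psi>\<close>, the action of an arrow obeys the arrow relation and
  hence lifts to a polynomial map, which no longer refers to the level.\<close>

lemma frame_presents:
  assumes fr: "frame m r M \<Psi>"
  obtains \<alpha> where "presents m r \<alpha> M \<Psi>"
proof -
  note D = frame_closed[OF fr] frame_add[OF fr] frame_vsc[OF fr] frame_kpol[OF fr] frame_idm[OF fr]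
  have "\<exists>g. g \<in> arrow_space r r (arrow_head a) (arrow_tail a) (head_exp C a) (tail_exp C a) \<and>
      (\<forall>v. \<Psi> (g v) = pr (lev m) (arrow a) \<odot>\<^bsub>M\<^esub> \<Psi> v)" if a: "a \<in> alphas C \<Omega>" for a
  proof -
    let ?i = "arrow_head a" and ?j = "arrow_tail a"
    let ?F = "\<lambda>v. pr (lev m) (arrow a) \<odot>\<^bsub>M\<^esub> \<Psi> v"
    have ar: "pr (lev m) (arrow a) \<otimes>\<^bsub>R (lev m)\<^esub> pr (lev m) (idm ?j) = pr (lev m) (arrow a)"
      using a by (simp add: idm_arrow flip: pr.hom_mult)
    have tl: "?F (vproj r ?j v) = ?F v" for v
      using a by (simp add: D M.lsmult_assoc[symmetric] ar)
    have sc: "?F (vsc s v) = H_scalar C (lev m) \<Omega> s \<odot>\<^bsub>M\<^esub> ?F v" for s v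
    proof -
      have "arrow a \<otimes> ascale s \<one> = ascale s (arrow a)"
        using a ascale_simps(8)[of s "arrow a" \<one>] by simp
      then show ?thesis using a
        by (simp add: D H_scalar_closed M.lsmult_assoc[symmetric] pr_ascale[symmetric])
          (simp add: H_scalar_eq flip: pr.hom_mult)
    qed
    have hd: "pr (lev m) (idm ?i) \<odot>\<^bsub>M\<^esub> ?F v = ?F v" for v
      using a by (simp add: D M.lsmult_assoc[symmetric] idm_arrow flip: pr.hom_mult)
    have rel: "?F (shift (\<lambda>_. tail_exp C a) (vproj r ?j v)) =
        pr (lev m) (kpol ?i (monom 1 (head_exp C a))) \<odot>\<^bsub>M\<^esub> ?F (vproj r ?j v)" for v
      unfolding tl using a pr_arrow_relation[OF a]
      by (simp add: D M.lsmult_assoc[symmetric] del: pr.hom_mult)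
    show ?thesis
      by (rule frame_lift_arrow[OF fr, of ?F ?i r ?j "tail_exp C a" "head_exp C a"])
        (use a hd sc rel tl alphas_exp_pos[OF a] in \<open>auto simp: D M.lsmult_closed M.lsmult_r_distr\<close>)
  qed
  then have "\<forall>a\<in>alphas C \<Omega>. \<exists>g. g \<in> arrow_space r r (arrow_head a) (arrow_tail a) (head_exp C a) (tail_exp C a) \<and>
      (\<forall>v. \<Psi> (g v) = pr (lev m) (arrow a) \<odot>\<^bsub>M\<^esub> \<Psi> v)" by blast
  then obtain \<alpha> where "\<forall>a\<in>alphas C \<Omega>. \<alpha> a \<in> arrow_space r r (arrow_head a) (arrow_tail a) (head_exp C a) (tail_exp C a) \<and>
      (\<forall>v. \<Psi> (\<alpha> a v) = pr (lev m) (arrow a) \<odot>\<^bsub>M\<^esub> \<Psi> v)" by metis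
  then have "presents m r \<alpha> M \<Psi>" using fr by (auto simp: presents_def reps_def)
  then show thesis by (rule that)
qed

end

end


section \<open>Models yield locally free modules of finite dimension\<close>

lemma not_monom_dvd_1: "0 < n \<Longrightarrow> \<not> monom 1 n dvd (1 :: 'k::field poly)"
  using dvd_imp_degree_le[of "monom 1 n" "1 :: 'k poly"] by (auto simp: degree_monom_eq)

context cartan_mult
begin

context
  fixes r :: "'n \<Rightarrow> nat" and M :: "(('n, 'k) KQ set, 'm) module" and \<Psi> :: "('n, 'k) pvec \<Rightarrow> 'm"
  assumes fr: "frame m r M \<Psi>"
begin

interpretation M: left_module "R (lev m)" M by (rule frame_module[OF fr])

lemma frame_vproj_finsum:
  "\<Psi> (vproj r i v) = (\<Oplus>\<^bsub>M\<^esub>l\<in>{..<r i}. pr (lev m) (kpol i (v i l)) \<odot>\<^bsub>M\<^esub> \<Psi> (vunit i l 1))"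
  unfolding frame_eq_fmap[OF fr, of "vproj r i v"]
  by (rule fmap_vproj) (simp_all add: frame_module[OF fr] frame_closed[OF fr])

lemma frame_vproj_eq_iff:
  "\<Psi> (vproj r i (\<lambda>_. p)) = \<Psi> (vproj r i (\<lambda>_. q)) \<longleftrightarrow>
   (\<forall>l<r i. pr (lev m) (kpol i (p l)) = pr (lev m) (kpol i (q l)))"
  unfolding frame_eq_iff[OF fr] pr_kpol_eq_iff
  by (auto simp: vdvd_def vproj_def cut_def)

text \<open>The converse of \<open>locally_free_frame\<close>: the images of the unit vectors form a
  basis, because the kernel of \<open>\<Psi>\<close> determines coordinates exactly modulo
  \<open>x^(m c_i)\<close>, that is, as elements of the vertex algebra.\<close>

lemma frame_finite_free: "finite_free_module (H_vertex C (lev m) \<Omega> i) (vertex_part C (lev m) \<Omega> M i)"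
proof -
  let ?V = "vertex_part C (lev m) \<Omega> M i" and ?H = "H_vertex C (lev m) \<Omega> i"
  define b where "b l = \<Psi> (vunit i l 1)" for l
  define B where "B = b ` {..<r i}"
  \<comment> \<open>A basis is a set here, so unit vectors need distinct images; they have them
    since \<open>x^(m c_i)\<close> has positive degree and does not divide 1.\<close>
  have inj: "inj_on b {..<r i}"
  proof (rule inj_onI)
    fix l l' assume l: "l \<in> {..<r i}" "b l = b l'"
    show "l = l'"
    proof (rule ccontr)
      assume "l \<noteq> l'"
      moreover have "ediv m (cut r (vunit i l 1 - vunit i l' 1 :: ('n, 'k) pvec))"
        using l by (simp add: b_def frame_eq_iff[OF fr])
      ultimately have "monom 1 (m * c i) dvd (1 :: 'k poly)"
        using l(1) by (auto simp: vdvd_def cut_def vunit_def dest!: spec[of _ i] spec[of _ l])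
      then show False using not_monom_dvd_1[of "m * c i", where 'k = 'k] by (simp add: m_pos c_pos)
    qed
  qed
  have bV: "b l \<in> carrier ?V" if "l < r i" for l
    using that frame_idm[OF fr, of i "vunit i l 1"]
    by (simp add: b_def vertex_part_carrier_iff[OF frame_module[OF fr]] frame_closed[OF fr] vproj_vunit)
  have bM: "b l \<in> carrier M" for l by (simp add: b_def frame_closed[OF fr])
  have B: "finite B" "B \<subseteq> carrier ?V" using bV by (auto simp: B_def)
  have sum_B: "(\<Oplus>\<^bsub>?V\<^esub>y\<in>B. \<rho> y \<odot>\<^bsub>?V\<^esub> y) = \<Psi> (vproj r i (\<lambda>_. p))"
    if \<rho>: "\<And>l. l < r i \<Longrightarrow> \<rho> (b l) = pr (lev m) (kpol i (p l))" for \<rho> p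
  proof -
    have c: "\<rho> y \<odot>\<^bsub>?V\<^esub> y \<in> carrier ?V" if "y \<in> B" for y
      using left_module.lsmult_closed[OF left_module_vertex_part[OF frame_module[OF fr]], of "\<rho> y" i y]
        that \<rho> B(2)
      by (auto simp: B_def H_vertex_simps bV)
    have "(\<Oplus>\<^bsub>?V\<^esub>y\<in>B. \<rho> y \<odot>\<^bsub>?V\<^esub> y) = (\<Oplus>\<^bsub>M\<^esub>y\<in>B. \<rho> y \<odot>\<^bsub>?V\<^esub> y)"
      using c by (intro finsum_vertex_part[OF frame_module[OF fr]]) auto
    also have "\<dots> = (\<Oplus>\<^bsub>M\<^esub>l\<in>{..<r i}. \<rho> (b l) \<odot>\<^bsub>M\<^esub> b l)"
      unfolding B_def vertex_part_simps(4) using inj \<rho>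
      by (intro M.M.finsum_reindex) (auto simp: bM M.lsmult_closed)
    also have "\<dots> = \<Psi> (vproj r i (\<lambda>_. p))"
      unfolding frame_vproj_finsum
      by (rule M.M.finsum_cong') (auto simp: \<rho> bM M.lsmult_closed b_def[symmetric])
    finally show ?thesis .
  qed
  have uniq: "\<exists>!\<rho>. \<rho> \<in> B \<rightarrow>\<^sub>E carrier ?H \<and> x = (\<Oplus>\<^bsub>?V\<^esub>y\<in>B. \<rho> y \<odot>\<^bsub>?V\<^esub> y)" if x: "x \<in> carrier ?V" for x
  proof (rule ex_ex1I)
    obtain y where y: "y \<in> carrier M" "x = pr (lev m) (idm i) \<odot>\<^bsub>M\<^esub> y" using x by (auto simp: vertex_part_simps)
    obtain v where "y = \<Psi> v" using y(1) frame_range[OF fr] by blast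
    then have v: "x = \<Psi> (vproj r i (\<lambda>_. v i))"
      using y(2) by (simp add: frame_idm[OF fr, symmetric] frame_vproj_finsum)
    define \<rho> where "\<rho> = (\<lambda>y\<in>B. pr (lev m) (kpol i (v i (inv_into {..<r i} b y))))"
    have "\<rho> \<in> B \<rightarrow>\<^sub>E carrier ?H" by (auto simp: \<rho>_def H_vertex_simps)
    moreover have "x = (\<Oplus>\<^bsub>?V\<^esub>y\<in>B. \<rho> y \<odot>\<^bsub>?V\<^esub> y)"
      unfolding v by (rule sum_B[symmetric]) (use inj in \<open>simp add: \<rho>_def B_def\<close>)
    ultimately show "\<exists>\<rho>. \<rho> \<in> B \<rightarrow>\<^sub>E carrier ?H \<and> x = (\<Oplus>\<^bsub>?V\<^esub>y\<in>B. \<rho> y \<odot>\<^bsub>?V\<^esub> y)" by blast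
  next
    fix \<rho> \<rho>' assume a: "\<rho> \<in> B \<rightarrow>\<^sub>E carrier ?H \<and> x = (\<Oplus>\<^bsub>?V\<^esub>y\<in>B. \<rho> y \<odot>\<^bsub>?V\<^esub> y)"
      and a': "\<rho>' \<in> B \<rightarrow>\<^sub>E carrier ?H \<and> x = (\<Oplus>\<^bsub>?V\<^esub>y\<in>B. \<rho>' y \<odot>\<^bsub>?V\<^esub> y)"
    have bB: "b l \<in> B" if "l < r i" for l using that by (auto simp: B_def)
    have "\<forall>l. \<exists>p. l < r i \<longrightarrow> \<rho> (b l) = pr (lev m) (kpol i p)"
      using PiE_mem[OF conjunct1[OF a] bB] by (auto simp: H_vertex_simps)
    then obtain p where p: "\<And>l. l < r i \<Longrightarrow> \<rho> (b l) = pr (lev m) (kpol i (p l))" by metis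
    have "\<forall>l. \<exists>p. l < r i \<longrightarrow> \<rho>' (b l) = pr (lev m) (kpol i p)"
      using PiE_mem[OF conjunct1[OF a'] bB] by (auto simp: H_vertex_simps)
    then obtain q where q: "\<And>l. l < r i \<Longrightarrow> \<rho>' (b l) = pr (lev m) (kpol i (q l))" by metis
    have "\<Psi> (vproj r i (\<lambda>_. p)) = \<Psi> (vproj r i (\<lambda>_. q))"
      using conjunct2[OF a] conjunct2[OF a'] sum_B[of \<rho> p, OF p] sum_B[of \<rho>' q, OF q] by simp
    then have "\<rho> (b l) = \<rho>' (b l)" if "l < r i" for l
      using that by (simp add: frame_vproj_eq_iff p q)
    then have "\<rho> y = \<rho>' y" if "y \<in> B" for y using that by (auto simp: B_def)
    then show "\<rho> = \<rho>'" by (rule PiE_ext[OF conjunct1[OF a] conjunct1[OF a']])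
  qed
  show ?thesis
    unfolding finite_free_module_def
    by (intro conjI exI[of _ B] ballI B uniq left_module_vertex_part[OF frame_module[OF fr]])
qed

lemma frame_locally_free: "locally_free C (lev m) \<Omega> M"
  by (simp add: locally_free_def frame_finite_free)

text \<open>A vector and its remainder modulo \<epsilon>^m have the same image, so the images of the
  monomials \<open>x^s\<close> with \<open>s < m c_i\<close> span; there are finitely many.\<close>

lemma frame_finite_dimensional: "finite_dimensional (H_scalar C (lev m) \<Omega>) M"
proof -
  let ?\<kappa> = "H_scalar C (lev m) \<Omega>"
  define B where "B = (\<lambda>((i, l), s). \<Psi> (vunit i l (monom 1 s))) ` (SIGMA x:coords r. {..m * c (fst x) - 1})"
  have B: "finite B" "B \<subseteq> carrier M" by (auto simp: B_def finite_coords frame_closed[OF fr])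
  have \<kappa>_add: "?\<kappa> (a + a') = ?\<kappa> a \<oplus>\<^bsub>R (lev m)\<^esub> ?\<kappa> a'" for a a' by (simp add: H_scalar_eq ascale_simps)
  have \<kappa>_0: "?\<kappa> 0 = \<zero>\<^bsub>R (lev m)\<^esub>" by (simp add: H_scalar_eq ascale_simps)
  define S where "S = {x. \<exists>a. x = (\<Oplus>\<^bsub>M\<^esub>y\<in>B. ?\<kappa> (a y) \<odot>\<^bsub>M\<^esub> y)}"
  have closed: "(\<lambda>y. ?\<kappa> (a y) \<odot>\<^bsub>M\<^esub> y) \<in> B \<rightarrow> carrier M" for a using B by (auto simp: M.lsmult_closed H_scalar_closed)
  have S_add: "x \<oplus>\<^bsub>M\<^esub> x' \<in> S" if "x \<in> S" "x' \<in> S" for x x'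
  proof -
    obtain a a' where x: "x = (\<Oplus>\<^bsub>M\<^esub>y\<in>B. ?\<kappa> (a y) \<odot>\<^bsub>M\<^esub> y)" and x': "x' = (\<Oplus>\<^bsub>M\<^esub>y\<in>B. ?\<kappa> (a' y) \<odot>\<^bsub>M\<^esub> y)"
      using \<open>x \<in> S\<close> \<open>x' \<in> S\<close> by (auto simp: S_def)
    have "x \<oplus>\<^bsub>M\<^esub> x' = (\<Oplus>\<^bsub>M\<^esub>y\<in>B. ?\<kappa> (a y) \<odot>\<^bsub>M\<^esub> y \<oplus>\<^bsub>M\<^esub> ?\<kappa> (a' y) \<odot>\<^bsub>M\<^esub> y)"
      unfolding x x' by (rule M.M.finsum_addf[OF closed closed, symmetric])
    also have "\<dots> = (\<Oplus>\<^bsub>M\<^esub>y\<in>B. ?\<kappa> (a y + a' y) \<odot>\<^bsub>M\<^esub> y)"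
      using B(2) by (intro M.M.finsum_cong') (auto simp: \<kappa>_add M.lsmult_l_distr H_scalar_closed M.lsmult_closed)
    finally show ?thesis unfolding S_def by (intro CollectI exI[of _ "\<lambda>y. a y + a' y"])
  qed
  have S_gen: "?\<kappa> a \<odot>\<^bsub>M\<^esub> y \<in> S" if y: "y \<in> B" for a y
  proof -
    have yM: "y \<in> carrier M" using B(2) y by blast
    have "(\<Oplus>\<^bsub>M\<^esub>z\<in>B. ?\<kappa> (if y = z then a else 0) \<odot>\<^bsub>M\<^esub> z) = (\<Oplus>\<^bsub>M\<^esub>z\<in>B. if y = z then ?\<kappa> a \<odot>\<^bsub>M\<^esub> z else \<zero>\<^bsub>M\<^esub>)"
      using B(2) by (intro M.M.finsum_cong') (auto simp: \<kappa>_0 M.smult_zero_left M.lsmult_closed H_scalar_closed)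
    also have "\<dots> = ?\<kappa> a \<odot>\<^bsub>M\<^esub> y"
      using M.M.finsum_singleton[OF y B(1), of "\<lambda>z. ?\<kappa> a \<odot>\<^bsub>M\<^esub> z"] closed[of "\<lambda>_. a"] by simp
    finally show ?thesis unfolding S_def by (auto intro!: exI[of _ "\<lambda>z. if y = z then a else 0"])
  qed
  have S_0: "\<zero>\<^bsub>M\<^esub> \<in> S"
  proof -
    have "(\<Oplus>\<^bsub>M\<^esub>z\<in>B. ?\<kappa> 0 \<odot>\<^bsub>M\<^esub> z) = (\<Oplus>\<^bsub>M\<^esub>z\<in>B. \<zero>\<^bsub>M\<^esub>)"
      using B(2) by (intro M.M.finsum_cong') (auto simp: \<kappa>_0 M.smult_zero_left)
    then show ?thesis unfolding S_def by (auto intro!: exI[of _ "\<lambda>_. 0"])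
  qed
  have S_sum: "\<Psi> (\<Sum>x\<in>I. g x) \<in> S" if "\<And>x. x \<in> I \<Longrightarrow> \<Psi> (g x) \<in> S" for g and I :: "'x set"
    using that by (induction I rule: infinite_finite_induct)
      (simp_all add: frame_0[OF fr] frame_add[OF fr] S_0 S_add del: zero_fun_apply plus_fun_apply)
  have "\<Psi> v \<in> S" for v
  proof -
    have "\<Psi> (trunc m r v) \<in> S"
    proof -
      have "\<Psi> (vunit i l (trunc m r v i l)) \<in> S" if il: "(i, l) \<in> coords r" for i l
      proof -
        let ?q = "trunc m r v i l"
        have deg: "degree ?q \<le> m * c i - 1"
          using degree_mod_less'[of "monom 1 (m * c i)" "v i l"]
          by (cases "?q = 0") (auto simp: trunc_def degree_monom_eq monom_eq_0_iff split: if_splits)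
        have e: "vunit i l ?q = (\<Sum>s\<le>m * c i - 1. vsc (coeff ?q s) (vunit i l (monom 1 s)))"
        proof -
          have "(\<Sum>s\<le>m * c i - 1. vsc (coeff ?q s) (vunit i l (monom 1 s)))
            = vunit i l (\<Sum>s\<le>m * c i - 1. monom (coeff ?q s) s)"
            by (auto simp: fun_eq_iff sum_fun_apply dmul_def vunit_def smult_monom)
          then show ?thesis by (simp add: poly_as_sum_of_monoms'[OF deg] del: One_nat_def)
        qed
        have "\<Psi> (vsc a (vunit i l (monom 1 s))) \<in> S" if "s \<le> m * c i - 1" for a s
          unfolding frame_vsc[OF fr] using il that
          by (intro S_gen) (auto simp: B_def intro!: image_eqI[of _ _ "((i, l), s)"])
        then show ?thesis by (subst e) (rule S_sum, simp)
      qed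
      then have "\<Psi> (\<Sum>(i, l)\<in>coords r. vunit i l (trunc m r v i l)) \<in> S"
        by (intro S_sum) auto
      then show ?thesis by (simp add: cut_eq_sum_vunit[symmetric] cut_trunc)
    qed
    moreover have "trunc m r (trunc m r v - v) = 0" by (simp add: trunc_diff trunc_trunc)
    then have "\<Psi> (trunc m r v) = \<Psi> v" by (simp add: frame_eq_iff[OF fr] trunc_eq_0_iff)
    ultimately show ?thesis by simp
  qed
  then have "\<forall>x\<in>carrier M. \<exists>a. x = (\<Oplus>\<^bsub>M\<^esub>y\<in>B. ?\<kappa> (a y) \<odot>\<^bsub>M\<^esub> y)"
    unfolding frame_range[OF fr, symmetric] S_def by blast
  then show ?thesis unfolding finite_dimensional_def using B by blast
qed

lemma frame_H_module: "H_module C (lev m) \<Omega> M"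
  by (simp add: H_module_def frame_module[OF fr] frame_finite_dimensional)

end

text \<open>The coefficients of a polynomial vector are indexed by vertex, coordinate and degree.
  Encoding these triples as natural numbers injects the model into the element type of
  \<open>Hmod\<close>.\<close>

lemma presents_exists:
  assumes \<alpha>: "\<alpha> \<in> reps r r"
  shows "\<exists>(N :: ('n, 'k) Hmod) \<Psi>. presents m r \<alpha> N \<Psi>"
proof -
  obtain e :: "'n \<Rightarrow> nat" where e: "inj e"
    using finite_imp_inj_to_nat_seg[OF finite] by blast
  define F :: "('n, 'k) pvec \<Rightarrow> nat \<Rightarrow> 'k" where
    "F v t = (case prod_decode t of (a, u) \<Rightarrow> case prod_decode u of (l, s) \<Rightarrow> coeff (v (inv_into UNIV e a) l) s)" for v t
  have "inj F"
  proof (rule injI, intro ext poly_eqI)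
    fix v w i l s assume "F v = F w"
    then have "F v (prod_encode (e i, prod_encode (l, s))) = F w (prod_encode (e i, prod_encode (l, s)))" by simp
    then show "coeff (v i l) s = coeff (w i l) s" by (simp add: F_def e)
  qed
  then have inj: "inj_on F X" for X by (rule inj_on_subset) simp
  note P = presents_vmod[OF \<alpha>]
  have M: "left_module (R (lev m)) (vmod m r \<alpha>)" using P frame_module by (auto simp: presents_def)
  show ?thesis using presents_transfer[OF P transported[OF M inj]] by blast
qed

end


section \<open>Rigidity in terms of cocycles\<close>

definition psc :: "'k::field \<Rightarrow> ('n, 'k) pvec \<times> ('n, 'k) pvec \<Rightarrow> ('n, 'k) pvec \<times> ('n, 'k) pvec" where
  "psc a x = (vsc a (fst x), vsc a (snd x))"

definition pproj :: "('n \<Rightarrow> nat) \<Rightarrow> 'n \<Rightarrow> ('n, 'k::field) pvec \<times> ('n, 'k) pvec \<Rightarrow> ('n, 'k) pvec \<times> ('n, 'k) pvec" where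
  "pproj r i x = (vproj r i (fst x), vproj r i (snd x))"

text \<open>The block triangular action with \<alpha> on the diagonal and \<gamma> in the corner.
  The loops act diagonally, matching the fact that extensions split over the loops.\<close>

fun twist where
  "twist r \<alpha> \<gamma> (Eps i) x = (shift (\<lambda>_. 1) (vproj r i (fst x)), shift (\<lambda>_. 1) (vproj r i (snd x)))"
| "twist r \<alpha> \<gamma> (Alpha i j g) x =
    (\<alpha> (Alpha i j g) (fst x) + \<gamma> (Alpha i j g) (snd x), \<alpha> (Alpha i j g) (snd x))"

lemma vector_space_psc: "vector_space (psc :: 'k::field \<Rightarrow> ('n, 'k) pvec \<times> ('n, 'k) pvec \<Rightarrow> _)"
proof -
  interpret vector_space "vsc :: 'k \<Rightarrow> ('n, 'k) pvec \<Rightarrow> _" by (rule vector_space_pvec)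
  show ?thesis
    by unfold_locales (simp_all add: psc_def prod_eq_iff scale_right_distrib scale_left_distrib del: plus_fun_apply)
qed

lemma (in abelian_group) minus_swap:
  assumes "a \<in> carrier G" "b \<in> carrier G" "x \<in> carrier G" "y \<in> carrier G" "a \<ominus> b = x \<ominus> y"
  shows "b \<ominus> y = a \<ominus> x"
proof -
  have "a = (x \<ominus> y) \<oplus> b" using assms by (simp flip: assms(5)) (simp add: a_minus_def a_assoc l_neg)
  also have "\<dots> = x \<oplus> (b \<ominus> y)" using assms(1-4) by (simp add: a_minus_def a_ac)
  finally have "a \<ominus> x = \<ominus> x \<oplus> (x \<oplus> (b \<ominus> y))" using assms(1-4) by (simp add: a_minus_def a_comm)
  then show ?thesis using assms(1-4) by (simp add: r_neg1)
qed

context cartan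
begin

lemma trunc_arrow:
  assumes "\<gamma> \<in> reps r r'" "a \<in> alphas C \<Omega>" "trunc m r v = 0"
  shows "trunc m r' (\<gamma> a v) = 0"
proof -
  have "\<gamma> a v = \<gamma> a (cut r v)" by (metis arrow_spaceD(2)[OF repsD[OF assms(1,2)]] vproj_cut)
  then show ?thesis using assms reps_ediv[OF assms(1,2)] by (simp add: trunc_eq_0_iff vdvd_cut)
qed

lemma twist_alphas:
  "a \<in> alphas C \<Omega> \<Longrightarrow> twist r \<alpha> \<gamma> a x = (\<alpha> a (fst x) + \<gamma> a (snd x), \<alpha> a (snd x))"
  by (auto simp: alphas_def)

lemma quiver_rep_twist:
  assumes \<alpha>: "\<alpha> \<in> reps r r" and \<gamma>: "\<gamma> \<in> reps r r"
  shows "quiver_rep (quiver C \<Omega>) A psc (pproj r) (twist r \<alpha> \<gamma>)"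
proof -
  interpret vector_space "psc :: 'k \<Rightarrow> ('n, 'k) pvec \<times> ('n, 'k) pvec \<Rightarrow> _" by (rule vector_space_psc)
  note D = arrow_spaceD[OF repsD[OF \<alpha>]] klinearD[OF repsD_linear[OF \<alpha>]]
  note D' = arrow_spaceD[OF repsD[OF \<gamma>]] klinearD[OF repsD_linear[OF \<gamma>]]
  show ?thesis
  proof unfold_locales
    fix a x y and s :: 'k assume "a \<in> arcs (quiver C \<Omega>)"
    then show "twist r \<alpha> \<gamma> a (x + y) = twist r \<alpha> \<gamma> a x + twist r \<alpha> \<gamma> a y"
      "twist r \<alpha> \<gamma> a (psc s x) = psc s (twist r \<alpha> \<gamma> a x)"
      "pproj r (head (quiver C \<Omega>) a) (twist r \<alpha> \<gamma> a x) = twist r \<alpha> \<gamma> a x"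
      "twist r \<alpha> \<gamma> a (pproj r (tail (quiver C \<Omega>) a) x) = twist r \<alpha> \<gamma> a x"
      by (auto simp: arcs_quiver twist_alphas D D' vproj_add dmul_add dmul_vproj vproj_vproj psc_def pproj_def
          prod_eq_iff dmul_commute[of _ "\<lambda>_. [:s:]"] add_ac simp del: plus_fun_apply)
  qed (auto simp: vproj_add dmul_vproj vproj_vproj psc_def pproj_def prod_eq_iff vproj_0 simp del: plus_fun_apply zero_fun_apply)
qed

end

context cartan_mult
begin

text \<open>The extension attached to a cocycle, built on pairs of polynomial vectors and then read
  modulo \<epsilon>^m. The equations record all that is used to evaluate a section of it.\<close>

lemma twisted_extension:
  assumes M: "presents m r \<alpha> M \<Psi>" and \<gamma>: "\<gamma> \<in> reps r r"
  obtains E where "(\<lambda>x. (x, \<zero>\<^bsub>M\<^esub>), E, snd) \<in> extensions (R (lev m)) M M" "carrier E = carrier M \<times> carrier M"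
    "\<And>v w v' w'. (\<Psi> v, \<Psi> w) \<oplus>\<^bsub>E\<^esub> (\<Psi> v', \<Psi> w') = (\<Psi> (v + v'), \<Psi> (w + w'))"
    "\<And>i p v w. pr (lev m) (kpol i p) \<odot>\<^bsub>E\<^esub> (\<Psi> v, \<Psi> w) = (\<Psi> (dmul (\<lambda>_. p) (vproj r i v)), \<Psi> (dmul (\<lambda>_. p) (vproj r i w)))"
    "\<And>s v w. H_scalar C (lev m) \<Omega> s \<odot>\<^bsub>E\<^esub> (\<Psi> v, \<Psi> w) = (\<Psi> (vsc s v), \<Psi> (vsc s w))"
    "\<And>a v w. a \<in> alphas C \<Omega> \<Longrightarrow> pr (lev m) (arrow a) \<odot>\<^bsub>E\<^esub> (\<Psi> v, \<Psi> w) = (\<Psi> (\<alpha> a v + \<gamma> a w), \<Psi> (\<alpha> a w))"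
proof -
  have fr: "frame m r M \<Psi>" and \<alpha>: "\<alpha> \<in> reps r r" using M by (auto simp: presents_def)
  interpret M: left_module "R (lev m)" M by (rule frame_module[OF fr])
  define \<pi> where "\<pi> x = (trunc m r (fst x), trunc m r (snd x))" for x
  interpret V: quiver_rep "quiver C \<Omega>" A psc "pproj r" "twist r \<alpha> \<gamma>" by (rule quiver_rep_twist[OF \<alpha> \<gamma>])
  have act_eps: "V.act (arrow (Eps i)) x = twist r \<alpha> \<gamma> (Eps i) x" for i x by (simp add: V.act_arc arcs_quiver)
  have act_arrow: "V.act (arrow a) x = (\<alpha> a (fst x) + \<gamma> a (snd x), \<alpha> a (snd x))" if "a \<in> alphas C \<Omega>" for a x
    using that by (simp add: V.act_arc arcs_quiver twist_alphas del: plus_fun_apply)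
  have act_kpol: "V.act (kpol i p) x = (dmul (\<lambda>_. p) (vproj r i (fst x)), dmul (\<lambda>_. p) (vproj r i (snd x)))" for i p x
  proof (induction p)
    case 0
    then show ?case by (simp add: V.act_zero dmul_zero prod_eq_iff del: zero_fun_apply)
  next
    case (pCons a p)
    have split: "dmul (\<lambda>_. pCons a p) (vproj r i w)
      = vsc a (vproj r i w) + shift (\<lambda>_. 1) (vproj r i (dmul (\<lambda>_. p) (vproj r i w)))" for w :: "('n, 'k) pvec"
      by (auto simp: fun_eq_iff dmul_def vproj_def monom_altdef)
    have step: "psc a (pproj r i x) + twist r \<alpha> \<gamma> (Eps i) y = (vsc a (vproj r i (fst x)) + shift (\<lambda>_. 1) (vproj r i (fst y)),
        vsc a (vproj r i (snd x)) + shift (\<lambda>_. 1) (vproj r i (snd y)))" for y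
      by (simp add: psc_def pproj_def)
    have "V.act (kpol i (pCons a p)) x = psc a (pproj r i x) + twist r \<alpha> \<gamma> (Eps i) (V.act (kpol i p) x)"
      unfolding kpol_pCons ascale_def
      by (simp only: V.act_add V.act_scale V.act_mult PA_scale_closed idm_closed kpol_closed
          arrow_closed PA_mult_closed V.act_idem act_eps)
    also have "\<dots> = (vsc a (vproj r i (fst x)) + shift (\<lambda>_. 1) (vproj r i (fst (V.act (kpol i p) x))),
        vsc a (vproj r i (snd x)) + shift (\<lambda>_. 1) (vproj r i (snd (V.act (kpol i p) x))))"
      by (rule step)
    finally show ?case unfolding pCons split fst_conv snd_conv .
  qed
  have act_one: "V.act \<one> x = (cut r (fst x), cut r (snd x))" for x
  proof -
    have "(\<Sum>i\<in>I. pproj r i x) = (\<Sum>i\<in>I. vproj r i (fst x), \<Sum>i\<in>I. vproj r i (snd x))" for I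
      by (induction I rule: infinite_finite_induct) (simp_all add: pproj_def prod_eq_iff del: plus_fun_apply zero_fun_apply)
    then show ?thesis by (simp add: V.act_one sum_vproj)
  qed
  interpret E0: rep_module C c \<Omega> A "lev m" psc "pproj r" "twist r \<alpha> \<gamma>" \<pi>
  proof unfold_locales
    show "\<pi> (\<Sum>u\<in>UNIV. pproj r u x) = \<pi> x" for x
    proof -
      have "(\<Sum>u\<in>UNIV. pproj r u x) = (cut r (fst x), cut r (snd x))"
        using V.act_one[of x] by (simp add: act_one)
      then show ?thesis by (simp add: \<pi>_def trunc_cut)
    qed
    have ker: "\<pi> x = 0 \<longleftrightarrow> trunc m r (fst x) = 0 \<and> trunc m r (snd x) = 0" for x
      by (simp add: \<pi>_def prod_eq_iff)
    have ker_dmul: "trunc m r (dmul p (vproj r i v)) = 0" if "trunc m r v = 0" for p i v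
    proof -
      have "ediv m (dmul p (vproj r i (cut r v)))" using that by (intro vdvd_dmul vdvd_vproj) (simp add: trunc_eq_0_iff)
      then show ?thesis by (simp add: trunc_eq_0_iff vproj_cut dmul_cut[symmetric] cut_vproj)
    qed
    show "\<pi> (pproj r u x) = 0" if "\<pi> x = 0" for u x
      using that ker_dmul[of _ "\<lambda>_. 1" u] by (simp add: ker pproj_def dmul_1)
    show "\<pi> (twist r \<alpha> \<gamma> a x) = 0" if "a \<in> arcs (quiver C \<Omega>)" "\<pi> x = 0" for a x
      using that trunc_arrow[OF \<alpha>] trunc_arrow[OF \<gamma>] ker_dmul
      by (auto simp: arcs_quiver ker twist_alphas trunc_add simp del: plus_fun_apply)
    show "\<pi> (V.act \<rho> x) = 0" if "\<rho> \<in> relations C (lev m) \<Omega>" for \<rho> x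
      using that unfolding relations_eq[of "lev m", OF d_pos]
    proof
      assume "\<rho> \<in> {kpol i (monom 1 (m * c i)) | i. True}"
      then obtain i where \<rho>: "\<rho> = kpol i (monom 1 (m * c i))" by auto
      have "trunc m r (dmul (\<lambda>_. monom 1 (m * c i)) (vproj r i v)) = 0" for v
      proof -
        have "dmul (\<lambda>_. monom 1 (m * c i)) (vproj r i v) = shift (lev m) (vproj r i v)"
          by (rule dmul_vproj_const[symmetric])
        moreover have "ediv m (shift (lev m) (vproj r i v))" unfolding vdvd_iff_shift by blast
        ultimately show ?thesis by (simp add: trunc_eq_0_iff vdvd_cut)
      qed
      then show ?thesis by (simp add: ker \<rho> act_kpol)
    next
      assume "\<rho> \<in> {(kpol (arrow_head a) (monom 1 (head_exp C a)) \<otimes> arrow a) \<ominus>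
         (arrow a \<otimes> kpol (arrow_tail a) (monom 1 (tail_exp C a))) | a. a \<in> alphas C \<Omega>}"
      then obtain a where a: "a \<in> alphas C \<Omega>" and \<rho>: "\<rho> = (kpol (arrow_head a) (monom 1 (head_exp C a)) \<otimes> arrow a) \<ominus>
         (arrow a \<otimes> kpol (arrow_tail a) (monom 1 (tail_exp C a)))" (is "_ = ?x \<ominus> ?y") by auto
      have xy: "?x \<in> carrier A" "?y \<in> carrier A" using a by simp_all
      \<comment> \<open>Entry by entry, this is the arrow relation for \<open>\<alpha>\<close> and
        for \<open>\<gamma>\<close>.\<close>
      have "V.act ?x x = V.act ?y x"
        using a arrow_spaceD[OF repsD[OF \<alpha> a]] arrow_spaceD[OF repsD[OF \<gamma> a]]
        by (simp add: V.act_mult act_arrow act_kpol vproj_add dmul_add del: plus_fun_apply)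
      moreover have "V.act (\<rho> \<oplus> ?y) x = V.act \<rho> x + V.act ?y x"
        using xy unfolding \<rho> by (intro V.act_add) auto
      moreover have "\<rho> \<oplus> ?y = ?x" using xy unfolding \<rho> by (simp add: a_minus_def PA.add.m_assoc PA.l_neg)
      ultimately have "V.act \<rho> x = 0" by simp
      then show ?thesis by (simp add: ker trunc_0 del: zero_fun_apply)
    qed
  qed (simp_all add: \<pi>_def psc_def trunc_add trunc_vsc trunc_trunc del: plus_fun_apply)
  \<comment> \<open>Applying \<open>\<Psi>\<close> to both components moves the module onto
    \<open>M \<times> M\<close>, the element type that \<open>extensions\<close> prescribes.\<close>
  define F where "F x = (\<Psi> (fst x), \<Psi> (snd x))" for x
  have \<Psi>_trunc: "\<Psi> (trunc m r v) = \<Psi> v" for v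
  proof -
    have "trunc m r (trunc m r v - v) = 0" by (simp add: trunc_diff trunc_trunc)
    then show ?thesis by (simp add: frame_eq_iff[OF fr] trunc_eq_0_iff)
  qed
  have F\<pi>: "F (\<pi> x) = (\<Psi> (fst x), \<Psi> (snd x))" for x by (simp add: F_def \<pi>_def \<Psi>_trunc)
  have eq: "trunc m r v = trunc m r w" if "\<Psi> v = \<Psi> w" for v w
  proof -
    have "trunc m r (v - w) = 0" using that by (simp add: frame_eq_iff[OF fr] trunc_eq_0_iff)
    then show ?thesis by (simp add: trunc_diff)
  qed
  have inj: "inj_on F (range \<pi>)"
  proof (rule inj_onI, elim rangeE)
    fix x y v w assume "F x = F y" "x = \<pi> v" "y = \<pi> w"
    then show "x = y" by (simp add: F\<pi>) (simp add: \<pi>_def eq[of "fst v" "fst w"] eq[of "snd v" "snd w"])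
  qed
  define E where "E = transported E0.rep_mod F"
  have T: "left_module (R (lev m)) E" "F \<in> lmod_hom (R (lev m)) E0.rep_mod E"
    "bij_betw F (range \<pi>) (carrier E)"
    using transported[OF E0.left_module_rep_mod, of F] inj by (simp_all add: E_def)
  have carE: "carrier E = carrier M \<times> carrier M"
  proof -
    have "carrier E = F ` range \<pi>" using T(3) by (simp add: bij_betw_def)
    also have "\<dots> = range \<Psi> \<times> range \<Psi>"
    proof (intro equalityI subsetI)
      fix x assume "x \<in> range \<Psi> \<times> range \<Psi>"
      then obtain v w where "x = (\<Psi> v, \<Psi> w)" by auto
      then have "x = F (\<pi> (v, w))" by (simp add: F\<pi>)
      then show "x \<in> F ` range \<pi>" by blast
    qed (auto simp: F\<pi>)
    finally show ?thesis by (simp add: frame_range[OF fr])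
  qed
  have addE: "(\<Psi> v, \<Psi> w) \<oplus>\<^bsub>E\<^esub> (\<Psi> v', \<Psi> w') = (\<Psi> (v + v'), \<Psi> (w + w'))" for v w v' w'
  proof -
    have "F (\<pi> (v, w) \<oplus>\<^bsub>E0.rep_mod\<^esub> \<pi> (v', w')) = F (\<pi> (v, w)) \<oplus>\<^bsub>E\<^esub> F (\<pi> (v', w'))"
      by (rule lmod_homD(2)[OF T(2)]) simp_all
    moreover have "\<pi> (v, w) \<oplus>\<^bsub>E0.rep_mod\<^esub> \<pi> (v', w') = \<pi> (v + v', w + w')"
      by (simp add: \<pi>_def trunc_add del: plus_fun_apply)
    ultimately show ?thesis by (simp only: F\<pi> fst_conv snd_conv)
  qed
  have act: "pr (lev m) a \<odot>\<^bsub>E\<^esub> (\<Psi> v, \<Psi> w) = (\<Psi> (fst (V.act a (v, w))), \<Psi> (snd (V.act a (v, w))))"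
    if a: "a \<in> carrier A" for a v w
  proof -
    have "F (pr (lev m) a \<odot>\<^bsub>E0.rep_mod\<^esub> \<pi> (v, w)) = pr (lev m) a \<odot>\<^bsub>E\<^esub> F (\<pi> (v, w))"
      using a by (intro lmod_homD(3)[OF T(2)]) simp_all
    moreover have "pr (lev m) a \<odot>\<^bsub>E0.rep_mod\<^esub> \<pi> (v, w) = \<pi> (V.act a (v, w))"
      using a by (simp only: E0.rep_mod_smult E0.\<pi>_act_\<pi>)
    ultimately show ?thesis by (simp only: F\<pi> fst_conv snd_conv)
  qed
  have pair_action: "is_action UNIV (+) 0 psc V.act"
    unfolding is_action_def by (auto simp: V.act_zero V.act_scale V.act_mult V.act_add)
  \<comment> \<open>The second component never sees the corner entry \<open>\<gamma>\<close>; this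
    makes \<open>snd\<close> a homomorphism.\<close>
  have act_snd: "snd (V.act a x) = vact r \<alpha> a (snd x)" if "a \<in> carrier A" for a x
  proof (rule is_action_intertwine[OF pair_action vact_is_action[OF \<alpha>] _ _ _ _ _ _ that])
    show "snd (V.act (arrow b) x) = vact r \<alpha> (arrow b) (snd x)" if "b \<in> arcs (quiver C \<Omega>)" for b x
      using that by (auto simp: arcs_quiver act_arrow act_eps vact_simps[OF \<alpha>])
  qed (simp_all add: psc_def V.act_idem vact_simps[OF \<alpha>] pproj_def del: plus_fun_apply zero_fun_apply)
  \<comment> \<open>The corner entry acts on the second component only, so the first summand is a
    submodule.\<close>
  have act_fst: "(vact r \<alpha> a v, 0) = V.act a (v, 0)" if "a \<in> carrier A" for a v
  proof (rule is_action_intertwine[OF vact_is_action[OF \<alpha>] pair_action, where F = "\<lambda>v. (v, 0)", OF _ _ _ _ _ _ that])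
    show "(vact r \<alpha> (arrow b) v, 0) = V.act (arrow b) (v, 0)" if "b \<in> arcs (quiver C \<Omega>)" for b v
      using that klinearD[OF repsD_linear[OF \<alpha>]] klinearD[OF repsD_linear[OF \<gamma>]]
      by (auto simp: arcs_quiver act_arrow act_eps vact_simps[OF \<alpha>] vproj_0 dmul_0 simp del: zero_fun_apply)
    show "(x + y, 0) = (x, 0) + (y, 0 :: ('n, 'k) pvec)" for x y :: "('n, 'k) pvec"
      by (simp add: prod_eq_iff del: plus_fun_apply zero_fun_apply)
    show "(vsc a x, 0) = psc a (x, 0)" for a and x :: "('n, 'k) pvec"
      by (simp add: psc_def dmul_0 del: zero_fun_apply)
    show "(0, 0) = (0 :: ('n, 'k) pvec \<times> ('n, 'k) pvec)"
      by (simp add: prod_eq_iff del: zero_fun_apply)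
    show "(vact r \<alpha> (idm u) x, 0) = V.act (idm u) (x, 0)" for u x
      by (simp add: V.act_idem vact_simps[OF \<alpha>] pproj_def vproj_0 del: zero_fun_apply)
  qed auto
  have f: "(\<lambda>x. (x, \<zero>\<^bsub>M\<^esub>)) \<in> lmod_hom (R (lev m)) M E"
    unfolding lmod_hom_def mem_Collect_eq
  proof (intro conjI ballI)
    show "(\<lambda>x. (x, \<zero>\<^bsub>M\<^esub>)) \<in> carrier M \<rightarrow> carrier E" by (simp add: carE)
    fix x assume "x \<in> carrier M"
    then obtain v where x: "x = \<Psi> v" using frame_range[OF fr] by blast
    show "(x \<oplus>\<^bsub>M\<^esub> y, \<zero>\<^bsub>M\<^esub>) = (x, \<zero>\<^bsub>M\<^esub>) \<oplus>\<^bsub>E\<^esub> (y, \<zero>\<^bsub>M\<^esub>)" if "y \<in> carrier M" for y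
    proof -
      obtain w where y: "y = \<Psi> w" using \<open>y \<in> carrier M\<close> frame_range[OF fr] by blast
      show ?thesis using addE[of v 0 w 0] by (simp add: x y frame_0[OF fr] frame_add[OF fr])
    qed
    fix a assume "a \<in> carrier (R (lev m))"
    then obtain b where b: "b \<in> carrier A" "a = pr (lev m) b" using pr_surj by blast
    show "(a \<odot>\<^bsub>M\<^esub> x, \<zero>\<^bsub>M\<^esub>) = a \<odot>\<^bsub>E\<^esub> (x, \<zero>\<^bsub>M\<^esub>)"
      using act[OF b(1), of v 0] act_fst[OF b(1), of v, symmetric] presents_act[OF fr M b(1), of v]
      by (simp add: b(2) x frame_0[OF fr])
  qed
  have g: "snd \<in> lmod_hom (R (lev m)) E M"
    unfolding lmod_hom_def mem_Collect_eq
  proof (intro conjI ballI)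
    show "snd \<in> carrier E \<rightarrow> carrier M" by (auto simp: carE)
    have pair: "\<exists>v w. x = (\<Psi> v, \<Psi> w)" if "x \<in> carrier E" for x
      using that unfolding carE frame_range[OF fr, symmetric] by auto
    fix x assume "x \<in> carrier E"
    then obtain v w where x: "x = (\<Psi> v, \<Psi> w)" using pair by blast
    show "snd (x \<oplus>\<^bsub>E\<^esub> y) = snd x \<oplus>\<^bsub>M\<^esub> snd y" if "y \<in> carrier E" for y
    proof -
      obtain v' w' where y: "y = (\<Psi> v', \<Psi> w')" using pair[OF \<open>y \<in> carrier E\<close>] by blast
      show ?thesis by (simp add: x y addE frame_add[OF fr])
    qed
    fix a assume "a \<in> carrier (R (lev m))"
    then obtain b where b: "b \<in> carrier A" "a = pr (lev m) b" using pr_surj by blast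
    show "snd (a \<odot>\<^bsub>E\<^esub> x) = a \<odot>\<^bsub>M\<^esub> snd x"
      by (simp add: x b act act_snd presents_act[OF fr M])
  qed
  have "(\<lambda>x. (x, \<zero>\<^bsub>M\<^esub>), E, snd) \<in> extensions (R (lev m)) M M"
    unfolding extensions_def using T(1) f g by (auto simp: inj_on_def carE)
  moreover have "H_scalar C (lev m) \<Omega> s \<odot>\<^bsub>E\<^esub> (\<Psi> v, \<Psi> w) = (\<Psi> (vsc s v), \<Psi> (vsc s w))" for s v w
  proof -
    have "V.act (ascale s \<one>) (v, w) = (cut r (vsc s v), cut r (vsc s w))"
      by (simp add: ascale_def V.act_scale act_one psc_def dmul_cut)
    then show ?thesis using act[of "ascale s \<one>" v w] by (simp add: H_scalar_eq frame_cut[OF fr])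
  qed
  ultimately show thesis
    using that[of E] carE addE act act_kpol act_arrow by simp
qed

text \<open>A section of the twisted extension has the form
  \<open>x \<mapsto> (\<phi> x, x)\<close>. Compatibility with the loops puts \<phi> into
  \<open>hom_space\<close> after lifting, and compatibility with the arrows exhibits
  \<open>\<gamma>\<close> as a coboundary.\<close>

lemma rigid_imp_rigid_mod:
  assumes M: "presents m r \<alpha> M \<Psi>" and rig: "rigid (R (lev m)) M"
  shows "rigid_mod m r \<alpha>"
  unfolding rigid_mod_def
proof
  fix \<gamma> :: "'n arrow \<Rightarrow> ('n, 'k) pvec \<Rightarrow> ('n, 'k) pvec" assume \<gamma>: "\<gamma> \<in> reps r r"
  have fr: "frame m r M \<Psi>" and \<alpha>: "\<alpha> \<in> reps r r" using M by (auto simp: presents_def)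
  interpret M: left_module "R (lev m)" M by (rule frame_module[OF fr])
  obtain E where X: "(\<lambda>x. (x, \<zero>\<^bsub>M\<^esub>), E, snd) \<in> extensions (R (lev m)) M M" and carE: "carrier E = carrier M \<times> carrier M"
    and addE: "\<And>v w v' w'. (\<Psi> v, \<Psi> w) \<oplus>\<^bsub>E\<^esub> (\<Psi> v', \<Psi> w') = (\<Psi> (v + v'), \<Psi> (w + w'))"
    and kpolE: "\<And>i p v w. pr (lev m) (kpol i p) \<odot>\<^bsub>E\<^esub> (\<Psi> v, \<Psi> w) = (\<Psi> (dmul (\<lambda>_. p) (vproj r i v)), \<Psi> (dmul (\<lambda>_. p) (vproj r i w)))"
    and scE: "\<And>s v w. H_scalar C (lev m) \<Omega> s \<odot>\<^bsub>E\<^esub> (\<Psi> v, \<Psi> w) = (\<Psi> (vsc s v), \<Psi> (vsc s w))"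
    and arE: "\<And>a v w. a \<in> alphas C \<Omega> \<Longrightarrow> pr (lev m) (arrow a) \<odot>\<^bsub>E\<^esub> (\<Psi> v, \<Psi> w) = (\<Psi> (\<alpha> a v + \<gamma> a w), \<Psi> (\<alpha> a w))"
    by (rule twisted_extension[OF M \<gamma>], rule that, assumption) simp_all
  obtain s where s: "s \<in> lmod_hom (R (lev m)) M E" and snd_s: "\<And>x. x \<in> carrier M \<Longrightarrow> snd (s x) = x"
    using rig X unfolding rigid_iff_sections[OF frame_module[OF fr]] by fastforce
  note D = frame_closed[OF fr]
  have s_E: "s (\<Psi> v) \<in> carrier E" for v by (rule lmod_homD(1)[OF s D])
  have "\<exists>w. s (\<Psi> v) = (\<Psi> w, \<Psi> v)" for v
  proof -
    obtain x y where xy: "s (\<Psi> v) = (x, y)" "x \<in> carrier M" using s_E[of v] by (auto simp: carE)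
    then obtain w where "x = \<Psi> w" using frame_range[OF fr] by blast
    then show ?thesis using xy snd_s[OF D, of v] by auto
  qed
  then obtain t where t: "\<And>v. s (\<Psi> v) = (\<Psi> (t v), \<Psi> v)" by metis
  \<comment> \<open>\<open>t\<close> is a pointwise choice, without structure of its own;
    \<open>\<phi>\<close> is a lift that is linear over the loops.\<close>
  obtain \<phi> where \<phi>: "\<phi> \<in> hom_space r r" and \<Psi>\<phi>: "\<And>v. \<Psi> (\<phi> v) = \<Psi> (t v)"
  proof (rule frame_lift_hom[OF fr, of "\<lambda>v. \<Psi> (t v)" r])
    show "\<Psi> (t (v + w)) = \<Psi> (t v) \<oplus>\<^bsub>M\<^esub> \<Psi> (t w)" for v w
      using t[of "v + w"] addE[of "t v" v "t w" w] by (simp add: frame_add[OF fr] lmod_homD(2)[OF s D D] t)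
    show "\<Psi> (t (vsc a v)) = H_scalar C (lev m) \<Omega> a \<odot>\<^bsub>M\<^esub> \<Psi> (t v)" for a v
      using t[of "vsc a v"] by (simp add: frame_vsc[OF fr] lmod_homD(3)[OF s H_scalar_closed D] t scE)
    show "\<Psi> (t (dmul (\<lambda>_. p) (vproj r i v))) = pr (lev m) (kpol i p) \<odot>\<^bsub>M\<^esub> \<Psi> (t v)" for i p v
      using t[of "dmul (\<lambda>_. p) (vproj r i v)"] by (simp add: frame_kpol[OF fr] lmod_homD(3)[OF s _ D] t kpolE)
    show "\<Psi> (t (cut r v)) = \<Psi> (t v)" for v
      using t[of "cut r v"] t[of v] by (simp add: frame_cut[OF fr])
  qed (simp_all add: D)
  have s_\<phi>: "s (\<Psi> v) = (\<Psi> (\<phi> v), \<Psi> v)" for v by (simp add: t \<Psi>\<phi>)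
  have key: "ediv m (\<gamma> a v - (\<phi> (\<alpha> a v) - \<alpha> a (\<phi> v)))" if a: "a \<in> alphas C \<Omega>" for a v
  proof -
    have cut: "cut r (\<gamma> a v) = \<gamma> a v" "cut r (\<alpha> a (\<phi> v)) = \<alpha> a (\<phi> v)"
      by (metis arrow_spaceD(3)[OF repsD[OF \<gamma> a]] cut_vproj, metis arrow_spaceD(3)[OF repsD[OF \<alpha> a]] cut_vproj)
    have "\<Psi> (\<alpha> a v) = pr (lev m) (arrow a) \<odot>\<^bsub>M\<^esub> \<Psi> v" using M a by (simp add: presents_def)
    then have "s (\<Psi> (\<alpha> a v)) = pr (lev m) (arrow a) \<odot>\<^bsub>E\<^esub> (\<Psi> (\<phi> v), \<Psi> v)"
      using a by (simp add: lmod_homD(3)[OF s _ D] s_\<phi>)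
    then have "\<Psi> (\<phi> (\<alpha> a v)) = \<Psi> (\<alpha> a (\<phi> v) + \<gamma> a v)" by (simp add: s_\<phi> arE[OF a])
    then have "ediv m (\<phi> (\<alpha> a v) - (\<alpha> a (\<phi> v) + \<gamma> a v))"
      by (simp add: frame_eq_iff[OF fr] cut_diff cut_add hom_spaceD[OF \<phi>] cut)
    then have "ediv m (- (\<phi> (\<alpha> a v) - (\<alpha> a (\<phi> v) + \<gamma> a v)))" by (simp only: vdvd_minus)
    then show ?thesis by (simp add: algebra_simps)
  qed
  have neg: "dmul (\<lambda>_. - 1) u = - u" for u :: "('n, 'k) pvec" by (simp add: dmul_def fun_eq_iff)
  \<comment> \<open>The section yields \<open>\<phi> \<alpha> - \<alpha> \<phi>\<close>, so the sign
    of \<open>\<phi>\<close> is reversed to match \<open>rigid_mod\<close>.\<close>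
  have "ediv m (\<gamma> a v - (\<alpha> a (- \<phi> v) - (- \<phi> (\<alpha> a v))))" if "a \<in> alphas C \<Omega>" for a v
  proof -
    have "\<alpha> a (- \<phi> v) = - \<alpha> a (\<phi> v)"
      using klinearD(4)[OF repsD_linear[OF \<alpha> that], of 0] klinearD(3)[OF repsD_linear[OF \<alpha> that]]
      by (metis diff_0)
    then show ?thesis using key[OF that, of v] by (simp add: algebra_simps)
  qed
  moreover have "(\<lambda>v. - \<phi> v) \<in> hom_space r r"
    using hom_space_dmul[OF \<phi>, of "\<lambda>_. - 1"] by (simp add: neg)
  ultimately show "\<exists>\<phi>\<in>hom_space r r. \<forall>a\<in>alphas C \<Omega>. \<forall>v. ediv m (\<gamma> a v - (\<alpha> a (\<phi> v) - \<phi> (\<alpha> a v)))"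
    by (intro bexI[of _ "\<lambda>v. - \<phi> v"]) auto
qed

text \<open>Freeness over the loops gives a section \<open>s\<close> that respects everything but
  the arrows. A primitive of its defect corrects it to a section of modules.\<close>

lemma rigid_mod_imp_rigid:
  assumes M: "presents m r \<alpha> M \<Psi>" and rig: "rigid_mod m r \<alpha>"
  shows "rigid (R (lev m)) M"
proof -
  have fr: "frame m r M \<Psi>" and \<alpha>: "\<alpha> \<in> reps r r" using M by (auto simp: presents_def)
  interpret M: left_module "R (lev m)" M by (rule frame_module[OF fr])
  have splits: "\<exists>h\<in>lmod_hom (R (lev m)) M E. \<forall>x\<in>carrier M. g (h x) = x"
    if X: "(f, E, g) \<in> extensions (R (lev m)) M M" for f E g
  proof -
    have E: "left_module (R (lev m)) E" and f: "f \<in> lmod_hom (R (lev m)) M E" and f_inj: "inj_on f (carrier M)"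
      and g: "g \<in> lmod_hom (R (lev m)) E M" and g_surj: "g ` carrier E = carrier M"
      and ker: "f ` carrier M = {e \<in> carrier E. g e = \<zero>\<^bsub>M\<^esub>}"
      using X by (auto simp: extensions_def)
    interpret E: left_module "R (lev m)" E by (rule E)
    note f_hom = lmod_homD[OF f] and g_hom = lmod_homD[OF g]
    \<comment> \<open>Arbitrary preimages of the unit vectors suffice, as \<open>fmap\<close>
      inserts the idempotents.\<close>
    have "\<exists>y. y \<in> carrier E \<and> g y = \<Psi> (vunit i l 1)" for i l
      using g_surj frame_closed[OF fr, of "vunit i l 1"] by (metis imageE)
    then obtain b where b: "\<And>i l. b i l \<in> carrier E" "\<And>i l. g (b i l) = \<Psi> (vunit i l 1)" by metis
    define s where "s = fmap r E b"
    have s_closed: "s v \<in> carrier E" and s_add: "s (v + w) = s v \<oplus>\<^bsub>E\<^esub> s w"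
      and s_vsc: "s (vsc a v) = H_scalar C (lev m) \<Omega> a \<odot>\<^bsub>E\<^esub> s v"
      and s_kpol: "s (dmul (\<lambda>_. p) (vproj r i v)) = pr (lev m) (kpol i p) \<odot>\<^bsub>E\<^esub> s v"
      and s_0: "ediv m (cut r v) \<Longrightarrow> s v = \<zero>\<^bsub>E\<^esub>" for v w a i p
      unfolding s_def by (rule fmap_closed fmap_add fmap_vsc fmap_kpol fmap_eq_0; (rule E b(1))?; assumption?)+
    have s_idm: "s (vproj r i v) = pr (lev m) (idm i) \<odot>\<^bsub>E\<^esub> s v" for i v
      using s_kpol[of 1 i v] by (simp add: kpol_1 dmul_1)
    have gs: "g (s v) = \<Psi> v" for v
    proof -
      have "g (s v) = (\<Oplus>\<^bsub>M\<^esub>x\<in>coords r. g (pr (lev m) (kpol (fst x) (v (fst x) (snd x))) \<odot>\<^bsub>E\<^esub> b (fst x) (snd x)))"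
        unfolding s_def fmap_def
        by (rule lmod_hom_finsum[OF E frame_module[OF fr] g]) (auto simp: b E.lsmult_closed)
      also have "\<dots> = fmap r M (\<lambda>i l. \<Psi> (vunit i l 1)) v"
        unfolding fmap_def by (rule M.M.finsum_cong') (auto simp: g_hom b M.lsmult_closed frame_closed[OF fr])
      finally show ?thesis by (simp add: frame_eq_fmap[OF fr, of v])
    qed
    text \<open>The failure of \<open>s\<close> to commute with the arrows is a cocycle with values in \<open>f M\<close>.\<close>
    define \<delta> where "\<delta> a v = pr (lev m) (arrow a) \<odot>\<^bsub>E\<^esub> s v \<ominus>\<^bsub>E\<^esub> s (\<alpha> a v)" for a v
    have \<delta>_closed: "\<delta> a v \<in> carrier E" if "a \<in> alphas C \<Omega>" for a v
      using that by (simp add: \<delta>_def s_closed E.lsmult_closed)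
    have "\<exists>x. x \<in> carrier M \<and> f x = \<delta> a v" if a: "a \<in> alphas C \<Omega>" for a v
    proof -
      have "g (\<delta> a v) = g (pr (lev m) (arrow a) \<odot>\<^bsub>E\<^esub> s v) \<ominus>\<^bsub>M\<^esub> g (s (\<alpha> a v))"
        unfolding \<delta>_def using a
        by (intro lmod_hom_minus[OF E frame_module[OF fr] g]) (simp_all add: s_closed E.lsmult_closed)
      also have "\<dots> = \<Psi> (\<alpha> a v) \<ominus>\<^bsub>M\<^esub> \<Psi> (\<alpha> a v)"
        using a M by (simp add: g_hom s_closed gs presents_def)
      also have "\<dots> = \<zero>\<^bsub>M\<^esub>" by (simp add: a_minus_def frame_closed[OF fr] M.r_neg)
      finally have "\<delta> a v \<in> f ` carrier M" using ker \<delta>_closed[OF a] by simp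
      then show ?thesis by auto
    qed
    then obtain d where d: "\<And>a v. a \<in> alphas C \<Omega> \<Longrightarrow> d a v \<in> carrier M" "\<And>a v. a \<in> alphas C \<Omega> \<Longrightarrow> f (d a v) = \<delta> a v"
      by metis
    \<comment> \<open>\<open>f\<close> is injective, so identities for \<open>d\<close> can be
      checked for \<open>\<delta>\<close> inside \<open>E\<close>.\<close>
    have f_eqI: "x = y" if "f x = f y" "x \<in> carrier M" "y \<in> carrier M" for x y
      using f_inj that by (auto dest: inj_onD)
    have "\<exists>\<gamma>. \<gamma> \<in> arrow_space r r (arrow_head a) (arrow_tail a) (head_exp C a) (tail_exp C a) \<and>
        (\<forall>v. \<Psi> (\<gamma> v) = d a v)" if a: "a \<in> alphas C \<Omega>" for a
    proof -
      let ?i = "arrow_head a" and ?j = "arrow_tail a" and ?p = "pr (lev m) (arrow a)"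
      have p: "?p \<in> carrier (R (lev m))" using a by simp
      note al = arrow_spaceD[OF repsD[OF \<alpha> a]] klinearD[OF repsD_linear[OF \<alpha> a]]
      note cl = s_closed E.lsmult_closed p
      have minus: "x \<odot>\<^bsub>E\<^esub> y \<ominus>\<^bsub>E\<^esub> x \<odot>\<^bsub>E\<^esub> z = x \<odot>\<^bsub>E\<^esub> (y \<ominus>\<^bsub>E\<^esub> z)"
        if "x \<in> carrier (R (lev m))" "y \<in> carrier E" "z \<in> carrier E" for x y z
      proof -
        have "x \<odot>\<^bsub>E\<^esub> y = x \<odot>\<^bsub>E\<^esub> (y \<ominus>\<^bsub>E\<^esub> z) \<oplus>\<^bsub>E\<^esub> x \<odot>\<^bsub>E\<^esub> z"
          using that by (simp add: E.lsmult_r_distr[symmetric] a_minus_def E.add.m_assoc E.l_neg)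
        then show ?thesis using that by (simp add: a_minus_def E.add.m_assoc E.r_neg E.lsmult_closed)
      qed
      have \<delta>_add: "\<delta> a (v + w) = \<delta> a v \<oplus>\<^bsub>E\<^esub> \<delta> a w" for v w
        by (simp add: \<delta>_def s_add al cl E.lsmult_r_distr a_minus_def E.minus_add E.add.m_ac)
      have \<delta>_vsc: "\<delta> a (vsc t v) = H_scalar C (lev m) \<Omega> t \<odot>\<^bsub>E\<^esub> \<delta> a v" for t v
      proof -
        have "arrow a \<otimes> ascale t \<one> = ascale t \<one> \<otimes> arrow a"
          using a ascale_simps(8)[of t "arrow a" \<one>] ascale_simps(7)[of t \<one> "arrow a"] by simp
        then have "?p \<otimes>\<^bsub>R (lev m)\<^esub> H_scalar C (lev m) \<Omega> t = H_scalar C (lev m) \<Omega> t \<otimes>\<^bsub>R (lev m)\<^esub> ?p"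
          using a by (simp add: H_scalar_eq flip: pr.hom_mult)
        then show ?thesis
          unfolding \<delta>_def al s_vsc
          by (subst minus[symmetric]) (simp_all add: cl H_scalar_closed E.lsmult_assoc[symmetric])
      qed
      have \<delta>_tail: "\<delta> a (vproj r ?j v) = \<delta> a v" for v
      proof -
        have "?p \<otimes>\<^bsub>R (lev m)\<^esub> pr (lev m) (idm ?j) = ?p" using a by (simp add: idm_arrow flip: pr.hom_mult)
        then show ?thesis by (simp add: \<delta>_def s_idm al cl E.lsmult_assoc[symmetric])
      qed
      have \<delta>_head: "pr (lev m) (idm ?i) \<odot>\<^bsub>E\<^esub> \<delta> a v = \<delta> a v" for v
      proof -
        have "pr (lev m) (idm ?i) \<otimes>\<^bsub>R (lev m)\<^esub> ?p = ?p" using a by (simp add: idm_arrow flip: pr.hom_mult)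
        moreover have "s (\<alpha> a v) = pr (lev m) (idm ?i) \<odot>\<^bsub>E\<^esub> s (\<alpha> a v)"
          using s_idm[of ?i "\<alpha> a v"] by (simp add: al)
        ultimately show ?thesis
          unfolding \<delta>_def by (subst minus[symmetric]) (simp_all add: cl E.lsmult_assoc[symmetric])
      qed
      have \<delta>_rel: "\<delta> a (shift (\<lambda>_. tail_exp C a) v) = pr (lev m) (kpol ?i (monom 1 (head_exp C a))) \<odot>\<^bsub>E\<^esub> \<delta> a v"
        if v: "vproj r ?j v = v" for v
      proof -
        have 1: "s (shift (\<lambda>_. tail_exp C a) v) = pr (lev m) (kpol ?j (monom 1 (tail_exp C a))) \<odot>\<^bsub>E\<^esub> s v"
          using s_kpol[of "monom 1 (tail_exp C a)" ?j v] by (simp add: v)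
        have 2: "s (\<alpha> a (shift (\<lambda>_. tail_exp C a) v)) = pr (lev m) (kpol ?i (monom 1 (head_exp C a))) \<odot>\<^bsub>E\<^esub> s (\<alpha> a v)"
          using s_kpol[of "monom 1 (head_exp C a)" ?i "\<alpha> a v"] by (simp add: al)
        show ?thesis
          unfolding \<delta>_def 1 2 using pr_arrow_relation[OF a]
          by (subst minus[symmetric]) (simp_all add: cl E.lsmult_assoc[symmetric] del: pr.hom_mult)
      qed
      obtain \<gamma> where "\<gamma> \<in> arrow_space r r ?i ?j (head_exp C a) (tail_exp C a)" "\<And>v. \<Psi> (\<gamma> v) = d a (vproj r ?j v)"
      proof (rule frame_lift_arrow[OF fr, of "d a" ?i r ?j "tail_exp C a" "head_exp C a"])
        show "d a (v + w) = d a v \<oplus>\<^bsub>M\<^esub> d a w" for v w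
          by (rule f_eqI) (simp_all add: d[OF a] f_hom \<delta>_add)
        show "d a (vsc t v) = H_scalar C (lev m) \<Omega> t \<odot>\<^bsub>M\<^esub> d a v" for t v
          by (rule f_eqI) (simp_all add: d[OF a] f_hom \<delta>_vsc H_scalar_closed M.lsmult_closed)
        show "pr (lev m) (idm ?i) \<odot>\<^bsub>M\<^esub> d a (vproj r ?j v) = d a (vproj r ?j v)" for v
          by (rule f_eqI) (simp_all add: d[OF a] f_hom \<delta>_head M.lsmult_closed)
        show "d a (shift (\<lambda>_. tail_exp C a) (vproj r ?j v)) =
            pr (lev m) (kpol ?i (monom 1 (head_exp C a))) \<odot>\<^bsub>M\<^esub> d a (vproj r ?j v)" for v
          by (rule f_eqI) (simp_all add: d[OF a] f_hom \<delta>_rel vproj_vproj M.lsmult_closed)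
        show "0 < tail_exp C a" by (rule alphas_exp_pos[OF a])
      qed (simp_all add: d[OF a])
      moreover have "d a (vproj r ?j v) = d a v" for v
        by (rule f_eqI) (simp_all add: d[OF a] \<delta>_tail)
      ultimately show ?thesis by auto
    qed
    then have "\<forall>a\<in>alphas C \<Omega>. \<exists>\<gamma>. \<gamma> \<in> arrow_space r r (arrow_head a) (arrow_tail a) (head_exp C a) (tail_exp C a) \<and>
        (\<forall>v. \<Psi> (\<gamma> v) = d a v)" by blast
    from bchoice[OF this] obtain \<gamma> where
      \<gamma>': "\<forall>a\<in>alphas C \<Omega>. \<gamma> a \<in> arrow_space r r (arrow_head a) (arrow_tail a) (head_exp C a) (tail_exp C a) \<and>
        (\<forall>v. \<Psi> (\<gamma> a v) = d a v)" ..
    have \<gamma>: "\<gamma> \<in> reps r r" using \<gamma>' by (simp add: reps_def)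
    obtain \<phi> where \<phi>: "\<phi> \<in> hom_space r r"
      and cob: "\<forall>a\<in>alphas C \<Omega>. \<forall>v. ediv m (\<gamma> a v - (\<alpha> a (\<phi> v) - \<phi> (\<alpha> a v)))"
      using bspec[OF rig[unfolded rigid_mod_def] \<gamma>] by blast
    note \<phi>_hom = hom_spaceD[OF \<phi>]
    \<comment> \<open>The element \<open>f (\<Psi> (\<phi> v))\<close> has the same defect with
      respect to the arrows as \<open>s v\<close>, so the difference commutes with them.\<close>
    define \<sigma> where "\<sigma> v = s v \<ominus>\<^bsub>E\<^esub> f (\<Psi> (\<phi> v))" for v
    have cl: "f (\<Psi> v) \<in> carrier E" for v by (simp add: f_hom frame_closed[OF fr])
    have minus: "x \<odot>\<^bsub>E\<^esub> y \<ominus>\<^bsub>E\<^esub> x \<odot>\<^bsub>E\<^esub> z = x \<odot>\<^bsub>E\<^esub> (y \<ominus>\<^bsub>E\<^esub> z)"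
      if "x \<in> carrier (R (lev m))" "y \<in> carrier E" "z \<in> carrier E" for x y z
    proof -
      have "x \<odot>\<^bsub>E\<^esub> y = x \<odot>\<^bsub>E\<^esub> (y \<ominus>\<^bsub>E\<^esub> z) \<oplus>\<^bsub>E\<^esub> x \<odot>\<^bsub>E\<^esub> z"
        using that by (simp add: E.lsmult_r_distr[symmetric] a_minus_def E.add.m_assoc E.l_neg)
      then show ?thesis using that by (simp add: a_minus_def E.add.m_assoc E.r_neg E.lsmult_closed)
    qed
    have \<sigma>_kpol: "\<sigma> (dmul (\<lambda>_. p) (vproj r i v)) = pr (lev m) (kpol i p) \<odot>\<^bsub>E\<^esub> \<sigma> v" for i p v
      unfolding \<sigma>_def
      by (subst minus[symmetric])
        (simp_all add: s_kpol s_closed cl \<phi>_hom(1-6) \<phi>_hom(7)[symmetric] frame_kpol[OF fr] f_hom frame_closed[OF fr])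
    obtain h where h: "h \<in> lmod_hom (R (lev m)) M E" and h\<Psi>: "\<And>v. h (\<Psi> v) = \<sigma> v"
    proof (rule presents_induced_hom[OF M E, of \<sigma>])
      show "\<sigma> v \<in> carrier E" for v by (simp add: \<sigma>_def s_closed cl)
      show "\<sigma> (v + w) = \<sigma> v \<oplus>\<^bsub>E\<^esub> \<sigma> w" for v w
        by (simp add: \<sigma>_def s_add s_closed cl \<phi>_hom frame_add[OF fr] f_hom frame_closed[OF fr]
            a_minus_def E.minus_add E.add.m_ac)
      show "\<sigma> (vsc t v) = H_scalar C (lev m) \<Omega> t \<odot>\<^bsub>E\<^esub> \<sigma> v" for t v
        unfolding \<sigma>_def
        by (subst minus[symmetric])
          (simp_all add: s_vsc s_closed cl \<phi>_hom frame_vsc[OF fr] f_hom frame_closed[OF fr] H_scalar_closed)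
      show "\<sigma> (vproj r i v) = pr (lev m) (idm i) \<odot>\<^bsub>E\<^esub> \<sigma> v" for i v
        using \<sigma>_kpol[of 1 i v] by (simp add: kpol_1 dmul_1)
      show "\<sigma> (shift (\<lambda>_. 1) (vproj r i v)) = pr (lev m) (arrow (Eps i)) \<odot>\<^bsub>E\<^esub> \<sigma> v" for i v
        using \<sigma>_kpol[of "monom 1 1" i v] kpol_X[of i] by simp
      show "\<sigma> v = \<zero>\<^bsub>E\<^esub>" if "ediv m (cut r v)" for v
      proof -
        have "\<Psi> (\<phi> v) = \<zero>\<^bsub>M\<^esub>" using hom_ediv[OF \<phi> that] by (simp add: frame_zero_iff[OF fr] \<phi>_hom)
        then show ?thesis
          using that lmod_hom_zero[OF frame_module[OF fr] E f] by (simp add: \<sigma>_def s_0 a_minus_def)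
      qed
      show "\<sigma> (\<alpha> a v) = pr (lev m) (arrow a) \<odot>\<^bsub>E\<^esub> \<sigma> v" if a: "a \<in> alphas C \<Omega>" for a v
      proof -
        let ?p = "pr (lev m) (arrow a)"
        have p: "?p \<in> carrier (R (lev m))" using a by simp
        have cut: "cut r (\<gamma> a v) = \<gamma> a v"
          by (metis arrow_spaceD(3)[OF conjunct1[OF bspec[OF \<gamma>' a]]] cut_vproj)
        have cut': "cut r (\<alpha> a (\<phi> v)) = \<alpha> a (\<phi> v)"
          by (metis arrow_spaceD(3)[OF repsD[OF \<alpha> a]] cut_vproj)
        have "\<Psi> (\<gamma> a v) = \<Psi> (\<alpha> a (\<phi> v) - \<phi> (\<alpha> a v))"
          using cob a by (simp add: frame_eq_iff[OF fr] cut_diff cut cut' \<phi>_hom)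
        then have "d a v = ?p \<odot>\<^bsub>M\<^esub> \<Psi> (\<phi> v) \<ominus>\<^bsub>M\<^esub> \<Psi> (\<phi> (\<alpha> a v))"
          using \<gamma>' a M by (simp add: presents_def frame_diff[OF fr])
        then have "\<delta> a v = ?p \<odot>\<^bsub>E\<^esub> f (\<Psi> (\<phi> v)) \<ominus>\<^bsub>E\<^esub> f (\<Psi> (\<phi> (\<alpha> a v)))"
          using d(2)[OF a, of v] p frame_closed[OF fr]
          by (simp add: lmod_hom_minus[OF frame_module[OF fr] E f] f_hom M.lsmult_closed)
        then have "s (\<alpha> a v) \<ominus>\<^bsub>E\<^esub> f (\<Psi> (\<phi> (\<alpha> a v))) = ?p \<odot>\<^bsub>E\<^esub> s v \<ominus>\<^bsub>E\<^esub> ?p \<odot>\<^bsub>E\<^esub> f (\<Psi> (\<phi> v))"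
          using p unfolding \<delta>_def by - (rule E.M.minus_swap, simp_all add: s_closed cl E.lsmult_closed)
        then show ?thesis unfolding \<sigma>_def using p by (simp add: minus s_closed cl)
      qed
    qed auto
    have "g (h x) = x" if x: "x \<in> carrier M" for x
    proof -
      obtain v where v: "x = \<Psi> v" using x frame_range[OF fr] by blast
      have "f (\<Psi> (\<phi> v)) \<in> {e \<in> carrier E. g e = \<zero>\<^bsub>M\<^esub>}"
        unfolding ker[symmetric] by (simp add: frame_closed[OF fr])
      then have "g (\<sigma> v) = \<Psi> v"
        unfolding \<sigma>_def using frame_closed[OF fr]
        by (simp add: lmod_hom_minus[OF E frame_module[OF fr] g] s_closed gs) (simp add: a_minus_def)
      then show ?thesis by (simp add: v h\<Psi>)
    qed
    then show ?thesis using h by (intro bexI[of _ h] ballI)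
  qed
  show ?thesis unfolding rigid_iff_sections[OF frame_module[OF fr]]
  proof (intro ballI)
    fix X assume X: "X \<in> extensions (R (lev m)) M M"
    obtain f E g where "X = (f, E, g)" by (cases X)
    then show "case X of (f, E, g) \<Rightarrow> \<exists>s\<in>lmod_hom (R (lev m)) M E. \<forall>x\<in>carrier M. g (s x) = x"
      using X splits[of f E g] by (simp only: prod.case)
  qed
qed

lemma rigid_iff_rigid_mod: "presents m r \<alpha> M \<Psi> \<Longrightarrow> rigid (R (lev m)) M \<longleftrightarrow> rigid_mod m r \<alpha>"
  using rigid_imp_rigid_mod rigid_mod_imp_rigid by blast

end


section \<open>Reduction\<close>

context cartan_mult
begin

lemma H_central_closed: "H_central C c \<Omega> m \<in> carrier (R (lev m))"
  and H_central_smult: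
    "frame m r M \<Psi> \<Longrightarrow> H_central C c \<Omega> m \<odot>\<^bsub>M\<^esub> \<Psi> v = \<Psi> (emul 1 v)"
proof -
  have eps: "H_eps C (lev m) \<Omega> i [^]\<^bsub>R (lev m)\<^esub> c i = pr (lev m) (kpol i (monom 1 (c i)))" for i
    unfolding kpol_monom[OF c_pos] H_eps_def by (simp add: pr.hom_nat_pow)
  have central: "H_central C c \<Omega> m = (\<Oplus>\<^bsub>R (lev m)\<^esub>i\<in>UNIV. pr (lev m) (kpol i (monom 1 (c i))))"
    by (simp add: H_central_def Let_def eps)
  show "H_central C c \<Omega> m \<in> carrier (R (lev m))"
    unfolding central by (rule pr.S.finsum_closed) auto
  assume fr: "frame m r M \<Psi>"
  interpret M: left_module "R (lev m)" M by (rule frame_module[OF fr])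
  have "H_central C c \<Omega> m \<odot>\<^bsub>M\<^esub> \<Psi> v = (\<Oplus>\<^bsub>M\<^esub>i\<in>UNIV. pr (lev m) (kpol i (monom 1 (c i))) \<odot>\<^bsub>M\<^esub> \<Psi> v)"
    unfolding central by (rule M.smult_finsum_left) (auto simp: frame_closed[OF fr])
  also have "\<dots> = \<Psi> (\<Sum>i\<in>UNIV. dmul (\<lambda>_. monom 1 (c i)) (vproj r i v))"
    by (simp add: frame_sum[OF fr] frame_kpol[OF fr])
  also have "(\<Sum>i\<in>UNIV. dmul (\<lambda>_. monom 1 (c i)) (vproj r i v)) = (\<Sum>i\<in>UNIV. emul 1 (vproj r i v))"
    by (rule sum.cong[OF refl]) (simp add: dmul_vproj_const[of "\<lambda>i. monom 1 (c i)", symmetric])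
  also have "\<dots> = cut r (emul 1 v)" by (simp only: dmul_sum[symmetric] sum_vproj dmul_cut)
  finally show "H_central C c \<Omega> m \<odot>\<^bsub>M\<^esub> \<Psi> v = \<Psi> (emul 1 v)" by (simp only: frame_cut[OF fr])
qed

lemma H_central_pow_smult:
  assumes fr: "frame m r M \<Psi>"
  shows "(H_central C c \<Omega> m [^]\<^bsub>R (lev m)\<^esub> (n::nat)) \<odot>\<^bsub>M\<^esub> \<Psi> v = \<Psi> (emul n v)"
proof (induction n arbitrary: v)
  interpret M: left_module "R (lev m)" M by (rule frame_module[OF fr])
  case 0
  then show ?case by (simp add: M.lsmult_one frame_closed[OF fr] dmul_1)
next
  interpret M: left_module "R (lev m)" M by (rule frame_module[OF fr])
  case (Suc n)
  have "emul n (emul 1 v) = emul (Suc n) v" by (simp add: shift_shift add.commute)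
  then show ?case
    using Suc[of "emul 1 v"]
    by (simp add: M.lsmult_assoc H_central_closed frame_closed[OF fr] H_central_smult[OF fr] del: One_nat_def)
qed

text \<open>Multiplication by \<epsilon> in \<open>M\<close> is \<open>emul 1\<close> on vectors.
  Hence the composition of \<open>\<Psi>\<close> with the quotient map has the same kernel as
  truncation at the lower level, with the same \<open>\<alpha>\<close> acting on both sides.\<close>

lemma reduction_isomorphic:
  assumes M: "presents m r \<alpha> M \<Psi>" and m: "2 \<le> m"
  shows "lmod_isomorphic (R (lev (m - 1))) (vmod (m - 1) r \<alpha>) (reduction C c \<Omega> m M)"
proof -
  define n where "n = m - 1"
  interpret N: cartan_mult C c \<Omega> A n by unfold_locales (use m in \<open>simp add: n_def\<close>)
  have fr: "frame m r M \<Psi>" and \<alpha>: "\<alpha> \<in> reps r r" using M by (auto simp: presents_def)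
  note P = N.presents_vmod[OF \<alpha>]
  have frN: "frame n r (vmod n r \<alpha>) (trunc n r)" using P by (simp add: presents_def)
  interpret M: left_module "R (lev m)" M by (rule frame_module[OF fr])
  define S where "S = reduction_submodule C c \<Omega> m M"
  have S: "S = range (\<lambda>v. \<Psi> (emul n v))"
    unfolding S_def reduction_submodule_def frame_range[OF fr, symmetric] image_image
    by (simp add: H_central_pow_smult[OF fr] n_def)
  \<comment> \<open>\<open>\<Psi>\<close> determines \<open>cut r w\<close> modulo \<epsilon>^m
    only, which is enough since \<open>n \<le> m\<close>.\<close>
  have S_iff: "\<Psi> w \<in> S \<longleftrightarrow> ediv n (cut r w)" for w
  proof
    assume "\<Psi> w \<in> S"
    then obtain u where "\<Psi> w = \<Psi> (emul n u)" by (auto simp: S)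
    then have "ediv m (cut r w - cut r (emul n u))" by (simp add: frame_eq_iff[OF fr] cut_diff)
    then have "ediv n (cut r w - cut r (emul n u))" by (rule ediv_mono) (simp add: n_def)
    moreover have "ediv n (cut r (emul n u))" by (rule vdvd_cut) (auto simp: vdvd_iff_shift)
    ultimately show "ediv n (cut r w)" by (simp add: vdvd_cong)
  next
    assume "ediv n (cut r w)"
    then obtain u where "cut r w = emul n u" by (auto simp: vdvd_iff_shift)
    then have "\<Psi> w = \<Psi> (emul n u)" by (simp add: frame_cut[OF fr, of w, symmetric])
    then show "\<Psi> w \<in> S" by (simp add: S)
  qed
  have sub: "abelian_subgroup S M"
  proof (rule abelian_subgroupI3)
    show "additive_subgroup S M"
    proof (rule additive_subgroup.intro, rule M.add.subgroupI)
      show "S \<subseteq> carrier M" by (auto simp: S frame_closed[OF fr])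
      show "S \<noteq> {}" by (auto simp: S)
      show "x \<oplus>\<^bsub>M\<^esub> y \<in> S" if "x \<in> S" "y \<in> S" for x y
        using that by (auto simp: S frame_add[OF fr, symmetric] dmul_add[symmetric])
      show "\<ominus>\<^bsub>M\<^esub> x \<in> S" if "x \<in> S" for x
      proof -
        obtain v where v: "x = \<Psi> (emul n v)" using \<open>x \<in> S\<close> by (auto simp: S)
        have "\<Psi> (emul n (0 - v)) \<oplus>\<^bsub>M\<^esub> x = \<Psi> 0"
          unfolding v by (simp only: frame_add[OF fr, symmetric] dmul_diff dmul_0) simp
        then have "\<ominus>\<^bsub>M\<^esub> x = \<Psi> (emul n (0 - v))"
          unfolding v by (intro M.minus_equality) (simp_all add: frame_0[OF fr] frame_closed[OF fr])
        then show ?thesis by (auto simp: S)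
      qed
    qed
  qed (rule M.M.abelian_group_axioms)
  define Q where "Q v = a_r_coset M S (\<Psi> v)" for v
  have Q_mem: "\<Psi> w \<in> Q v \<longleftrightarrow> ediv n (cut r (w - v))" for v w
  proof -
    have "\<Psi> w \<in> Q v \<longleftrightarrow> (\<exists>s\<in>S. \<Psi> w = s \<oplus>\<^bsub>M\<^esub> \<Psi> v)" by (simp add: Q_def a_r_coset_def')
    also have "\<dots> \<longleftrightarrow> \<Psi> (w - v) \<in> S"
    proof
      assume "\<exists>s\<in>S. \<Psi> w = s \<oplus>\<^bsub>M\<^esub> \<Psi> v"
      then obtain u where "\<Psi> w = \<Psi> (emul n u + v)" by (auto simp: S frame_add[OF fr])
      then have "\<Psi> (w - v) = \<Psi> (emul n u)" by (simp add: frame_eq_iff[OF fr] diff_diff_add add.commute)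
      then show "\<Psi> (w - v) \<in> S" by (auto simp: S)
    next
      assume "\<Psi> (w - v) \<in> S"
      moreover have "\<Psi> w = \<Psi> (w - v) \<oplus>\<^bsub>M\<^esub> \<Psi> v" by (simp add: frame_add[OF fr, symmetric])
      ultimately show "\<exists>s\<in>S. \<Psi> w = s \<oplus>\<^bsub>M\<^esub> \<Psi> v" by blast
    qed
    finally show ?thesis by (simp add: S_iff)
  qed
  have Q_eqI: "Q w = Q v" if "ediv n (cut r (w - v))" for v w
    using abelian_subgroup.a_repr_independence'[OF sub, of "\<Psi> w" "\<Psi> v"] that Q_mem[of w v]
    by (simp add: Q_def frame_closed[OF fr])
  have Q_eq_iff: "Q w = Q v \<longleftrightarrow> ediv n (cut r (w - v))" for v w
    using Q_eqI Q_mem[of w w] Q_mem[of w v] by (auto simp: cut_0 vdvd_0)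
  have Q_add: "set_add M (Q v) (Q w) = Q (v + w)" for v w
    unfolding Q_def frame_add[OF fr] by (rule abelian_subgroup.a_rcos_sum[OF sub]) (simp_all add: frame_closed[OF fr])
  let ?red = "reduction C c \<Omega> m M"
  have red: "carrier ?red = range Q" "x \<oplus>\<^bsub>?red\<^esub> y = set_add M x y"
    "h \<odot>\<^bsub>?red\<^esub> X = (\<Union>a\<in>h. \<Union>x\<in>X. a_r_coset M S (pr (lev m) a \<odot>\<^bsub>M\<^esub> x))" for x y h X
    by (auto simp: reduction_def Let_def S_def[symmetric] A_RCOSETS_def' Q_def frame_range[OF fr, symmetric])
  have red_smult: "pr (lev n) a \<odot>\<^bsub>?red\<^esub> Q v = Q (vact r \<alpha> a v)" if a: "a \<in> carrier A" for a v
  proof -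
    \<comment> \<open>The reduction defines its scalar action as a union over representatives. All
      terms agree because \<open>vmod\<close> is already a module at level \<open>n\<close>: modulo
      \<epsilon>^n the result depends only on the classes of \<open>a\<close> and
      \<open>v\<close>.\<close>
    have const: "a_r_coset M S (pr (lev m) b \<odot>\<^bsub>M\<^esub> x) = Q (vact r \<alpha> a v)"
      if b: "b \<in> pr (lev n) a" and x: "x \<in> Q v" for b x
    proof -
      note b' = N.pr_mem[OF a b]
      have "x \<in> carrier M" using abelian_subgroup.a_elemrcos_carrier[OF sub frame_closed[OF fr]] x by (simp add: Q_def)
      then obtain w where w: "x = \<Psi> w" using frame_range[OF fr] by blast
      have "trunc n r w = trunc n r v"
        using x by (simp add: w Q_mem N.frame_eq_iff[OF frN])
      then have "trunc n r (vact r \<alpha> b w) = trunc n r (vact r \<alpha> a v)"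
        using b' a by (simp add: N.presents_act[OF frN P])
      then have "Q (vact r \<alpha> b w) = Q (vact r \<alpha> a v)"
        by (simp add: Q_eq_iff N.frame_eq_iff[OF frN])
      then show ?thesis using b'(1) by (simp add: w Q_def presents_act[OF fr M])
    qed
    have "\<Psi> v \<in> Q v" by (simp add: Q_mem cut_0 vdvd_0)
    then show ?thesis using const N.pr_self[OF a] unfolding red by blast
  qed
  have Q_trunc: "Q (trunc n r v) = Q v" for v
    unfolding Q_eq_iff N.frame_eq_iff[OF frN, symmetric] by (simp add: trunc_trunc)
  have "Q \<in> lmod_hom (R (lev n)) (vmod n r \<alpha>) ?red"
    unfolding lmod_hom_def mem_Collect_eq
  proof (intro conjI ballI)
    show "Q \<in> carrier (vmod n r \<alpha>) \<rightarrow> carrier ?red" by (simp add: red)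
    fix x assume "x \<in> carrier (vmod n r \<alpha>)"
    then obtain v where v: "x = trunc n r v" unfolding N.frame_range[OF frN, symmetric] by blast
    show "Q (x \<oplus>\<^bsub>vmod n r \<alpha>\<^esub> y) = Q x \<oplus>\<^bsub>?red\<^esub> Q y" if y: "y \<in> carrier (vmod n r \<alpha>)" for y
    proof -
      obtain w where "y = trunc n r w" using y unfolding N.frame_range[OF frN, symmetric] by blast
      then show ?thesis by (simp only: v N.frame_add[OF frN, symmetric] Q_trunc red Q_add)
    qed
    fix h assume "h \<in> carrier (R (lev n))"
    then obtain a where a: "a \<in> carrier A" "h = pr (lev n) a" using N.pr_surj by blast
    show "Q (h \<odot>\<^bsub>vmod n r \<alpha>\<^esub> x) = h \<odot>\<^bsub>?red\<^esub> Q x"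
      by (simp add: a v N.presents_act[OF frN P, symmetric] Q_trunc red_smult)
  qed
  moreover have "bij_betw Q (carrier (vmod n r \<alpha>)) (carrier ?red)"
    unfolding bij_betw_def red N.frame_range[OF frN, symmetric]
  proof
    show "inj_on Q (range (trunc n r))"
    proof (rule inj_onI, elim rangeE)
      fix x y v w assume "Q x = Q y" and xy: "x = trunc n r v" "y = trunc n r w"
      then have "Q v = Q w" by (simp add: Q_trunc)
      then show "x = y" unfolding xy Q_eq_iff N.frame_eq_iff[OF frN] .
    qed
    show "Q ` range (trunc n r) = range Q" by (simp add: image_image Q_trunc)
  qed
  ultimately show ?thesis unfolding lmod_isomorphic_def n_def by blast
qed

section \<open>Isomorphism classes parametrized by polynomial models\<close>

lemma iso_class_cong:
  assumes "left_module (R (lev m)) M" "lmod_isomorphic (R (lev m)) M N"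
  shows "iso_class C (lev m) \<Omega> M = iso_class C (lev m) \<Omega> N"
  using lmod_isomorphic_trans[OF assms(2)] lmod_isomorphic_trans[OF lmod_isomorphic_sym[OF assms]]
  unfolding iso_class_def by blast

lemma left_module_vmod: "\<alpha> \<in> reps r r \<Longrightarrow> left_module (R (lev m)) (vmod m r \<alpha>)"
  using presents_vmod[of \<alpha> r] frame_module by (auto simp: presents_def)

lemma presents_iso_class:
  assumes M: "presents m r \<alpha> M \<Psi>"
  shows "iso_class C (lev m) \<Omega> M = iso_class C (lev m) \<Omega> (vmod m r \<alpha>)"
proof (rule iso_class_cong)
  have fr: "frame m r M \<Psi>" and \<alpha>: "\<alpha> \<in> reps r r" using M by (auto simp: presents_def)
  show "left_module (R (lev m)) M" by (rule frame_module[OF fr])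
  show "lmod_isomorphic (R (lev m)) M (vmod m r \<alpha>)"
    by (rule presents_unique[OF M presents_vmod[OF \<alpha>]])
qed

text \<open>The level enters on the right only through the truncation and the modulus in
  \<open>rigid_mod\<close>; this common parametrization is what compares the classes at levels
  \<open>k\<close> and \<open>k - 1\<close>.\<close>

lemma rigid_locally_free_classes_eq:
  "rigid_locally_free_classes C (lev m) \<Omega> =
    {iso_class C (lev m) \<Omega> (vmod m r \<alpha>) | r \<alpha>. \<alpha> \<in> reps r r \<and> rigid_mod m r \<alpha>}"
proof (intro equalityI subsetI)
  fix X :: "('n, 'k) Hmod set" assume "X \<in> rigid_locally_free_classes C (lev m) \<Omega>"
  then obtain M :: "('n, 'k) Hmod" where X: "X = iso_class C (lev m) \<Omega> M" and M: "H_module C (lev m) \<Omega> M"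
    "locally_free C (lev m) \<Omega> M" "rigid (R (lev m)) M"
    by (auto simp: rigid_locally_free_classes_def)
  have lm: "left_module (R (lev m)) M" using M(1) by (simp add: H_module_def)
  obtain r \<Psi> where fr: "frame m r M \<Psi>" by (rule locally_free_frame[OF lm M(2)])
  obtain \<alpha> where P: "presents m r \<alpha> M \<Psi>" by (rule frame_presents[OF lm fr])
  then have "\<alpha> \<in> reps r r" "rigid_mod m r \<alpha>" "X = iso_class C (lev m) \<Omega> (vmod m r \<alpha>)"
    using M(3) by (simp_all add: presents_def rigid_iff_rigid_mod[OF P] X presents_iso_class[OF P])
  then show "X \<in> {iso_class C (lev m) \<Omega> (vmod m r \<alpha>) | r \<alpha>. \<alpha> \<in> reps r r \<and> rigid_mod m r \<alpha>}" by blast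
next
  fix X :: "('n, 'k) Hmod set" assume "X \<in> {iso_class C (lev m) \<Omega> (vmod m r \<alpha>) | r \<alpha>. \<alpha> \<in> reps r r \<and> rigid_mod m r \<alpha>}"
  then obtain r \<alpha> where X: "X = iso_class C (lev m) \<Omega> (vmod m r \<alpha>)" and \<alpha>: "\<alpha> \<in> reps r r" "rigid_mod m r \<alpha>" by auto
  obtain N :: "('n, 'k) Hmod" and \<Psi> where P: "presents m r \<alpha> N \<Psi>" using presents_exists[OF \<alpha>(1)] by blast
  then have fr: "frame m r N \<Psi>" by (simp add: presents_def)
  have "X = iso_class C (lev m) \<Omega> N" by (simp add: X presents_iso_class[OF P])
  then show "X \<in> rigid_locally_free_classes C (lev m) \<Omega>"
    unfolding rigid_locally_free_classes_def
    using frame_H_module[OF fr] frame_locally_free[OF fr] \<alpha>(2) rigid_iff_rigid_mod[OF P] by blast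
qed

text \<open>\<open>reduction_class\<close> is a union over the members of a class, so its value is
  meaningful only if there is one.\<close>

lemma iso_class_vmod_nonempty:
  assumes \<alpha>: "\<alpha> \<in> reps r r" shows "iso_class C (lev m) \<Omega> (vmod m r \<alpha>) \<noteq> {}"
proof -
  obtain N :: "('n, 'k) Hmod" and \<Psi> where P: "presents m r \<alpha> N \<Psi>" using presents_exists[OF \<alpha>] by blast
  then have fr: "frame m r N \<Psi>" by (simp add: presents_def)
  have "N \<in> iso_class C (lev m) \<Omega> (vmod m r \<alpha>)"
    using frame_H_module[OF fr] presents_unique[OF presents_vmod[OF \<alpha>] P] by (simp add: iso_class_def)
  then show ?thesis by blast
qed

text \<open>On parameters reduction is the identity: every member of the class is presented by the
  same \<open>\<alpha>\<close>, so all terms of the union coincide.\<close>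

lemma reduction_class_vmod:
  assumes \<alpha>: "\<alpha> \<in> reps r r" and m: "2 \<le> m"
  shows "reduction_class C c \<Omega> m (iso_class C (lev m) \<Omega> (vmod m r \<alpha>)) =
    iso_class C (lev (m - 1)) \<Omega> (vmod (m - 1) r \<alpha>)"
proof -
  interpret N: cartan_mult C c \<Omega> A "m - 1" by unfold_locales (use m in simp)
  have "iso_class C (lev (m - 1)) \<Omega> (reduction C c \<Omega> m M) = iso_class C (lev (m - 1)) \<Omega> (vmod (m - 1) r \<alpha>)"
    if M: "M \<in> iso_class C (lev m) \<Omega> (vmod m r \<alpha>)" for M
  proof -
    have lm: "left_module (R (lev m)) M" and iso: "lmod_isomorphic (R (lev m)) (vmod m r \<alpha>) M"
      using M by (auto simp: iso_class_def H_module_def)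
    obtain h where "h \<in> lmod_hom (R (lev m)) (vmod m r \<alpha>) M" "bij_betw h (carrier (vmod m r \<alpha>)) (carrier M)"
      using iso by (auto simp: lmod_isomorphic_def)
    note P = presents_transfer[OF presents_vmod[OF \<alpha>] lm this]
    show ?thesis
      by (rule N.iso_class_cong[OF N.left_module_vmod[OF \<alpha>] reduction_isomorphic[OF P m], symmetric])
  qed
  then show ?thesis
    unfolding reduction_class_def using iso_class_vmod_nonempty[OF \<alpha>] by auto
qed

end

section \<open>The bijection\<close>

context cartan
begin

theorem bij_betw_reduction_class:
  assumes k: "2 \<le> k"
  shows "bij_betw (reduction_class C c \<Omega> k) (rigid_locally_free_classes C (lev k) \<Omega> :: ('n, 'k) Hmod set set)
    (rigid_locally_free_classes C (lev (k - 1)) \<Omega>)"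
proof -
  interpret K: cartan_mult C c \<Omega> A k by unfold_locales (use k in simp)
  interpret L: cartan_mult C c \<Omega> A "k - 1" by unfold_locales (use k in simp)
  \<comment> \<open>Here \<open>2 \<le> k\<close> enters, as
    \<open>k \<le> (k - 1) + (k - 1)\<close>.\<close>
  have rig: "rigid_mod k r \<alpha> \<longleftrightarrow> rigid_mod (k - 1) r \<alpha>" if "\<alpha> \<in> reps r r" for r \<alpha>
    using rigid_mod_up[OF that, of "k - 1" k] rigid_mod_down[of k r \<alpha> "k - 1"] k by auto
  show ?thesis
    unfolding bij_betw_def
  proof
    show "inj_on (reduction_class C c \<Omega> k) (rigid_locally_free_classes C (lev k) \<Omega> :: ('n, 'k) Hmod set set)"
    proof (rule inj_onI)
      fix X Y :: "('n, 'k) Hmod set"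
      assume X: "X \<in> rigid_locally_free_classes C (lev k) \<Omega>" and Y: "Y \<in> rigid_locally_free_classes C (lev k) \<Omega>"
        and eq: "reduction_class C c \<Omega> k X = reduction_class C c \<Omega> k Y"
      obtain r \<alpha> where X': "X = iso_class C (lev k) \<Omega> (vmod k r \<alpha>)" and \<alpha>: "\<alpha> \<in> reps r r" "rigid_mod k r \<alpha>"
        using X unfolding K.rigid_locally_free_classes_eq by blast
      obtain r' \<beta> where Y': "Y = iso_class C (lev k) \<Omega> (vmod k r' \<beta>)" and \<beta>: "\<beta> \<in> reps r' r'"
        using Y unfolding K.rigid_locally_free_classes_eq by blast
      have "iso_class C (lev (k - 1)) \<Omega> (vmod (k - 1) r \<alpha>) = iso_class C (lev (k - 1)) \<Omega> (vmod (k - 1) r' \<beta>)"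
        using eq by (simp add: X' Y' K.reduction_class_vmod \<alpha> \<beta> k)
      then obtain N :: "('n, 'k) Hmod" where "lmod_isomorphic (R (lev (k - 1))) (vmod (k - 1) r \<alpha>) N"
        "lmod_isomorphic (R (lev (k - 1))) (vmod (k - 1) r' \<beta>) N"
        using L.iso_class_vmod_nonempty[OF \<alpha>(1)] by (auto simp: iso_class_def)
      then have "lmod_isomorphic (R (lev (k - 1))) (vmod (k - 1) r \<alpha>) (vmod (k - 1) r' \<beta>)"
        using lmod_isomorphic_trans lmod_isomorphic_sym[OF L.left_module_vmod[OF \<beta>]] by blast
      \<comment> \<open>The modules at both levels come from the same \<open>\<alpha>\<close> and
        \<open>\<beta>\<close>, so the isomorphism of the reductions lifts.\<close>
      then have "lmod_isomorphic (R (lev k)) (vmod k r \<alpha>) (vmod k r' \<beta>)"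
        using k \<alpha> rig
        by (intro lift_isomorphic[OF L.presents_vmod[OF \<alpha>(1)] L.presents_vmod[OF \<beta>] _ _
              K.presents_vmod[OF \<alpha>(1)] K.presents_vmod[OF \<beta>]]) auto
      then show "X = Y" unfolding X' Y' by (rule K.iso_class_cong[OF K.left_module_vmod[OF \<alpha>(1)]])
    qed
    show "reduction_class C c \<Omega> k ` rigid_locally_free_classes C (lev k) \<Omega> =
        (rigid_locally_free_classes C (lev (k - 1)) \<Omega> :: ('n, 'k) Hmod set set)"
    proof (intro equalityI subsetI)
      fix Y :: "('n, 'k) Hmod set" assume "Y \<in> reduction_class C c \<Omega> k ` rigid_locally_free_classes C (lev k) \<Omega>"
      then obtain r \<alpha> where "Y = reduction_class C c \<Omega> k (iso_class C (lev k) \<Omega> (vmod k r \<alpha>))"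
        and "\<alpha> \<in> reps r r" "rigid_mod k r \<alpha>"
        unfolding K.rigid_locally_free_classes_eq by blast
      then show "Y \<in> rigid_locally_free_classes C (lev (k - 1)) \<Omega>"
        unfolding L.rigid_locally_free_classes_eq using rig K.reduction_class_vmod[OF _ k] by blast
    next
      fix Y :: "('n, 'k) Hmod set" assume "Y \<in> rigid_locally_free_classes C (lev (k - 1)) \<Omega>"
      then obtain r \<alpha> where Y: "Y = iso_class C (lev (k - 1)) \<Omega> (vmod (k - 1) r \<alpha>)"
        and \<alpha>: "\<alpha> \<in> reps r r" "rigid_mod (k - 1) r \<alpha>"
        unfolding L.rigid_locally_free_classes_eq by blast
      then have "iso_class C (lev k) \<Omega> (vmod k r \<alpha>) \<in> (rigid_locally_free_classes C (lev k) \<Omega> :: ('n, 'k) Hmod set set)"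
        unfolding K.rigid_locally_free_classes_eq using rig by blast
      moreover have "Y = reduction_class C c \<Omega> k (iso_class C (lev k) \<Omega> (vmod k r \<alpha>))"
        by (simp only: Y K.reduction_class_vmod[OF \<alpha>(1) k])
      ultimately show "Y \<in> reduction_class C c \<Omega> k ` rigid_locally_free_classes C (lev k) \<Omega>" by blast
    qed
  qed
qed

end

theorem proposition3p2:
  fixes C :: "int^'n::finite^'n" and c :: "'n \<Rightarrow> nat" and \<Omega> :: "('n \<times> 'n) set" and k :: nat
  assumes "generalized_cartan_matrix C" and "symmetrizer C c" and "orientation C \<Omega>"
    and "k \<ge> 2"
  shows "bij_betw (reduction_class C c \<Omega> k)
    (rigid_locally_free_classes C (\<lambda>i. k * c i) \<Omega> :: ('n, 'k::alg_closed_field) Hmod set set)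
    (rigid_locally_free_classes C (\<lambda>i. (k - 1) * c i) \<Omega>)"
proof -
  interpret cartan C c \<Omega> "KQ C \<Omega> :: ('n, 'k) KQ ring"
    by (rule cartan.intro[OF assms(1-3) refl])
  show ?thesis by (rule bij_betw_reduction_class[OF assms(4)])
qed

end
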